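(* Let $n\ge1$, let $H$ and $L$ be Hermitian $n\times n$ matrices with $[H,L]=0$, and let $0<\eta\le1$. Write $L=\sum_{k=1}^{K}\lambda_kP_k$ and $H=\sum_{j=1}^{D}\beta_jQ_j$ with $\lambda_k,\beta_j\in\mathbb{R}$, where the $P_k$ (resp. $Q_j$) are Hermitian orthogonal projections with $P_kP_l=\delta_{kl}P_l$ (resp. $Q_jQ_l=\delta_{jl}Q_l$) and $[P_k,Q_j]=0$ for all $k,j$. Let $W_t$ be a standard one-dimensional Wiener process and let $\rho_t$ be the solution, with initial condition a density matrix $\rho_0$, of the quantum filter equation $$d\rho_t=-i[H,\rho_t]dt+\Big(L\rho_tL^\dagger-\tfrac12(L^\dagger L\rho_t+\rho_tL^\dagger L)\Big)dt+\sqrt\eta\Big(L\rho_t+\rho_tL^\dagger-\mathrm{Tr}\big((L+L^\dagger)\rho_t\big)\rho_t\Big)dW_t,$$ and let the observation process be $dY_t=dW_t+\sqrt\eta\,\mathrm{Tr}\big((L+L^\dagger)\rho_t\big)dt$. For $\phi=(\theta,\gamma,\alpha)$ with $\theta\in\mathbb{R}^K$, $\gamma\in\mathbb{R}^D$, $\alpha=(\alpha_{kj})_{1\le k\le j\le K}$, define $L_\theta=\sum_k\theta_kP_k$, $H_\gamma=\sum_j\gamma_jQ_j$, $$\rho_\alpha=\rho_0+\sum_{1\le k\le j\le K}\big(P_k\rho_0P_j+(1-\delta_{kj})P_j\rho_0P_k\big)\big(e^{\alpha_{kj}}-1\big),\qquad \tilde\rho_\phi=e^{\frac12L_\theta+\frac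 i2H_\gamma}\rho_\alpha e^{\frac12L_\theta-\frac i2H_\gamma}.$$ Let $\phi(t)=(\theta(t),\gamma(t),\alpha(t))$, where $\theta_k(t)$ solves $d\theta_k(t)=-(1+\eta)\lambda_k^2dt+2\sqrt\eta\lambda_kdY_t$, $\theta_k(0)=0$, and $\gamma_j(t)=-2\beta_jt$, $\alpha_{kj}(t)=(1-\eta)\lambda_k\lambda_jt$. Then for all $t\ge0$, $\rho_t=\tilde\rho_{\phi(t)}/\mathrm{Tr}(\tilde\rho_{\phi(t)})$ almost surely.
   Context: $[A,B]=AB-BA$, $A^\dagger$ is the conjugate transpose, $\delta_{kj}$ is the Kronecker delta. Density matrices are Hermitian positive semidefinite matrices of trace one. *)

theory Defs
  imports "HOL-Analysis.Analysis" "HOL-Probability.Probability"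
begin

type_synonym 'n cmat = "complex ^ 'n ^ 'n"

definition cadj :: "'n::finite cmat \<Rightarrow> 'n cmat" where
  "cadj A = (\<chi> i j. cnj (A $ j $ i))"

definition hermitian :: "'n::finite cmat \<Rightarrow> bool" where
  "hermitian A \<longleftrightarrow> cadj A = A"

definition mtrace :: "'n::finite cmat \<Rightarrow> complex" where
  "mtrace A = (\<Sum>i\<in>UNIV. A $ i $ i)"

definition commutator :: "'n::finite cmat \<Rightarrow> 'n cmat \<Rightarrow> 'n cmat" where
  "commutator A B = A ** B - B ** A"

definition csmult :: "complex \<Rightarrow> 'n::finite cmat \<Rightarrow> 'n cmat" where
  "csmult c A = (\<chi> i j. c * A $ i $ j)"

fun mpow :: "'n::finite cmat \<Rightarrow> nat \<Rightarrow> 'n cmat" where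
  "mpow A 0 = mat 1"
| "mpow A (Suc k) = A ** mpow A k"

definition mexp :: "'n::finite cmat \<Rightarrow> 'n cmat" where
  "mexp A = (\<Sum>k. (1 / fact k) *\<^sub>R mpow A k)"

definition psd :: "'n::finite cmat \<Rightarrow> bool" where
  "psd A \<longleftrightarrow> hermitian A \<and>
     (\<forall>v :: complex ^ 'n. 0 \<le> Re (\<Sum>i\<in>UNIV. \<Sum>j\<in>UNIV. cnj (v $ i) * A $ i $ j * v $ j))"

definition density_matrix :: "'n::finite cmat \<Rightarrow> bool" where
  "density_matrix A \<longleftrightarrow> psd A \<and> mtrace A = 1"

definition kdelta :: "nat \<Rightarrow> nat \<Rightarrow> real" where
  "kdelta k j = (if k = j then 1 else 0)"

definition wiener_process :: "'a measure \<Rightarrow> (real \<Rightarrow> 'a measure) \<Rightarrow> (real \<Rightarrow> 'a \<Rightarrow> real) \<Rightarrow> bool" where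
  "wiener_process M F W \<longleftrightarrow>
     prob_space M \<and> filtration (space M) F \<and> (\<forall>t. subalgebra M (F t)) \<and>
     (\<forall>\<omega>\<in>space M. W 0 \<omega> = 0) \<and>
     (\<forall>\<omega>\<in>space M. continuous_on {0..} (\<lambda>t. W t \<omega>)) \<and>
     (\<forall>t\<ge>0. W t \<in> borel_measurable (F t)) \<and>
     (\<forall>s t. 0 \<le> s \<and> s < t \<longrightarrow>
        distributed M lborel (\<lambda>\<omega>. W t \<omega> - W s \<omega>) (normal_density 0 (sqrt (t - s))) \<and>
        (\<forall>A\<in>sets (F s). \<forall>B\<in>sets (borel :: real measure).
           measure M (A \<inter> {\<omega>\<in>space M. W t \<omega> - W s \<omega> \<in> B})
             = measure M A * measure M {\<omega>\<in>space M. W t \<omega> - W s \<omega> \<in> B}))"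

definition riemann_sum :: "(real \<Rightarrow> 'a \<Rightarrow> 'b::real_vector) \<Rightarrow> (real \<Rightarrow> 'a \<Rightarrow> real)
    \<Rightarrow> real \<Rightarrow> nat \<Rightarrow> 'a \<Rightarrow> 'b" where
  "riemann_sum X W t N \<omega> =
     (\<Sum>i<N. (W (t * real (Suc i) / real N) \<omega> - W (t * real i / real N) \<omega>)
              *\<^sub>R X (t * real i / real N) \<omega>)"

text \<open>I is the Ito integral of the (continuous, adapted) integrand X against W over
  [0,t]: I is a random variable and the left-point Riemann sums converge to I in
  probability.  For continuous adapted integrands this coincides with the Ito integral.\<close>
definition is_ito_integral :: "'a measure \<Rightarrow> (real \<Rightarrow> 'a \<Rightarrow> 'b::euclidean_space)
    \<Rightarrow> (real \<Rightarrow> 'a \<Rightarrow> real) \<Rightarrow> real \<Rightarrow> ('a \<Rightarrow> 'b) \<Rightarrow> bool" where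
  "is_ito_integral M X W t I \<longleftrightarrow>
     I \<in> borel_measurable M \<and>
     (\<forall>e>0. (\<lambda>N. measure M {\<omega>\<in>space M. e < norm (riemann_sum X W t N \<omega> - I \<omega>)})
              \<longlonglongrightarrow> 0)"

definition qf_drift :: "'n::finite cmat \<Rightarrow> 'n cmat \<Rightarrow> 'n cmat \<Rightarrow> 'n cmat" where
  "qf_drift H L \<rho> =
     csmult (-\<i>) (commutator H \<rho>) + L ** \<rho> ** cadj L
     - (1/2) *\<^sub>R (cadj L ** L ** \<rho> + \<rho> ** cadj L ** L)"

definition qf_diffusion :: "real \<Rightarrow> 'n::finite cmat \<Rightarrow> 'n cmat \<Rightarrow> 'n cmat" where
  "qf_diffusion \<eta> L \<rho> =
     sqrt \<eta> *\<^sub>R (L ** \<rho> + \<rho> ** cadj L - csmult (mtrace ((L + cadj L) ** \<rho>)) \<rho>)"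

definition solves_quantum_filter ::
  "'a measure \<Rightarrow> (real \<Rightarrow> 'a measure) \<Rightarrow> (real \<Rightarrow> 'a \<Rightarrow> real) \<Rightarrow> real \<Rightarrow>
   'n::finite cmat \<Rightarrow> 'n cmat \<Rightarrow> 'n cmat \<Rightarrow> (real \<Rightarrow> 'a \<Rightarrow> 'n cmat) \<Rightarrow> bool" where
  "solves_quantum_filter M F W \<eta> H L \<rho>0 \<rho> \<longleftrightarrow>
     (\<forall>\<omega>\<in>space M. \<rho> 0 \<omega> = \<rho>0) \<and>
     (\<forall>\<omega>\<in>space M. continuous_on {0..} (\<lambda>t. \<rho> t \<omega>)) \<and>
     (\<forall>t\<ge>0. \<rho> t \<in> borel_measurable (F t)) \<and>
     (\<forall>t\<ge>0. \<exists>I. is_ito_integral M (\<lambda>s \<omega>. qf_diffusion \<eta> L (\<rho> s \<omega>)) W t I \<and>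
        (AE \<omega> in M. \<rho> t \<omega> = \<rho>0 + integral {0..t} (\<lambda>s. qf_drift H L (\<rho> s \<omega>)) + I \<omega>))"

definition obs_process :: "(real \<Rightarrow> 'a \<Rightarrow> real) \<Rightarrow> real \<Rightarrow> 'n::finite cmat
    \<Rightarrow> (real \<Rightarrow> 'a \<Rightarrow> 'n cmat) \<Rightarrow> real \<Rightarrow> 'a \<Rightarrow> real" where
  "obs_process W \<eta> L \<rho> t \<omega> =
     W t \<omega> + integral {0..t} (\<lambda>s. sqrt \<eta> * Re (mtrace ((L + cadj L) ** \<rho> s \<omega>)))"

definition rho_alpha :: "nat \<Rightarrow> (nat \<Rightarrow> 'n::finite cmat) \<Rightarrow> 'n cmat \<Rightarrow> (nat \<Rightarrow> nat \<Rightarrow> real) \<Rightarrow> 'n cmat" where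
  "rho_alpha K P \<rho>0 \<alpha> = \<rho>0 +
     (\<Sum>(k, j)\<in>{(k, j). k \<le> j \<and> j < K}.
        (exp (\<alpha> k j) - 1) *\<^sub>R (P k ** \<rho>0 ** P j + (1 - kdelta k j) *\<^sub>R (P j ** \<rho>0 ** P k)))"

definition rho_tilde :: "nat \<Rightarrow> (nat \<Rightarrow> 'n::finite cmat) \<Rightarrow> nat \<Rightarrow> (nat \<Rightarrow> 'n cmat) \<Rightarrow> 'n cmat
    \<Rightarrow> (nat \<Rightarrow> real) \<Rightarrow> (nat \<Rightarrow> real) \<Rightarrow> (nat \<Rightarrow> nat \<Rightarrow> real) \<Rightarrow> 'n cmat" where
  "rho_tilde K P D Q \<rho>0 \<theta> \<gamma> \<alpha> =
     (let L\<theta> = (\<Sum>k<K. \<theta> k *\<^sub>R P k); H\<gamma> = (\<Sum>j<D. \<gamma> j *\<^sub>R Q j) in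
      mexp ((1/2) *\<^sub>R L\<theta> + csmult (\<i>/2) H\<gamma>) ** rho_alpha K P \<rho>0 \<alpha>
        ** mexp ((1/2) *\<^sub>R L\<theta> - csmult (\<i>/2) H\<gamma>))"

end

theory Submission
  imports Defs
begin

text \<open>
  In a joint eigenbasis of \<open>H\<close> and \<open>L\<close> every block \<open>E\<^sub>i \<rho> E\<^sub>j\<close>, every population \<open>Tr (E\<^sub>i \<rho>)\<close> and also
  \<open>1 - Tr \<rho>\<close> solve a scalar equation \<open>dX = a X dt + c (s - \<mu>) X dW\<close> with \<open>c = sqrt \<eta>\<close> and the same random
  coefficient \<open>\<mu> = Tr ((L + cadj L) \<rho>)\<close>. After dividing \<open>X\<close> by the explicit exponential
  \<open>exp (c s Y + (a - c\<^sup>2 s\<^sup>2 / 2) t)\<close> of \<open>Y = W + c \<integral> \<mu> dt\<close>, all of them solve one and the same equation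
  \<open>dS = - c \<mu> S dW\<close>, so the quotient of two of them is constant as long as the denominator does not vanish.
  Neither the Ito formula nor a uniqueness theorem is needed: the quotient telescopes over a grid, and
  orthogonality of the Wiener increments shows that the sum of its increments tends to \<open>0\<close> in probability.
  Taking a population as denominator, \<open>Tr \<rho> = 1\<close> and \<open>\<rho>\<close> is proportional to the claimed matrix until the
  first zero of the denominator; at such a zero all populations would vanish while \<open>Tr \<rho> = 1\<close>, so there
  is none. Finally \<open>Y\<close>, a priori complex, is real by a Gronwall argument, hence it is the observation process.
\<close>

text \<open>The Ito integral is available only time by time, as a limit in probability of left-point
  sums over uniform grids of \<open>[0, t]\<close>. It is not given as a process, no moment bound on
  the solution is assumed, and Hermiticity or positivity of \<open>\<rho>\<close> at positive times
  is not part of what it means to solve the equation. Hence boundedness is imposed path by path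
  through a cutoff, all required sums are made to converge almost surely along one common
  subsequence, and what is left is a deterministic argument on a single path.

  The claimed coefficients can be read off the exponential. A block between eigenvalues
  \<open>x\<close> and \<open>y\<close> of \<open>L\<close> has \<open>s = x + y\<close> and real
  drift rate \<open>- (x - y)^2 / 2\<close>. With \<open>c^2 = \<eta>\<close> the rate in the
  exponent is \<open>- (x - y)^2 / 2 - \<eta> (x + y)^2 / 2 = - (1 + \<eta>) (x^2 + y^2) / 2 + (1 -
  \<eta>) x y\<close>. The squares are shared by the two outer matrix exponentials and give the
  drift of \<open>\<theta>\<close>; the mixed term is \<open>\<alpha>\<close>.\<close>

abbreviation grid :: "real \<Rightarrow> nat \<Rightarrow> nat \<Rightarrow> real" where
  "grid t n i \<equiv> t * real i / real n"

section \<open>Increments of the Wiener process\<close>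

locale wiener =
  fixes M :: "'a measure" and F :: "real \<Rightarrow> 'a measure" and W :: "real \<Rightarrow> 'a \<Rightarrow> real"
  assumes wiener_process: "wiener_process M F W"
begin

lemma prob_space_M: "prob_space M"
  using wiener_process by (simp add: wiener_process_def)

sublocale prob_space M
  by (rule prob_space_M)

lemma subalgebra_F: "subalgebra M (F t)"
  using wiener_process by (simp add: wiener_process_def)

lemma subalgebra_F_mono: "s \<le> t \<Longrightarrow> subalgebra (F t) (F s)"
  using wiener_process
  by (auto simp: wiener_process_def filtration_def subalgebra_def)

lemma measurable_F_mono: "f \<in> measurable (F s) N \<Longrightarrow> s \<le> t \<Longrightarrow> f \<in> measurable (F t) N"
  using subalgebra_F_mono measurable_from_subalg by blast

lemma measurable_F_M: "f \<in> measurable (F s) N \<Longrightarrow> f \<in> measurable M N"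
  using subalgebra_F measurable_from_subalg by blast

lemma W_measurable: "0 \<le> t \<Longrightarrow> W t \<in> borel_measurable (F t)"
  using wiener_process by (simp add: wiener_process_def)

lemma W_continuous: "\<omega> \<in> space M \<Longrightarrow> continuous_on {0..} (\<lambda>t. W t \<omega>)"
  using wiener_process by (simp add: wiener_process_def)

lemma increment_distributed:
  "0 \<le> s \<Longrightarrow> s < t \<Longrightarrow> distributed M lborel (\<lambda>\<omega>. W t \<omega> - W s \<omega>) (normal_density 0 (sqrt (t - s)))"
  using wiener_process by (simp add: wiener_process_def)

text \<open>The product rule in \<open>wiener_process\<close> concerns single events. Preimages of
  Borel sets form intersection-stable families, so it extends to the generated sigma-algebras. The
  function \<open>g\<close> serves both the increment itself and its centred square.\<close>

lemma increment_indep: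
  fixes f :: "'a \<Rightarrow> real" and g :: "real \<Rightarrow> real"
  assumes st: "0 \<le> s" "s < t" and f: "f \<in> borel_measurable (F s)" and g: "g \<in> borel_measurable borel"
  shows "indep_var borel f borel (\<lambda>\<omega>. g (W t \<omega> - W s \<omega>))"
proof -
  let ?D = "\<lambda>\<omega>. W t \<omega> - W s \<omega>"
  have D: "?D \<in> borel_measurable M"
    using increment_distributed[OF st] by (auto simp: distributed_def)
  have fM: "f \<in> borel_measurable M" using f measurable_F_M by blast
  have spF: "space (F s) = space M" using subalgebra_F by (simp add: subalgebra_def)
  have "indep_set (sigma_sets (space M) {f -` A \<inter> space M |A. A \<in> sets borel})
     (sigma_sets (space M) {?D -` A \<inter> space M |A. A \<in> sets borel})"
  proof (rule indep_set_sigma_sets)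
    show "Int_stable {f -` A \<inter> space M |A. A \<in> sets borel}"
      unfolding Int_stable_def
    proof clarsimp
      fix A B :: "real set" assume "A \<in> sets borel" "B \<in> sets borel"
      then show "\<exists>C. f -` A \<inter> space M \<inter> (f -` B \<inter> space M) = f -` C \<inter> space M \<and> C \<in> sets borel"
        by (intro exI[of _ "A \<inter> B"]) auto
    qed
    show "Int_stable {?D -` A \<inter> space M |A. A \<in> sets borel}"
      unfolding Int_stable_def
    proof clarsimp
      fix A B :: "real set" assume "A \<in> sets borel" "B \<in> sets borel"
      then show "\<exists>C. ?D -` A \<inter> space M \<inter> (?D -` B \<inter> space M) = ?D -` C \<inter> space M \<and> C \<in> sets borel"
        by (intro exI[of _ "A \<inter> B"]) auto
    qed
    show "indep_set {f -` A \<inter> space M |A. A \<in> sets borel} {?D -` A \<inter> space M |A. A \<in> sets borel}"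
    proof (rule indep_setI)
      show "{f -` A \<inter> space M |A. A \<in> sets borel} \<subseteq> events" using fM by auto
      show "{?D -` A \<inter> space M |A. A \<in> sets borel} \<subseteq> events" using D by auto
      fix a b assume a: "a \<in> {f -` A \<inter> space M |A. A \<in> sets borel}"
        and b: "b \<in> {?D -` A \<inter> space M |A. A \<in> sets borel}"
      from a obtain A where A: "a = f -` A \<inter> space M" "A \<in> sets borel" by auto
      from b obtain B where B: "b = ?D -` B \<inter> space M" "B \<in> sets borel" by auto
      have aF: "a \<in> sets (F s)" using A f spF by (metis measurable_sets)
      have "b = {\<omega>\<in>space M. ?D \<omega> \<in> B}" using B by auto
      then show "prob (a \<inter> b) = prob a * prob b"
        using wiener_process st aF B(2) unfolding wiener_process_def by blast
    qed
  qed
  then have "indep_var borel f borel ?D"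
    unfolding indep_var_eq using D fM by simp
  then have "indep_var borel ((\<lambda>x. x) \<circ> f) borel (g \<circ> ?D)"
    by (rule indep_var_compose) (use g in auto)
  then show ?thesis by (simp add: comp_def)
qed

lemma increment_power:
  assumes st: "0 \<le> s" "s < t"
  shows "integrable M (\<lambda>\<omega>. (W t \<omega> - W s \<omega>) ^ k)"
    and "expectation (\<lambda>\<omega>. (W t \<omega> - W s \<omega>) ^ k) = (\<integral>x. normal_density 0 (sqrt (t - s)) x * x ^ k \<partial>lborel)"
proof -
  have "integrable lborel (\<lambda>x. normal_density 0 (sqrt (t - s)) x * x ^ k)"
    using integrable_normal_moment[of "sqrt (t - s)" 0 k] st by simp
  then show "integrable M (\<lambda>\<omega>. (W t \<omega> - W s \<omega>) ^ k)"
    by (subst (asm) distributed_integrable[OF increment_distributed[OF st]]) auto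
  show "expectation (\<lambda>\<omega>. (W t \<omega> - W s \<omega>) ^ k) = (\<integral>x. normal_density 0 (sqrt (t - s)) x * x ^ k \<partial>lborel)"
    by (subst distributed_integral[OF increment_distributed[OF st]]) auto
qed

lemma increment_mean: "0 \<le> s \<Longrightarrow> s < t \<Longrightarrow> expectation (\<lambda>\<omega>. W t \<omega> - W s \<omega>) = 0"
  using increment_power(2)[of s t 1] integral_normal_moment_odd[of "sqrt (t - s)" 0 0] by simp

lemma increment_variance: "0 \<le> s \<Longrightarrow> s < t \<Longrightarrow> expectation (\<lambda>\<omega>. (W t \<omega> - W s \<omega>)\<^sup>2) = t - s"
  using increment_power(2)[of s t 2] integral_normal_moment_even[of "sqrt (t - s)" 0 1]
  by (simp add: power2_eq_square)

lemma increment_fourth: "0 \<le> s \<Longrightarrow> s < t \<Longrightarrow> expectation (\<lambda>\<omega>. (W t \<omega> - W s \<omega>) ^ 4) = 3 * (t - s)\<^sup>2"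
  using increment_power(2)[of s t 4] integral_normal_moment_even[of "sqrt (t - s)" 0 2]
  by (simp add: power2_eq_square fact_numeral field_simps)

text \<open>Discrete Ito isometry. When a term is added to a partial sum, the mixed term has mean
  zero: the partial sum times \<open>\<xi> k\<close> is known at time \<open>\<tau> k\<close>, and
  the next increment is independent of that past. The function \<open>g\<close> is the identity for
  stochastic sums and the centred square for the quadratic variation.\<close>

lemma orthogonal_increments_real:
  fixes \<xi> :: "nat \<Rightarrow> 'a \<Rightarrow> real" and \<tau> :: "nat \<Rightarrow> real" and g :: "nat \<Rightarrow> real \<Rightarrow> real"
  assumes \<tau>0: "0 \<le> \<tau> 0" and \<tau>: "\<And>i. \<tau> i < \<tau> (Suc i)"
    and \<xi>: "\<And>i. i < m \<Longrightarrow> \<xi> i \<in> borel_measurable (F (\<tau> i))"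
    and bnd: "\<And>i \<omega>. i < m \<Longrightarrow> \<bar>\<xi> i \<omega>\<bar> \<le> C"
    and g: "\<And>i. g i \<in> borel_measurable borel"
    and g2: "\<And>i. integrable M (\<lambda>\<omega>. (g i (W (\<tau> (Suc i)) \<omega> - W (\<tau> i) \<omega>))\<^sup>2)"
    and g1: "\<And>i. expectation (\<lambda>\<omega>. g i (W (\<tau> (Suc i)) \<omega> - W (\<tau> i) \<omega>)) = 0"
  defines "N \<equiv> \<lambda>i \<omega>. g i (W (\<tau> (Suc i)) \<omega> - W (\<tau> i) \<omega>)"
  shows "integrable M (\<lambda>\<omega>. (\<Sum>i<m. \<xi> i \<omega> * N i \<omega>)\<^sup>2) \<and>
     expectation (\<lambda>\<omega>. (\<Sum>i<m. \<xi> i \<omega> * N i \<omega>)\<^sup>2)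
       = (\<Sum>i<m. expectation (\<lambda>\<omega>. (\<xi> i \<omega>)\<^sup>2) * expectation (\<lambda>\<omega>. (N i \<omega>)\<^sup>2))"
proof -
  have \<tau>pos: "0 \<le> \<tau> i" for i
    by (induction i) (use \<tau>0 \<tau> in \<open>auto intro: order_trans less_imp_le\<close>)
  have \<tau>mono: "i \<le> j \<Longrightarrow> \<tau> i \<le> \<tau> j" for i j
    by (rule lift_Suc_mono_le[of \<tau>]) (use \<tau> in \<open>auto intro: less_imp_le\<close>)
  have NF: "N i \<in> borel_measurable (F (\<tau> (Suc i)))" for i
  proof -
    have "W (\<tau> i) \<in> borel_measurable (F (\<tau> (Suc i)))"
      using W_measurable[OF \<tau>pos[of i]] measurable_F_mono \<tau>mono[of i "Suc i"] by auto
    moreover have "W (\<tau> (Suc i)) \<in> borel_measurable (F (\<tau> (Suc i)))"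
      using W_measurable[OF \<tau>pos] .
    ultimately have "(\<lambda>\<omega>. W (\<tau> (Suc i)) \<omega> - W (\<tau> i) \<omega>) \<in> borel_measurable (F (\<tau> (Suc i)))"
      by simp
    then show ?thesis unfolding N_def by (rule measurable_compose) (use g in auto)
  qed
  have N2: "integrable M (\<lambda>\<omega>. (N i \<omega>)\<^sup>2)" for i using g2 by (simp add: N_def)
  have NM: "N i \<in> borel_measurable M" for i using NF measurable_F_M by blast
  have N1: "integrable M (N i)" for i
    using N2 NM square_integrable_imp_integrable by blast
  \<comment> \<open>Adaptedness of the partial sum is carried through the induction because
    independence of the next increment relies on it; the bound \<open>C\<close> makes its product
    with \<open>\<xi> k\<close> integrable.\<close>
  have step: "k \<le> m \<Longrightarrow> (\<lambda>\<omega>. \<Sum>i<k. \<xi> i \<omega> * N i \<omega>) \<in> borel_measurable (F (\<tau> k)) \<and>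
     integrable M (\<lambda>\<omega>. (\<Sum>i<k. \<xi> i \<omega> * N i \<omega>)\<^sup>2) \<and>
     expectation (\<lambda>\<omega>. (\<Sum>i<k. \<xi> i \<omega> * N i \<omega>)\<^sup>2)
       = (\<Sum>i<k. expectation (\<lambda>\<omega>. (\<xi> i \<omega>)\<^sup>2) * expectation (\<lambda>\<omega>. (N i \<omega>)\<^sup>2))" for k
  proof (induction k)
    case 0
    then show ?case by simp
  next
    case (Suc k)
    define S where "S = (\<lambda>\<omega>. \<Sum>i<k. \<xi> i \<omega> * N i \<omega>)"
    have km: "k < m" using Suc by simp
    have SF: "S \<in> borel_measurable (F (\<tau> k))" and S2: "integrable M (\<lambda>\<omega>. (S \<omega>)\<^sup>2)"
      and ES: "expectation (\<lambda>\<omega>. (S \<omega>)\<^sup>2) = (\<Sum>i<k. expectation (\<lambda>\<omega>. (\<xi> i \<omega>)\<^sup>2) * expectation (\<lambda>\<omega>. (N i \<omega>)\<^sup>2))"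
      using Suc unfolding S_def by auto
    have SM: "S \<in> borel_measurable M" using SF measurable_F_M by blast
    have S1: "integrable M S" using S2 SM square_integrable_imp_integrable by blast
    have xF: "\<xi> k \<in> borel_measurable (F (\<tau> k))" using \<xi> km by simp
    have xM: "\<xi> k \<in> borel_measurable M" using xF measurable_F_M by blast
    have x2: "integrable M (\<lambda>\<omega>. (\<xi> k \<omega>)\<^sup>2)"
    proof (rule integrable_const_bound[of _ "C\<^sup>2"])
      show "AE \<omega> in M. norm ((\<xi> k \<omega>)\<^sup>2) \<le> C\<^sup>2"
        using bnd[OF km] by (intro AE_I2) (metis abs_ge_zero abs_le_square_iff abs_of_nonneg norm_power power2_abs real_norm_def order_trans)
    qed (use xM in auto)
    have Sx: "integrable M (\<lambda>\<omega>. S \<omega> * \<xi> k \<omega>)"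
    proof (rule Bochner_Integration.integrable_bound[of _ "\<lambda>\<omega>. C * S \<omega>"])
      show "AE \<omega> in M. norm (S \<omega> * \<xi> k \<omega>) \<le> norm (C * S \<omega>)"
        using bnd[OF km] by (intro AE_I2) (metis abs_ge_zero abs_mult abs_of_nonneg mult.commute mult_right_mono order_trans real_norm_def)
    qed (use S1 SM xM in auto)
    have t: "0 \<le> \<tau> k" "\<tau> k < \<tau> (Suc k)" using \<tau>pos \<tau> by auto
    have i1: "indep_var borel (\<lambda>\<omega>. S \<omega> * \<xi> k \<omega>) borel (N k)"
      unfolding N_def by (rule increment_indep[OF t]) (use SF xF g in auto)
    have i2: "indep_var borel (\<lambda>\<omega>. (\<xi> k \<omega>)\<^sup>2) borel (\<lambda>\<omega>. (N k \<omega>)\<^sup>2)"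
      unfolding N_def by (rule increment_indep[OF t]) (use xF g in auto)
    have c1: "integrable M (\<lambda>\<omega>. (S \<omega> * \<xi> k \<omega>) * N k \<omega>)"
      "expectation (\<lambda>\<omega>. (S \<omega> * \<xi> k \<omega>) * N k \<omega>) = 0"
      using indep_var_integrable[OF i1 Sx N1] indep_var_lebesgue_integral[OF i1 Sx N1] g1
      by (auto simp: N_def)
    have c2: "integrable M (\<lambda>\<omega>. (\<xi> k \<omega>)\<^sup>2 * (N k \<omega>)\<^sup>2)"
      "expectation (\<lambda>\<omega>. (\<xi> k \<omega>)\<^sup>2 * (N k \<omega>)\<^sup>2) = expectation (\<lambda>\<omega>. (\<xi> k \<omega>)\<^sup>2) * expectation (\<lambda>\<omega>. (N k \<omega>)\<^sup>2)"
      using indep_var_integrable[OF i2 x2 N2] indep_var_lebesgue_integral[OF i2 x2 N2] by auto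
    have eq: "(\<lambda>\<omega>. (\<Sum>i<Suc k. \<xi> i \<omega> * N i \<omega>)\<^sup>2) =
      (\<lambda>\<omega>. (S \<omega>)\<^sup>2 + 2 * ((S \<omega> * \<xi> k \<omega>) * N k \<omega>) + (\<xi> k \<omega>)\<^sup>2 * (N k \<omega>)\<^sup>2)"
      by (rule ext) (simp add: S_def power2_eq_square algebra_simps)
    have "S \<in> borel_measurable (F (\<tau> (Suc k)))" "\<xi> k \<in> borel_measurable (F (\<tau> (Suc k)))"
      using SF xF measurable_F_mono t by (blast intro: less_imp_le)+
    then have "(\<lambda>\<omega>. S \<omega> + \<xi> k \<omega> * N k \<omega>) \<in> borel_measurable (F (\<tau> (Suc k)))"
      using NF by (intro borel_measurable_add borel_measurable_times)
    then have "(\<lambda>\<omega>. \<Sum>i<Suc k. \<xi> i \<omega> * N i \<omega>) \<in> borel_measurable (F (\<tau> (Suc k)))"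
      by (simp add: S_def)
    moreover have "integrable M (\<lambda>\<omega>. (\<Sum>i<Suc k. \<xi> i \<omega> * N i \<omega>)\<^sup>2)"
      unfolding eq using S2 c1 c2 by (intro Bochner_Integration.integrable_add integrable_mult_right) auto
    moreover have "expectation (\<lambda>\<omega>. (\<Sum>i<Suc k. \<xi> i \<omega> * N i \<omega>)\<^sup>2) =
        (\<Sum>i<Suc k. expectation (\<lambda>\<omega>. (\<xi> i \<omega>)\<^sup>2) * expectation (\<lambda>\<omega>. (N i \<omega>)\<^sup>2))"
    proof -
      have "expectation (\<lambda>\<omega>. (S \<omega>)\<^sup>2 + 2 * ((S \<omega> * \<xi> k \<omega>) * N k \<omega>) + (\<xi> k \<omega>)\<^sup>2 * (N k \<omega>)\<^sup>2)
        = expectation (\<lambda>\<omega>. (S \<omega>)\<^sup>2) + 2 * expectation (\<lambda>\<omega>. (S \<omega> * \<xi> k \<omega>) * N k \<omega>)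
          + expectation (\<lambda>\<omega>. (\<xi> k \<omega>)\<^sup>2 * (N k \<omega>)\<^sup>2)"
        using S2 c1(1) c2(1) by simp
      then show ?thesis unfolding eq using ES c1(2) c2(2) by simp
    qed
    ultimately show ?case by blast
  qed
  from step[of m] show ?thesis by blast
qed

text \<open>The increments are real, so real and imaginary parts are two real sums of the same kind,
  and the squared modulus adds their squares.\<close>

lemma orthogonal_increments:
  fixes \<xi> :: "nat \<Rightarrow> 'a \<Rightarrow> complex" and \<tau> :: "nat \<Rightarrow> real" and g :: "nat \<Rightarrow> real \<Rightarrow> real"
  assumes \<tau>0: "0 \<le> \<tau> 0" and \<tau>: "\<And>i. \<tau> i < \<tau> (Suc i)"
    and \<xi>: "\<And>i. i < m \<Longrightarrow> \<xi> i \<in> borel_measurable (F (\<tau> i))"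
    and bnd: "\<And>i \<omega>. i < m \<Longrightarrow> norm (\<xi> i \<omega>) \<le> C"
    and g: "\<And>i. g i \<in> borel_measurable borel"
    and g2: "\<And>i. integrable M (\<lambda>\<omega>. (g i (W (\<tau> (Suc i)) \<omega> - W (\<tau> i) \<omega>))\<^sup>2)"
    and g1: "\<And>i. expectation (\<lambda>\<omega>. g i (W (\<tau> (Suc i)) \<omega> - W (\<tau> i) \<omega>)) = 0"
  defines "N \<equiv> \<lambda>i \<omega>. g i (W (\<tau> (Suc i)) \<omega> - W (\<tau> i) \<omega>)"
  shows "integrable M (\<lambda>\<omega>. (norm (\<Sum>i<m. \<xi> i \<omega> * of_real (N i \<omega>)))\<^sup>2)"
    and "expectation (\<lambda>\<omega>. (norm (\<Sum>i<m. \<xi> i \<omega> * of_real (N i \<omega>)))\<^sup>2)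
       = (\<Sum>i<m. expectation (\<lambda>\<omega>. (norm (\<xi> i \<omega>))\<^sup>2) * expectation (\<lambda>\<omega>. (N i \<omega>)\<^sup>2))"
proof -
  have xM: "\<xi> i \<in> borel_measurable M" if "i < m" for i using \<xi>[OF that] measurable_F_M by blast
  have eq: "(norm (\<Sum>i<m. \<xi> i \<omega> * of_real (N i \<omega>)))\<^sup>2 =
    (\<Sum>i<m. Re (\<xi> i \<omega>) * N i \<omega>)\<^sup>2 + (\<Sum>i<m. Im (\<xi> i \<omega>) * N i \<omega>)\<^sup>2" for \<omega>
    by (simp add: cmod_power2)
  have re: "integrable M (\<lambda>\<omega>. (\<Sum>i<m. Re (\<xi> i \<omega>) * N i \<omega>)\<^sup>2) \<and>
     expectation (\<lambda>\<omega>. (\<Sum>i<m. Re (\<xi> i \<omega>) * N i \<omega>)\<^sup>2)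
       = (\<Sum>i<m. expectation (\<lambda>\<omega>. (Re (\<xi> i \<omega>))\<^sup>2) * expectation (\<lambda>\<omega>. (N i \<omega>)\<^sup>2))"
    unfolding N_def
    by (rule orthogonal_increments_real[where C = C])
      (use assms(1-7) in \<open>auto intro!: borel_measurable_Re intro: order_trans[OF abs_Re_le_cmod]\<close>)
  have im: "integrable M (\<lambda>\<omega>. (\<Sum>i<m. Im (\<xi> i \<omega>) * N i \<omega>)\<^sup>2) \<and>
     expectation (\<lambda>\<omega>. (\<Sum>i<m. Im (\<xi> i \<omega>) * N i \<omega>)\<^sup>2)
       = (\<Sum>i<m. expectation (\<lambda>\<omega>. (Im (\<xi> i \<omega>))\<^sup>2) * expectation (\<lambda>\<omega>. (N i \<omega>)\<^sup>2))"
    unfolding N_def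
    by (rule orthogonal_increments_real[where C = C])
      (use assms(1-7) in \<open>auto intro!: borel_measurable_Im intro: order_trans[OF abs_Im_le_cmod]\<close>)
  show "integrable M (\<lambda>\<omega>. (norm (\<Sum>i<m. \<xi> i \<omega> * of_real (N i \<omega>)))\<^sup>2)"
    unfolding eq using re im by auto
  have sq: "expectation (\<lambda>\<omega>. (norm (\<xi> i \<omega>))\<^sup>2) = expectation (\<lambda>\<omega>. (Re (\<xi> i \<omega>))\<^sup>2) + expectation (\<lambda>\<omega>. (Im (\<xi> i \<omega>))\<^sup>2)"
    if i: "i < m" for i
  proof -
    have le: "(Re z)\<^sup>2 \<le> C\<^sup>2" "(Im z)\<^sup>2 \<le> C\<^sup>2" if "norm z \<le> C" for z
      using that abs_Re_le_cmod[of z] abs_Im_le_cmod[of z] by (metis abs_le_square_iff abs_of_nonneg norm_ge_zero order_trans)+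
    have "integrable M (\<lambda>\<omega>. (Re (\<xi> i \<omega>))\<^sup>2)"
      by (rule integrable_const_bound[of _ "C\<^sup>2"]) (use xM[OF i] le(1)[OF bnd[OF i]] in \<open>auto intro!: borel_measurable_power borel_measurable_Re\<close>)
    moreover have "integrable M (\<lambda>\<omega>. (Im (\<xi> i \<omega>))\<^sup>2)"
      by (rule integrable_const_bound[of _ "C\<^sup>2"]) (use xM[OF i] le(2)[OF bnd[OF i]] in \<open>auto intro!: borel_measurable_power borel_measurable_Im\<close>)
    ultimately show ?thesis by (simp add: cmod_power2)
  qed
  show "expectation (\<lambda>\<omega>. (norm (\<Sum>i<m. \<xi> i \<omega> * of_real (N i \<omega>)))\<^sup>2)
       = (\<Sum>i<m. expectation (\<lambda>\<omega>. (norm (\<xi> i \<omega>))\<^sup>2) * expectation (\<lambda>\<omega>. (N i \<omega>)\<^sup>2))"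
    unfolding eq using re im sq by (simp add: sum.distrib distrib_right)
qed

end

section \<open>Null sequences and local errors of stochastic sums\<close>

text \<open>
  \<open>X\<close> tends to \<open>0\<close> at \<open>\<omega> \<in> A\<close> along every subsequence along which a control sequence \<open>Z\<close>, null in \<open>L\<^sup>1\<close>, does.
  The set \<open>A\<close> need not be measurable, so localisation to bounded paths is free.
\<close>

definition ip_null :: "'a measure \<Rightarrow> 'a set \<Rightarrow> (nat \<Rightarrow> 'a \<Rightarrow> 'b::real_normed_vector) \<Rightarrow> bool" where
  "ip_null M A X \<longleftrightarrow> (\<exists>Z. (\<forall>n. integrable M (Z n)) \<and> (\<forall>n \<omega>. 0 \<le> (Z n \<omega> :: real)) \<and>
     (\<lambda>n. \<integral>\<omega>. Z n \<omega> \<partial>M) \<longlonglongrightarrow> 0 \<and>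
     (\<forall>\<omega>\<in>A. \<forall>r. strict_mono r \<longrightarrow> (\<lambda>k. Z (r k) \<omega>) \<longlonglongrightarrow> 0 \<longrightarrow> (\<lambda>k. X (r k) \<omega>) \<longlonglongrightarrow> 0))"

lemma ip_nullI:
  assumes "\<And>n. integrable M (Z n)" "\<And>n \<omega>. 0 \<le> (Z n \<omega> :: real)" "(\<lambda>n. \<integral>\<omega>. Z n \<omega> \<partial>M) \<longlonglongrightarrow> 0"
    and "\<And>\<omega> r. \<omega> \<in> A \<Longrightarrow> strict_mono r \<Longrightarrow> (\<lambda>k. Z (r k) \<omega>) \<longlonglongrightarrow> 0 \<Longrightarrow> (\<lambda>k. X (r k) \<omega>) \<longlonglongrightarrow> 0"
  shows "ip_null M A X"
  unfolding ip_null_def using assms by blast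

text \<open>The control is kept and only a pathwise implication is checked; this is how
  deterministic consequences of convergence enter.\<close>

lemma ip_null_imp:
  assumes "ip_null M A X" "B \<subseteq> A"
    and "\<And>\<omega> r. \<omega> \<in> B \<Longrightarrow> strict_mono r \<Longrightarrow> (\<lambda>k. X (r k) \<omega>) \<longlonglongrightarrow> 0 \<Longrightarrow> (\<lambda>k. Y (r k) \<omega>) \<longlonglongrightarrow> 0"
  shows "ip_null M B Y"
  using assms unfolding ip_null_def by (meson subsetD)

lemma ip_null_mono: "ip_null M A X \<Longrightarrow> B \<subseteq> A \<Longrightarrow> ip_null M B X"
  by (rule ip_null_imp)

text \<open>The sum of two nonnegative controls tends to \<open>0\<close> only if both do. Pairing
  is what makes one subsequence serve several sums at once.\<close>

lemma ip_null_Pair: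
  assumes "ip_null M A X" "ip_null M A Y"
  shows "ip_null M A (\<lambda>n \<omega>. (X n \<omega>, Y n \<omega>))"
proof -
  obtain Z where Z: "\<And>n. integrable M (Z n)" "\<And>n \<omega>. 0 \<le> (Z n \<omega> :: real)" "(\<lambda>n. \<integral>\<omega>. Z n \<omega> \<partial>M) \<longlonglongrightarrow> 0"
    "\<And>\<omega> r. \<omega> \<in> A \<Longrightarrow> strict_mono r \<Longrightarrow> (\<lambda>k. Z (r k) \<omega>) \<longlonglongrightarrow> 0 \<Longrightarrow> (\<lambda>k. X (r k) \<omega>) \<longlonglongrightarrow> 0"
    using assms(1) unfolding ip_null_def by blast
  obtain Z' where Z': "\<And>n. integrable M (Z' n)" "\<And>n \<omega>. 0 \<le> (Z' n \<omega> :: real)" "(\<lambda>n. \<integral>\<omega>. Z' n \<omega> \<partial>M) \<longlonglongrightarrow> 0"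
    "\<And>\<omega> r. \<omega> \<in> A \<Longrightarrow> strict_mono r \<Longrightarrow> (\<lambda>k. Z' (r k) \<omega>) \<longlonglongrightarrow> 0 \<Longrightarrow> (\<lambda>k. Y (r k) \<omega>) \<longlonglongrightarrow> 0"
    using assms(2) unfolding ip_null_def by blast
  show ?thesis
  proof (rule ip_nullI[where Z = "\<lambda>n \<omega>. Z n \<omega> + Z' n \<omega>"])
    show "integrable M (\<lambda>\<omega>. Z n \<omega> + Z' n \<omega>)" for n using Z Z' by auto
    show "0 \<le> Z n \<omega> + Z' n \<omega>" for n \<omega> using Z Z' by auto
    show "(\<lambda>n. \<integral>\<omega>. Z n \<omega> + Z' n \<omega> \<partial>M) \<longlonglongrightarrow> 0"
      using tendsto_add[OF Z(3) Z'(3)] Z(1) Z'(1) by simp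
    fix \<omega> and r :: "nat \<Rightarrow> nat" assume \<omega>: "\<omega> \<in> A" and r: "strict_mono r"
      and lim: "(\<lambda>k. Z (r k) \<omega> + Z' (r k) \<omega>) \<longlonglongrightarrow> 0"
    have "(\<lambda>k. Z (r k) \<omega>) \<longlonglongrightarrow> 0" "(\<lambda>k. Z' (r k) \<omega>) \<longlonglongrightarrow> 0"
      by (rule real_tendsto_sandwich[OF _ _ tendsto_const lim]; use Z(2) Z'(2) in auto)+
    then have "(\<lambda>k. X (r k) \<omega>) \<longlonglongrightarrow> 0" "(\<lambda>k. Y (r k) \<omega>) \<longlonglongrightarrow> 0"
      using Z(4)[OF \<omega> r] Z'(4)[OF \<omega> r] by auto
    then show "(\<lambda>k. (X (r k) \<omega>, Y (r k) \<omega>)) \<longlonglongrightarrow> 0"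
      using tendsto_Pair unfolding zero_prod_def by blast
  qed
qed

text \<open>A sequence null in mean has an almost surely null subsequence; chosen for the control,
  it works for \<open>X\<close> at almost every point of \<open>A\<close>.\<close>

lemma ip_null_AE_subseq:
  assumes "ip_null M A X"
  shows "\<exists>r::nat \<Rightarrow> nat. strict_mono r \<and> (AE \<omega> in M. \<omega> \<in> A \<longrightarrow> (\<lambda>k. X (r k) \<omega>) \<longlonglongrightarrow> 0)"
proof -
  obtain Z where Z: "\<And>n. integrable M (Z n)" "\<And>n \<omega>. 0 \<le> (Z n \<omega> :: real)" "(\<lambda>n. \<integral>\<omega>. Z n \<omega> \<partial>M) \<longlonglongrightarrow> 0"
    "\<And>\<omega> r. \<omega> \<in> A \<Longrightarrow> strict_mono r \<Longrightarrow> (\<lambda>k. Z (r k) \<omega>) \<longlonglongrightarrow> 0 \<Longrightarrow> (\<lambda>k. X (r k) \<omega>) \<longlonglongrightarrow> 0"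
    using assms unfolding ip_null_def by blast
  have "(\<lambda>n. \<integral>\<omega>. norm (Z n \<omega>) \<partial>M) \<longlonglongrightarrow> 0" using Z(2,3) by simp
  then obtain r where r: "strict_mono r" "AE \<omega> in M. (\<lambda>k. Z (r k) \<omega>) \<longlonglongrightarrow> 0"
    using tendsto_L1_AE_subseq[of M Z] Z(1) by blast
  then show ?thesis using Z(4) by (intro exI[of _ r]) (auto elim!: eventually_mono)
qed

lemma ip_null_L2:
  fixes X :: "nat \<Rightarrow> 'a \<Rightarrow> 'b::real_normed_vector"
  assumes "\<And>n. integrable M (\<lambda>\<omega>. (norm (X n \<omega>))\<^sup>2)" "(\<lambda>n. \<integral>\<omega>. (norm (X n \<omega>))\<^sup>2 \<partial>M) \<longlonglongrightarrow> 0"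
  shows "ip_null M UNIV X"
proof (rule ip_nullI[OF assms(1) _ assms(2)])
  fix \<omega> :: 'a and r :: "nat \<Rightarrow> nat" assume "(\<lambda>k. (norm (X (r k) \<omega>))\<^sup>2) \<longlonglongrightarrow> 0"
  then have "(\<lambda>k. norm (X (r k) \<omega>)) \<longlonglongrightarrow> 0"
    using tendsto_real_sqrt[of _ "0::real"] by fastforce
  then show "(\<lambda>k. X (r k) \<omega>) \<longlonglongrightarrow> 0" by (simp add: tendsto_norm_zero_iff)
qed auto

section \<open>Quadratic variation of the Wiener process\<close>

context wiener
begin

text \<open>On a cell of length \<open>h = t / n\<close> the centred square of the increment has
  variance \<open>3 h^2 - 2 h^2 + h^2 = 2 h^2\<close>. These variables are orthogonal, so the second
  moment of the weighted sum is at most \<open>2 C^2 t^2 / n\<close>.\<close>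

lemma quadratic_variation_null:
  fixes w :: "real \<Rightarrow> 'a \<Rightarrow> complex"
  assumes t: "0 < t" and w: "\<And>s. 0 \<le> s \<Longrightarrow> w s \<in> borel_measurable (F s)"
    and bnd: "\<And>s \<omega>. norm (w s \<omega>) \<le> C"
  shows "ip_null M UNIV (\<lambda>n \<omega>. \<Sum>i<n. w (grid t n i) \<omega> *
     of_real ((W (grid t n (Suc i)) \<omega> - W (grid t n i) \<omega>)\<^sup>2 - t / real n))"
proof -
  let ?X = "\<lambda>n \<omega>. \<Sum>i<n. w (grid t n i) \<omega> *
     of_real ((W (grid t n (Suc i)) \<omega> - W (grid t n i) \<omega>)\<^sup>2 - t / real n)"
  have C: "0 \<le> C" using bnd norm_ge_zero order_trans by blast
  have *: "integrable M (\<lambda>\<omega>. (norm (?X n \<omega>))\<^sup>2) \<and>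
     expectation (\<lambda>\<omega>. (norm (?X n \<omega>))\<^sup>2) \<le> 2 * C\<^sup>2 * t\<^sup>2 * (1 / real n)" for n
  proof (cases "n = 0")
    case True then show ?thesis by simp
  next
    case False
    define \<tau> where "\<tau> = (\<lambda>i. grid t n i)"
    define g where "g = (\<lambda>(i::nat) x::real. x\<^sup>2 - t / real n)"
    have \<tau>0: "0 \<le> \<tau> i" for i using t by (simp add: \<tau>_def)
    have \<tau>lt: "\<tau> i < \<tau> (Suc i)" for i using t False by (simp add: \<tau>_def divide_strict_right_mono)
    have d: "\<tau> (Suc i) - \<tau> i = t / real n" for i
      unfolding \<tau>_def diff_divide_distrib[symmetric] by (simp add: algebra_simps)
    have sq: "(g i x)\<^sup>2 = x ^ 4 - 2 * (t / real n) * x ^ 2 + (t / real n)\<^sup>2" for i x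
      by (simp add: g_def power2_diff power_mult[symmetric] algebra_simps)
    note pw = increment_power(1)[OF \<tau>0 \<tau>lt]
    have g2: "integrable M (\<lambda>\<omega>. (g i (W (\<tau> (Suc i)) \<omega> - W (\<tau> i) \<omega>))\<^sup>2)" for i
      unfolding sq using pw by (intro Bochner_Integration.integrable_add Bochner_Integration.integrable_diff integrable_mult_right) auto
    have Eg2: "expectation (\<lambda>\<omega>. (g i (W (\<tau> (Suc i)) \<omega> - W (\<tau> i) \<omega>))\<^sup>2) = 2 * (t / real n)\<^sup>2" for i
    proof -
      have "expectation (\<lambda>\<omega>. (g i (W (\<tau> (Suc i)) \<omega> - W (\<tau> i) \<omega>))\<^sup>2) =
         expectation (\<lambda>\<omega>. (W (\<tau> (Suc i)) \<omega> - W (\<tau> i) \<omega>) ^ 4)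
         - 2 * (t / real n) * expectation (\<lambda>\<omega>. (W (\<tau> (Suc i)) \<omega> - W (\<tau> i) \<omega>) ^ 2) + (t / real n)\<^sup>2"
        unfolding sq using pw[of i 4] pw[of i 2] by (simp add: prob_space)
      then show ?thesis
        unfolding increment_fourth[OF \<tau>0 \<tau>lt] increment_variance[OF \<tau>0 \<tau>lt] d
        by (simp add: power2_eq_square)
    qed
    have g1: "expectation (\<lambda>\<omega>. g i (W (\<tau> (Suc i)) \<omega> - W (\<tau> i) \<omega>)) = 0" for i
    proof -
      have "expectation (\<lambda>\<omega>. g i (W (\<tau> (Suc i)) \<omega> - W (\<tau> i) \<omega>)) =
        expectation (\<lambda>\<omega>. (W (\<tau> (Suc i)) \<omega> - W (\<tau> i) \<omega>) ^ 2) - t / real n"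
        unfolding g_def using pw[of i 2] by (simp add: prob_space)
      then show ?thesis by (simp add: increment_variance[OF \<tau>0 \<tau>lt] d)
    qed
    have gm: "g i \<in> borel_measurable borel" for i by (simp add: g_def)
    note oi = orthogonal_increments[where \<tau> = \<tau> and g = g and m = n and \<xi> = "\<lambda>i. w (\<tau> i)" and C = C,
        OF \<tau>0 \<tau>lt w[OF \<tau>0] bnd gm g2 g1]
    have wE: "expectation (\<lambda>\<omega>. (norm (w (\<tau> i) \<omega>))\<^sup>2) \<le> C\<^sup>2" for i
    proof -
      have m: "w (\<tau> i) \<in> borel_measurable M" using w[OF \<tau>0] measurable_F_M by blast
      have b: "(norm (w (\<tau> i) \<omega>))\<^sup>2 \<le> C\<^sup>2" for \<omega> using bnd by (simp add: power_mono)
      have "expectation (\<lambda>\<omega>. (norm (w (\<tau> i) \<omega>))\<^sup>2) \<le> expectation (\<lambda>\<omega>. C\<^sup>2)"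
        by (rule integral_mono) (use m b in \<open>auto intro!: integrable_const_bound[of _ "C\<^sup>2"]\<close>)
      then show ?thesis by (simp add: prob_space)
    qed
    have X: "?X n \<omega> = (\<Sum>i<n. w (\<tau> i) \<omega> * of_real (g i (W (\<tau> (Suc i)) \<omega> - W (\<tau> i) \<omega>)))" for \<omega>
      by (simp add: \<tau>_def g_def)
    have "expectation (\<lambda>\<omega>. (norm (?X n \<omega>))\<^sup>2) = (\<Sum>i<n. expectation (\<lambda>\<omega>. (norm (w (\<tau> i) \<omega>))\<^sup>2) * (2 * (t / real n)\<^sup>2))"
      unfolding X oi(2) Eg2 ..
    also have "\<dots> \<le> (\<Sum>i<n. C\<^sup>2 * (2 * (t / real n)\<^sup>2))"
      by (intro sum_mono mult_right_mono wE) auto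
    also have "\<dots> = 2 * C\<^sup>2 * t\<^sup>2 * (1 / real n)" using False by (simp add: power2_eq_square)
    finally show ?thesis unfolding X using oi(1) by blast
  qed
  show ?thesis
  proof (rule ip_null_L2)
    show "integrable M (\<lambda>\<omega>. (norm (?X n \<omega>))\<^sup>2)" for n using * by blast
    have lim: "(\<lambda>n. 2 * C\<^sup>2 * t\<^sup>2 * (1 / real n)) \<longlonglongrightarrow> 0"
      by (rule tendsto_mult_right_zero[OF lim_1_over_n])
    show "(\<lambda>n. expectation (\<lambda>\<omega>. (norm (?X n \<omega>))\<^sup>2)) \<longlonglongrightarrow> 0"
      by (rule real_tendsto_sandwich[OF _ _ tendsto_const lim])
        (use * in \<open>simp_all add: always_eventually\<close>)
  qed
qed

end

text \<open>Values beyond the cutoff \<open>C\<close> are replaced by \<open>0\<close>; no continuity of the truncated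
  process is needed, only that increments still tend to \<open>0\<close> pathwise.\<close>

definition cutdiff :: "real \<Rightarrow> (real \<Rightarrow> 'a \<Rightarrow> complex) \<Rightarrow> real \<Rightarrow> real \<Rightarrow> 'a \<Rightarrow> complex" where
  "cutdiff C \<Psi> s u \<omega> = (if norm (\<Psi> s \<omega>) \<le> C \<and> norm (\<Psi> u \<omega>) \<le> C then \<Psi> u \<omega> - \<Psi> s \<omega> else 0)"

lemma norm_cut_le: "0 \<le> C \<Longrightarrow> norm (cutdiff C \<Psi> s u \<omega>) \<le> 2 * C"
  unfolding cutdiff_def using norm_triangle_ineq4[of "\<Psi> u \<omega>" "\<Psi> s \<omega>"] by auto

lemma norm_cut_le_diff: "norm (cutdiff C \<Psi> s u \<omega>) \<le> norm (\<Psi> u \<omega> - \<Psi> s \<omega>)"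
  by (simp add: cutdiff_def)

section \<open>Two-level grids and truncated sums over their cells\<close>

text \<open>Subdivision point \<open>l\<close> of cell \<open>i\<close> is written as node
  \<open>i * r + l\<close> of the uniform grid with \<open>n * r\<close> cells, so that
  \<open>l = r\<close> is automatically the left end of the next cell.\<close>

definition fine_node :: "real \<Rightarrow> nat \<Rightarrow> nat \<Rightarrow> nat \<Rightarrow> nat \<Rightarrow> real" where
  "fine_node t n r i l = t * real (i * r + l) / real (n * r)"

definition fine_increment :: "(real \<Rightarrow> 'a \<Rightarrow> real) \<Rightarrow> real \<Rightarrow> nat \<Rightarrow> nat \<Rightarrow> nat \<Rightarrow> nat \<Rightarrow> 'a \<Rightarrow> real" where
  "fine_increment W t n r i l \<omega> = W (fine_node t n r i (Suc l)) \<omega> - W (fine_node t n r i l) \<omega>"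

text \<open>Truncated form of the error made on cell \<open>i\<close> when the integrand is frozen
  at the left end of the cell.\<close>

definition cut_block where
  "cut_block C \<Psi> W t n r i \<omega> = (\<Sum>l<r. cutdiff C \<Psi> (grid t n i) (fine_node t n r i l) \<omega>
      * of_real (fine_increment W t n r i l \<omega>))"

text \<open>The right-hand side of the Ito isometry before taking means: its expectation is the
  total second moment of the blocks.\<close>

definition cut_energy :: "real \<Rightarrow> (real \<Rightarrow> 'a \<Rightarrow> complex) \<Rightarrow> real \<Rightarrow> nat \<Rightarrow> nat \<Rightarrow> 'a \<Rightarrow> real" where
  "cut_energy C \<Psi> t n r \<omega> = (\<Sum>i<n. \<Sum>l<r. (norm (cutdiff C \<Psi> (grid t n i) (fine_node t n r i l) \<omega>))\<^sup>2 * (t / real (n * r)))"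

lemma fine_node_div_mod:
  assumes "0 < r" shows "fine_node t n r (L div r) (L mod r) = grid t (n * r) L"
  unfolding fine_node_def by (simp add: div_mult_mod_eq)

lemma fine_node_0: "0 < r \<Longrightarrow> fine_node t n r i 0 = grid t n i"
  by (simp add: fine_node_def)

lemma fine_node_nonneg: "0 \<le> t \<Longrightarrow> 0 \<le> fine_node t n r i l"
  by (simp add: fine_node_def)

lemma fine_node_ge: "0 \<le> t \<Longrightarrow> 0 < r \<Longrightarrow> grid t n i \<le> fine_node t n r i l"
  unfolding fine_node_0[of r t n i, symmetric]
  by (auto simp: fine_node_def simp del: of_nat_mult of_nat_add intro!: divide_right_mono mult_left_mono)

lemma fine_node_less:
  assumes "0 \<le> t" "i < n" "l \<le> r" "0 < r"
  shows "fine_node t n r i l \<le> t" and "fine_node t n r i l \<le> grid t n i + t / real n"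
proof -
  have "real (i * r + l) \<le> real (Suc i * r)" using assms by (simp only: of_nat_le_iff) simp
  then have "t * real (i * r + l) \<le> t * real (Suc i * r)" using assms by (intro mult_left_mono)
  then have "fine_node t n r i l \<le> t * real (Suc i * r) / real (n * r)"
    unfolding fine_node_def by (intro divide_right_mono) auto
  also have "\<dots> = grid t n (Suc i)"
    unfolding of_nat_mult using assms by (simp add: mult.assoc[symmetric] del: of_nat_Suc)
  finally have *: "fine_node t n r i l \<le> grid t n (Suc i)" .
  then show "fine_node t n r i l \<le> grid t n i + t / real n"
    by (simp add: algebra_simps add_divide_distrib)
  have "t * real (Suc i) \<le> t * real n" using assms by (intro mult_left_mono) auto
  then have "grid t n (Suc i) \<le> t" using assms by (simp add: divide_le_eq)
  with * show "fine_node t n r i l \<le> t" by simp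
qed

text \<open>Orthogonality across all cells together requires a single sum over the grid with
  \<open>n * r\<close> cells.\<close>

lemma sum_fine_reindex:
  fixes f :: "nat \<Rightarrow> nat \<Rightarrow> 'b::comm_monoid_add"
  assumes "0 < r"
  shows "(\<Sum>i<n. \<Sum>l<r. f i l) = (\<Sum>L<n * r. f (L div r) (L mod r))"
proof -
  have "(\<Sum>L<n * r. f (L div r) (L mod r)) = (\<Sum>i<n. \<Sum>L\<in>{i * r..<i * r + r}. f (L div r) (L mod r))"
    by (rule sum.nat_group[symmetric])
  also have "\<dots> = (\<Sum>i<n. \<Sum>l<r. f i l)"
  proof (rule sum.cong[OF refl])
    fix i
    have "(\<Sum>L\<in>{i * r..<i * r + r}. f (L div r) (L mod r)) = (\<Sum>l\<in>{0..<r}. f ((l + i * r) div r) ((l + i * r) mod r))"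
      using sum.shift_bounds_nat_ivl[of "\<lambda>L. f (L div r) (L mod r)" 0 "i * r" r] by (simp add: add.commute)
    also have "\<dots> = (\<Sum>l<r. f i l)"
      using assms by (intro sum.cong) auto
    finally show "(\<Sum>L\<in>{i * r..<i * r + r}. f (L div r) (L mod r)) = (\<Sum>l<r. f i l)" .
  qed
  finally show ?thesis by simp
qed

lemma uniform_grid_continuity:
  fixes f :: "real \<Rightarrow> 'b::metric_space"
  assumes t: "0 \<le> t" and f: "continuous_on {0..t} f" and e: "0 < e"
  shows "\<forall>\<^sub>F n in sequentially. \<forall>u\<in>{0..t}. \<forall>v\<in>{0..t}. \<bar>u - v\<bar> \<le> t / real n \<longrightarrow> dist (f u) (f v) < e"
proof -
  have "uniformly_continuous_on {0..t} f"
    using f by (intro compact_uniformly_continuous) auto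
  then obtain d where d: "0 < d" "\<And>u v. u \<in> {0..t} \<Longrightarrow> v \<in> {0..t} \<Longrightarrow> dist v u < d \<Longrightarrow> dist (f v) (f u) < e"
    unfolding uniformly_continuous_on_def using e by meson
  have "(\<lambda>n. t * (1 / real n)) \<longlonglongrightarrow> t * 0" by (intro tendsto_intros lim_1_over_n)
  then have "\<forall>\<^sub>F n in sequentially. t * (1 / real n) < d" using d(1) by (intro order_tendstoD(2)) auto
  then show ?thesis
    by eventually_elim (use d(2) in \<open>auto simp: dist_real_def\<close>)
qed

section \<open>Second moments of truncated blocks, for an arbitrary refinement\<close>

context wiener
begin

context
  fixes \<Psi> :: "real \<Rightarrow> 'a \<Rightarrow> complex" and t C :: real and r :: "nat \<Rightarrow> nat"
  assumes t: "0 < t" and C: "0 \<le> C" and r: "\<And>n. 0 < r n"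
    and \<Psi>F: "\<And>s. 0 \<le> s \<Longrightarrow> \<Psi> s \<in> borel_measurable (F s)"
    and \<Psi>c: "\<And>\<omega>. \<omega> \<in> space M \<Longrightarrow> continuous_on {0..} (\<lambda>s. \<Psi> s \<omega>)"
begin

lemma cut_measurable:
  assumes "0 \<le> s" "s \<le> u" shows "cutdiff C \<Psi> s u \<in> borel_measurable (F u)"
proof -
  have 1: "\<Psi> s \<in> borel_measurable (F u)" using \<Psi>F[OF assms(1)] assms(2) measurable_F_mono by blast
  have 2: "\<Psi> u \<in> borel_measurable (F u)" using \<Psi>F assms by simp
  show ?thesis unfolding cutdiff_def[abs_def] using 1 2 by measurable
qed

lemma cut_energy_measurable: "cut_energy C \<Psi> t n (r n) \<in> borel_measurable M"
proof -
  have "cutdiff C \<Psi> (grid t n i) (fine_node t n (r n) i l) \<in> borel_measurable M" for i l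
    by (rule measurable_F_M[OF cut_measurable]) (use t r fine_node_ge in auto)
  then show ?thesis unfolding cut_energy_def[abs_def] by measurable
qed

lemma cut_energy_bound: "0 \<le> cut_energy C \<Psi> t n (r n) \<omega>" "cut_energy C \<Psi> t n (r n) \<omega> \<le> (2 * C)\<^sup>2 * t"
proof -
  show "0 \<le> cut_energy C \<Psi> t n (r n) \<omega>"
    unfolding cut_energy_def using t by (intro sum_nonneg mult_nonneg_nonneg) auto
  have "cut_energy C \<Psi> t n (r n) \<omega> \<le> (\<Sum>i<n. \<Sum>l<r n. (2 * C)\<^sup>2 * (t / real (n * r n)))"
    unfolding cut_energy_def using t norm_cut_le[OF C]
    by (intro sum_mono mult_right_mono power_mono) auto
  also have "\<dots> \<le> (2 * C)\<^sup>2 * t" using r[of n] t by (cases "n = 0") auto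
  finally show "cut_energy C \<Psi> t n (r n) \<omega> \<le> (2 * C)\<^sup>2 * t" .
qed

text \<open>Both nodes of an increment lie in the same coarse cell, so uniform continuity of the
  path bounds it by \<open>d\<close> once \<open>n\<close> is large, whatever the refinement
  \<open>r n\<close>. The cell lengths add up to \<open>t\<close>, and \<open>d\<close> is chosen
  with \<open>d^2 * t = e / 2\<close>.\<close>

lemma cut_energy_pathwise:
  assumes "\<omega> \<in> space M" shows "(\<lambda>n. cut_energy C \<Psi> t n (r n) \<omega>) \<longlonglongrightarrow> 0"
proof (rule LIMSEQ_I)
  fix e :: real assume e: "0 < e"
  define d where "d = sqrt (e / (2 * t))"
  have d: "0 < d" and d2: "d\<^sup>2 * t < e" using e t by (auto simp: d_def)
  have "continuous_on {0..t} (\<lambda>s. \<Psi> s \<omega>)"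
    using \<Psi>c[OF assms] continuous_on_subset by fastforce
  from uniform_grid_continuity[OF _ this d] t
  obtain n0 where n0: "\<And>n u v. n \<ge> n0 \<Longrightarrow> u \<in> {0..t} \<Longrightarrow> v \<in> {0..t} \<Longrightarrow> \<bar>u - v\<bar> \<le> t / real n \<Longrightarrow> dist (\<Psi> u \<omega>) (\<Psi> v \<omega>) < d"
    unfolding eventually_sequentially by (metis less_imp_le)
  have "norm (cut_energy C \<Psi> t n (r n) \<omega> - 0) < e" if n: "n \<ge> n0" for n
  proof -
    have "cut_energy C \<Psi> t n (r n) \<omega> \<le> (\<Sum>i<n. \<Sum>l<r n. d\<^sup>2 * (t / real (n * r n)))"
      unfolding cut_energy_def
    proof (intro sum_mono mult_right_mono power_mono)
      fix i l assume i: "i \<in> {..<n}" and l: "l \<in> {..<r n}"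
      have "norm (\<Psi> (fine_node t n (r n) i l) \<omega> - \<Psi> (grid t n i) \<omega>) < d"
        unfolding dist_norm[symmetric]
      proof (rule n0[OF n])
        have 1: "fine_node t n (r n) i l \<le> t" "fine_node t n (r n) i l \<le> grid t n i + t / real n"
          using fine_node_less[of t i n l "r n"] i l t r by auto
        have 2: "grid t n i \<le> fine_node t n (r n) i l" using fine_node_ge[of t "r n"] t r by simp
        have 3: "0 \<le> grid t n i" using t by simp
        show "fine_node t n (r n) i l \<in> {0..t}" "grid t n i \<in> {0..t}"
          "\<bar>fine_node t n (r n) i l - grid t n i\<bar> \<le> t / real n"
          using 1 2 3 by auto
      qed
      then show "norm (cutdiff C \<Psi> (grid t n i) (fine_node t n (r n) i l) \<omega>) \<le> d"
        using norm_cut_le_diff by (meson less_imp_le order_trans)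
    qed (use t in auto)
    also have "\<dots> \<le> d\<^sup>2 * t" using r[of n] t by (cases "n = 0") auto
    finally show ?thesis using d2 cut_energy_bound(1)[of n \<omega>] by simp
  qed
  then show "\<exists>no. \<forall>n\<ge>no. norm (cut_energy C \<Psi> t n (r n) \<omega> - 0) < e" by blast
qed

text \<open>Dominated convergence; it is the cutoff that supplies the constant majorant.\<close>

lemma cut_energy_expectation: "(\<lambda>n. expectation (cut_energy C \<Psi> t n (r n))) \<longlonglongrightarrow> 0"
proof -
  have "(\<lambda>n. expectation (cut_energy C \<Psi> t n (r n))) \<longlonglongrightarrow> expectation (\<lambda>\<omega>. 0)"
    by (rule integral_dominated_convergence[where w = "\<lambda>_. (2 * C)\<^sup>2 * t"])
      (use cut_energy_pathwise cut_energy_bound cut_energy_measurable in \<open>auto simp: abs_of_nonneg\<close>)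
  then show ?thesis by simp
qed

lemma cut_square_integrable:
  assumes "0 \<le> s" "s \<le> u" shows "integrable M (\<lambda>\<omega>. (norm (cutdiff C \<Psi> s u \<omega>))\<^sup>2)"
proof (rule integrable_const_bound[of _ "(2 * C)\<^sup>2"])
  show "AE \<omega> in M. norm ((norm (cutdiff C \<Psi> s u \<omega>))\<^sup>2) \<le> (2 * C)\<^sup>2"
    using power_mono[OF norm_cut_le[OF C] norm_ge_zero, where n = 2] by (intro AE_I2) simp
  show "(\<lambda>\<omega>. (norm (cutdiff C \<Psi> s u \<omega>))\<^sup>2) \<in> borel_measurable M"
    using measurable_F_M[OF cut_measurable[OF assms]] by measurable
qed

lemma expectation_cut_energy:
  "expectation (cut_energy C \<Psi> t n (r n)) = (\<Sum>i<n. \<Sum>l<r n.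
     expectation (\<lambda>\<omega>. (norm (cutdiff C \<Psi> (grid t n i) (fine_node t n (r n) i l) \<omega>))\<^sup>2) * (t / real (n * r n)))"
proof -
  have "integrable M (\<lambda>\<omega>. (norm (cutdiff C \<Psi> (grid t n i) (fine_node t n (r n) i l) \<omega>))\<^sup>2)" for i l
    by (rule cut_square_integrable) (use t r fine_node_ge in auto)
  then show ?thesis unfolding cut_energy_def[abs_def] by simp
qed

text \<open>The truncated increment up to a fine node is known at that node, so the isometry applies
  to the Wiener increments that follow it.\<close>

lemma cut_block_L2:
  assumes "i < n"
  shows "integrable M (\<lambda>\<omega>. (norm (cut_block C \<Psi> W t n (r n) i \<omega>))\<^sup>2)"
    and "expectation (\<lambda>\<omega>. (norm (cut_block C \<Psi> W t n (r n) i \<omega>))\<^sup>2) = (\<Sum>l<r n.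
     expectation (\<lambda>\<omega>. (norm (cutdiff C \<Psi> (grid t n i) (fine_node t n (r n) i l) \<omega>))\<^sup>2) * (t / real (n * r n)))"
proof -
  let ?\<tau> = "fine_node t n (r n) i"
  have n: "0 < real (n * r n)" using assms r[of n] by simp
  have \<tau>0: "0 \<le> ?\<tau> l" for l using t by (simp add: fine_node_nonneg)
  have \<tau>lt: "?\<tau> l < ?\<tau> (Suc l)" for l
    unfolding fine_node_def by (intro divide_strict_right_mono mult_strict_left_mono n t) auto
  have d: "?\<tau> (Suc l) - ?\<tau> l = t / real (n * r n)" for l
    unfolding fine_node_def diff_divide_distrib[symmetric] by (simp add: algebra_simps)
  have i2: "integrable M (\<lambda>\<omega>. (W (?\<tau> (Suc l)) \<omega> - W (?\<tau> l) \<omega>)\<^sup>2)" for l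
    using increment_power(1)[OF \<tau>0 \<tau>lt] .
  have cm: "cutdiff C \<Psi> (grid t n i) (?\<tau> l) \<in> borel_measurable (F (?\<tau> l))" for l
    by (rule cut_measurable) (use t r fine_node_ge in auto)
  note oi = orthogonal_increments[where \<tau> = ?\<tau> and g = "\<lambda>_ x. x" and m = "r n" and C = "2 * C"
      and \<xi> = "\<lambda>l. cutdiff C \<Psi> (grid t n i) (?\<tau> l)",
      OF \<tau>0 \<tau>lt cm norm_cut_le[OF C] _ i2 increment_mean[OF \<tau>0 \<tau>lt]]
  show "integrable M (\<lambda>\<omega>. (norm (cut_block C \<Psi> W t n (r n) i \<omega>))\<^sup>2)"
    unfolding cut_block_def fine_increment_def using oi(1) by simp
  show "expectation (\<lambda>\<omega>. (norm (cut_block C \<Psi> W t n (r n) i \<omega>))\<^sup>2) = (\<Sum>l<r n.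
     expectation (\<lambda>\<omega>. (norm (cutdiff C \<Psi> (grid t n i) (?\<tau> l) \<omega>))\<^sup>2) * (t / real (n * r n)))"
    unfolding cut_block_def fine_increment_def using oi(2)
    by (simp add: increment_variance[OF \<tau>0 \<tau>lt] d del: of_nat_mult)
qed

text \<open>The squares are their own control, since the isometry identifies their total mean with
  the mean energy.\<close>

lemma cut_block_squares_null:
  "ip_null M UNIV (\<lambda>n \<omega>. \<Sum>i<n. (norm (cut_block C \<Psi> W t n (r n) i \<omega>))\<^sup>2)"
proof (rule ip_nullI[where Z = "\<lambda>n \<omega>. \<Sum>i<n. (norm (cut_block C \<Psi> W t n (r n) i \<omega>))\<^sup>2"])
  have "expectation (\<lambda>\<omega>. \<Sum>i<n. (norm (cut_block C \<Psi> W t n (r n) i \<omega>))\<^sup>2) = expectation (cut_energy C \<Psi> t n (r n))" for n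
    unfolding expectation_cut_energy using cut_block_L2 by simp
  then show "(\<lambda>n. expectation (\<lambda>\<omega>. \<Sum>i<n. (norm (cut_block C \<Psi> W t n (r n) i \<omega>))\<^sup>2)) \<longlonglongrightarrow> 0"
    using cut_energy_expectation by simp
qed (use cut_block_L2 in \<open>auto intro!: sum_nonneg\<close>)

text \<open>Smallness of the squares does not make the sum of the norms small, so cancellation has
  to be used. A weight taken at the coarse node is known at all fine nodes of its cell; hence the
  whole sum is an orthogonal sum on the fine grid, with second moment at most \<open>B^2\<close>
  times the mean energy.\<close>

lemma weighted_cut_block_null:
  fixes v :: "real \<Rightarrow> 'a \<Rightarrow> complex"
  assumes v: "\<And>s. 0 \<le> s \<Longrightarrow> v s \<in> borel_measurable (F s)" and bnd: "\<And>s \<omega>. norm (v s \<omega>) \<le> B"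
  shows "ip_null M UNIV (\<lambda>n \<omega>. \<Sum>i<n. v (grid t n i) \<omega> * cut_block C \<Psi> W t n (r n) i \<omega>)"
proof -
  let ?X = "\<lambda>n \<omega>. \<Sum>i<n. v (grid t n i) \<omega> * cut_block C \<Psi> W t n (r n) i \<omega>"
  have B: "0 \<le> B" using bnd norm_ge_zero order_trans by blast
  have *: "integrable M (\<lambda>\<omega>. (norm (?X n \<omega>))\<^sup>2) \<and>
     expectation (\<lambda>\<omega>. (norm (?X n \<omega>))\<^sup>2) \<le> B\<^sup>2 * expectation (cut_energy C \<Psi> t n (r n))" for n
  proof (cases "n = 0")
    case True then show ?thesis by (simp add: cut_energy_def)
  next
    case False
    then have n: "0 < real (n * r n)" using r[of n] by simp
    define \<tau> where "\<tau> = (\<lambda>L. grid t (n * r n) L)"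
    define s where "s = (\<lambda>L. t * real (L div r n) / real n)"
    define \<xi> where "\<xi> = (\<lambda>L \<omega>. v (s L) \<omega> * cutdiff C \<Psi> (s L) (\<tau> L) \<omega>)"
    have \<tau>0: "0 \<le> \<tau> L" for L using t by (simp add: \<tau>_def)
    have \<tau>lt: "\<tau> L < \<tau> (Suc L)" for L
      unfolding \<tau>_def by (intro divide_strict_right_mono mult_strict_left_mono n t) auto
    have d: "\<tau> (Suc L) - \<tau> L = t / real (n * r n)" for L
      unfolding \<tau>_def diff_divide_distrib[symmetric] by (simp add: algebra_simps)
    have s0: "0 \<le> s L" for L using t by (simp add: s_def)
    have fn: "fine_node t n (r n) (L div r n) (L mod r n) = \<tau> L" for L
      unfolding \<tau>_def by (rule fine_node_div_mod) (rule r)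
    \<comment> \<open>The index \<open>Suc (L mod r n)\<close> may equal \<open>r n\<close>; the
      formula then gives the first node of the next cell, so no case distinction arises.\<close>
    have fs: "fine_node t n (r n) (L div r n) (Suc (L mod r n)) = \<tau> (Suc L)" for L
      unfolding \<tau>_def fine_node_def by (metis add_Suc_right div_mult_mod_eq)
    have s\<tau>: "s L \<le> \<tau> L" for L using fine_node_ge[of t "r n" "L div r n" n "L mod r n"] t r fn by (simp add: s_def)
    have xF: "\<xi> L \<in> borel_measurable (F (\<tau> L))" for L
      unfolding \<xi>_def
      by (intro borel_measurable_times measurable_F_mono[OF v[OF s0] s\<tau>] cut_measurable s0 s\<tau>)
    have xb: "norm (\<xi> L \<omega>) \<le> B * (2 * C)" for L \<omega>
      unfolding \<xi>_def norm_mult using bnd norm_cut_le[OF C] B by (intro mult_mono) auto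
    have i2: "integrable M (\<lambda>\<omega>. (W (\<tau> (Suc L)) \<omega> - W (\<tau> L) \<omega>)\<^sup>2)" for L
      using increment_power(1)[OF \<tau>0 \<tau>lt] .
    note oi = orthogonal_increments[where \<tau> = \<tau> and g = "\<lambda>_ x. x" and m = "n * r n" and C = "B * (2 * C)"
      and \<xi> = \<xi>, OF \<tau>0 \<tau>lt xF xb _ i2 increment_mean[OF \<tau>0 \<tau>lt]]
    have X: "?X n \<omega> = (\<Sum>L<n * r n. \<xi> L \<omega> * of_real (W (\<tau> (Suc L)) \<omega> - W (\<tau> L) \<omega>))" for \<omega>
    proof -
      have "?X n \<omega> = (\<Sum>i<n. \<Sum>l<r n. v (grid t n i) \<omega> * cutdiff C \<Psi> (grid t n i) (fine_node t n (r n) i l) \<omega>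
          * of_real (fine_increment W t n (r n) i l \<omega>))"
        unfolding cut_block_def sum_distrib_left by (simp add: mult.assoc)
      also have "\<dots> = (\<Sum>L<n * r n. \<xi> L \<omega> * of_real (W (\<tau> (Suc L)) \<omega> - W (\<tau> L) \<omega>))"
        unfolding sum_fine_reindex[OF r] fine_increment_def fn fs \<xi>_def s_def ..
      finally show "?X n \<omega> = (\<Sum>L<n * r n. \<xi> L \<omega> * of_real (W (\<tau> (Suc L)) \<omega> - W (\<tau> L) \<omega>))" .
    qed
    have xE: "expectation (\<lambda>\<omega>. (norm (\<xi> L \<omega>))\<^sup>2) \<le> B\<^sup>2 * expectation (\<lambda>\<omega>. (norm (cutdiff C \<Psi> (s L) (\<tau> L) \<omega>))\<^sup>2)" for L
    proof -
      have xM: "\<xi> L \<in> borel_measurable M" using xF measurable_F_M by blast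
      have "expectation (\<lambda>\<omega>. (norm (\<xi> L \<omega>))\<^sup>2) \<le> expectation (\<lambda>\<omega>. B\<^sup>2 * (norm (cutdiff C \<Psi> (s L) (\<tau> L) \<omega>))\<^sup>2)"
      proof (rule integral_mono)
        have nb: "(norm (\<xi> L \<omega>))\<^sup>2 \<le> (B * (2 * C))\<^sup>2" for \<omega> using xb by (simp add: power_mono)
        show "integrable M (\<lambda>\<omega>. (norm (\<xi> L \<omega>))\<^sup>2)"
          using xM nb by (intro integrable_const_bound[of _ "(B * (2 * C))\<^sup>2"]) auto
        show "integrable M (\<lambda>\<omega>. B\<^sup>2 * (norm (cutdiff C \<Psi> (s L) (\<tau> L) \<omega>))\<^sup>2)"
          using cut_square_integrable[OF s0 s\<tau>] by simp
        show "(norm (\<xi> L \<omega>))\<^sup>2 \<le> B\<^sup>2 * (norm (cutdiff C \<Psi> (s L) (\<tau> L) \<omega>))\<^sup>2" for \<omega>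
          unfolding \<xi>_def norm_mult power_mult_distrib using bnd by (intro mult_right_mono power_mono) auto
      qed
      then show ?thesis by simp
    qed
    have "expectation (\<lambda>\<omega>. (norm (?X n \<omega>))\<^sup>2) = (\<Sum>L<n * r n. expectation (\<lambda>\<omega>. (norm (\<xi> L \<omega>))\<^sup>2) * (t / real (n * r n)))"
      unfolding X using oi(2) by (simp add: increment_variance[OF \<tau>0 \<tau>lt] d del: of_nat_mult)
    also have "\<dots> \<le> (\<Sum>L<n * r n. B\<^sup>2 * expectation (\<lambda>\<omega>. (norm (cutdiff C \<Psi> (s L) (\<tau> L) \<omega>))\<^sup>2) * (t / real (n * r n)))"
      using t by (intro sum_mono mult_right_mono xE) auto
    also have "\<dots> = B\<^sup>2 * expectation (cut_energy C \<Psi> t n (r n))"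
      unfolding expectation_cut_energy sum_fine_reindex[OF r] fn s_def sum_distrib_left by (simp add: mult.assoc)
    finally have "expectation (\<lambda>\<omega>. (norm (?X n \<omega>))\<^sup>2) \<le> B\<^sup>2 * expectation (cut_energy C \<Psi> t n (r n))" .
    then show ?thesis unfolding X using oi(1) by simp
  qed
  show ?thesis
  proof (rule ip_null_L2)
    show "integrable M (\<lambda>\<omega>. (norm (?X n \<omega>))\<^sup>2)" for n using * by blast
    have lim: "(\<lambda>n. B\<^sup>2 * expectation (cut_energy C \<Psi> t n (r n))) \<longlonglongrightarrow> 0"
      by (rule tendsto_mult_right_zero[OF cut_energy_expectation])
    show "(\<lambda>n. expectation (\<lambda>\<omega>. (norm (?X n \<omega>))\<^sup>2)) \<longlonglongrightarrow> 0"
      by (rule real_tendsto_sandwich[OF _ _ tendsto_const lim])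
        (use * in \<open>simp_all add: always_eventually\<close>)
  qed
qed

end

end

section \<open>Increments of the Ito integral against their left-point approximation\<close>

definition ito_error :: "(real \<Rightarrow> 'a \<Rightarrow> complex) \<Rightarrow> (real \<Rightarrow> 'a \<Rightarrow> real) \<Rightarrow> (real \<Rightarrow> 'a \<Rightarrow> complex)
    \<Rightarrow> real \<Rightarrow> nat \<Rightarrow> nat \<Rightarrow> 'a \<Rightarrow> complex" where
  "ito_error \<Psi> W I t n i \<omega> = I (grid t n (Suc i)) \<omega> - I (grid t n i) \<omega>
     - \<Psi> (grid t n i) \<omega> * of_real (W (grid t n (Suc i)) \<omega> - W (grid t n i) \<omega>)"

text \<open>Untruncated counterpart of \<open>cut_block\<close>; the two agree on paths bounded by
  \<open>C\<close>.\<close>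

definition block where
  "block \<Psi> W t n r i \<omega> = (\<Sum>l<r. (\<Psi> (fine_node t n r i l) \<omega> - \<Psi> (grid t n i) \<omega>)
      * complex_of_real (fine_increment W t n r i l \<omega>))"

lemma sum_fine_increment:
  assumes "0 < r"
  shows "(\<Sum>l<r. fine_increment W t n r i l \<omega>) = W (grid t n (Suc i)) \<omega> - W (grid t n i) \<omega>"
proof -
  have "(\<Sum>l<r. fine_increment W t n r i l \<omega>) = W (fine_node t n r i r) \<omega> - W (fine_node t n r i 0) \<omega>"
    unfolding fine_increment_def by (rule sum_lessThan_telescope)
  moreover have "fine_node t n r i r = grid t n (Suc i)"
    using fine_node_0[OF assms, of t n "Suc i"] by (simp add: fine_node_def add.commute)
  ultimately show ?thesis using fine_node_0[OF assms, of t n i] by simp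
qed

text \<open>With \<open>i * r\<close> cells on \<open>[0, t i / n]\<close> the mesh is
  \<open>t / (n r)\<close> for every \<open>i\<close>; this is why the number of cells grows with
  \<open>i\<close>.\<close>

lemma riemann_sum_fine:
  fixes \<Psi> :: "real \<Rightarrow> 'a \<Rightarrow> complex"
  assumes "0 < n" "0 < r"
  shows "riemann_sum \<Psi> W (grid t n i) (i * r) \<omega> =
    (\<Sum>j<i. \<Sum>l<r. of_real (fine_increment W t n r j l \<omega>) * \<Psi> (fine_node t n r j l) \<omega>)"
proof (cases "i = 0")
  case True then show ?thesis by (simp add: riemann_sum_def)
next
  case False
  have node: "grid t n i * real L / real (i * r) = grid t (n * r) L" for L
    using False by simp
  have fs: "fine_node t n r (L div r) (Suc (L mod r)) = grid t (n * r) (Suc L)" for L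
    unfolding fine_node_def by (metis add_Suc_right div_mult_mod_eq)
  show ?thesis
    unfolding riemann_sum_def sum_fine_reindex[OF assms(2)] node fine_increment_def fs
      fine_node_div_mod[OF assms(2)] scaleR_conv_of_real ..
qed

lemma sum_squares_le_square_sum:
  fixes f :: "nat \<Rightarrow> real"
  assumes "\<And>i. i < n \<Longrightarrow> 0 \<le> f i"
  shows "(\<Sum>i<n. (f i)\<^sup>2) \<le> (\<Sum>i<n. f i)\<^sup>2"
  using assms
proof (induction n)
  case (Suc n)
  have "0 \<le> (\<Sum>i<n. f i) * f n" using Suc.prems by (intro mult_nonneg_nonneg sum_nonneg) auto
  then show ?case using Suc by (simp add: power2_sum)
qed simp

lemma riemann_sum_zero_time: "riemann_sum \<Psi> W 0 N \<omega> = 0"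
  by (simp add: riemann_sum_def)

context wiener
begin

context
  fixes \<Psi> I :: "real \<Rightarrow> 'a \<Rightarrow> complex" and t :: real
  assumes t: "0 < t"
    and \<Psi>F: "\<And>s. 0 \<le> s \<Longrightarrow> \<Psi> s \<in> borel_measurable (F s)"
    and I: "\<And>s. 0 \<le> s \<Longrightarrow> is_ito_integral M \<Psi> W s (I s)"
begin

lemma riemann_defect_measurable:
  assumes "0 \<le> s" shows "(\<lambda>\<omega>. norm (riemann_sum \<Psi> W s N \<omega> - I s \<omega>)) \<in> borel_measurable M"
proof -
  have "W (s * real i / real N) \<in> borel_measurable M" "\<Psi> (s * real i / real N) \<in> borel_measurable M" for i
    using assms by (auto intro!: measurable_F_M[OF W_measurable] measurable_F_M[OF \<Psi>F])
  moreover have "I s \<in> borel_measurable M" using I[OF assms] by (simp add: is_ito_integral_def)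
  ultimately show ?thesis unfolding riemann_sum_def by measurable
qed

lemma riemann_defect_eventually:
  assumes "0 < n" "0 < e" "0 < d"
  shows "\<forall>\<^sub>F r in sequentially. measure M {\<omega>\<in>space M. e < norm (riemann_sum \<Psi> W (grid t n i) (i * r) \<omega> - I (grid t n i) \<omega>)} < d"
proof -
  let ?s = "grid t n i"
  have s: "0 \<le> ?s" using t by simp
  have lim: "(\<lambda>N. measure M {\<omega>\<in>space M. e < norm (riemann_sum \<Psi> W ?s N \<omega> - I ?s \<omega>)}) \<longlonglongrightarrow> 0"
    using I[OF s] assms(2) by (simp add: is_ito_integral_def)
  have "(\<lambda>r. measure M {\<omega>\<in>space M. e < norm (riemann_sum \<Psi> W ?s (i * r) \<omega> - I ?s \<omega>)}) \<longlonglongrightarrow> 0"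
  \<comment> \<open>At \<open>i = 0\<close> the cell count \<open>i * r\<close> does not grow with
    \<open>r\<close>, but every sum over \<open>[0, 0]\<close> is \<open>0\<close>, so the number of
    cells is immaterial.\<close>
  proof (cases "i = 0")
    case True
    with lim show ?thesis by (simp add: riemann_sum_zero_time)
  next
    case False
    then have "filterlim (\<lambda>r. i * r) sequentially sequentially"
      by (intro mult_nat_left_at_top) simp
    from filterlim_compose[OF lim this] show ?thesis .
  qed
  then show ?thesis using assms(3) by (rule order_tendstoD(2))
qed

text \<open>The uniform grids of \<open>[0, t i / n]\<close> and \<open>[0, t (i + 1) / n]\<close> with \<open>i r\<close> and \<open>(i + 1) r\<close> cells are nested,
  so increments of the integral are limits of sums over the cells in between.\<close>

lemma ito_refinement:
  "\<exists>r. (\<forall>n. 0 < r n) \<and>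
     ip_null M UNIV (\<lambda>n \<omega>. \<Sum>i<n. norm (ito_error \<Psi> W I t n i \<omega> - block \<Psi> W t n (r n) i \<omega>))"
proof -
  define def where "def = (\<lambda>n r i \<omega>. norm (riemann_sum \<Psi> W (grid t n i) (i * r) \<omega> - I (grid t n i) \<omega>))"
  \<comment> \<open>The same number is the tolerance and the bound on the exceptional probability;
    over \<open>n + 1\<close> grid points the two contributions add up to
    \<open>2 / (n + 1)\<close>.\<close>
  define e where "e = (\<lambda>n. 1 / (real (Suc n))\<^sup>2)"
  have e0: "0 < e n" for n by (simp add: e_def)
  have "\<exists>r>0. n > 0 \<longrightarrow> (\<forall>i\<in>{..n}. measure M {\<omega>\<in>space M. e n < def n r i \<omega>} < e n)" for n
  proof (cases "n = 0")
    case False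
    then have "\<forall>\<^sub>F r in sequentially. \<forall>i\<in>{..n}. measure M {\<omega>\<in>space M. e n < def n r i \<omega>} < e n"
      unfolding def_def using e0 by (intro eventually_ball_finite ballI riemann_defect_eventually) auto
    from eventually_conj[OF this eventually_gt_at_top[of 0]]
    show ?thesis unfolding eventually_sequentially by blast
  qed auto
  then obtain r where r0: "\<And>n. 0 < r n"
    and r: "\<And>n i. n > 0 \<Longrightarrow> i \<le> n \<Longrightarrow> measure M {\<omega>\<in>space M. e n < def n (r n) i \<omega>} < e n"
    by (metis atMost_iff)
  \<comment> \<open>Cutting the total defect at \<open>1\<close> makes it integrable, and the cut is
    inactive as soon as the control is below \<open>1\<close>. At \<open>n = 0\<close> the sum to be
    controlled is empty.\<close>
  define Z where "Z = (\<lambda>n \<omega>. if n = 0 then 0 else min 1 (\<Sum>i\<le>n. def n (r n) i \<omega>))"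
  have defm: "def n k i \<in> borel_measurable M" for n k i
    unfolding def_def using t by (intro riemann_defect_measurable) auto
  have def0: "0 \<le> def n k i \<omega>" for n k i \<omega> by (simp add: def_def)
  have Zm: "Z n \<in> borel_measurable M" for n
    unfolding Z_def using defm by measurable
  have Z0: "0 \<le> Z n \<omega>" for n \<omega> unfolding Z_def using def0 by (simp add: sum_nonneg)
  have Z1: "Z n \<omega> \<le> 1" for n \<omega> unfolding Z_def by simp
  have Zi: "integrable M (Z n)" for n
    by (rule integrable_const_bound[of _ 1]) (use Zm Z0 Z1 in auto)
  have EZ: "expectation (Z n) \<le> 2 * (1 / real (Suc n))" for n
  proof (cases "n = 0")
    case True then show ?thesis by (simp add: Z_def)
  next
    case False
    define B where "B = (\<lambda>i. {\<omega>\<in>space M. e n < def n (r n) i \<omega>})"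
    have B: "B i \<in> events" for i unfolding B_def using defm by measurable
    \<comment> \<open>Either some defect exceeds the tolerance and an indicator alone already gives
      \<open>1\<close>, or all defects stay within it.\<close>
    have le: "Z n \<omega> \<le> (\<Sum>i\<le>n. indicat_real (B i) \<omega> + e n)" if "\<omega> \<in> space M" for \<omega>
    proof (cases "\<exists>i\<le>n. \<omega> \<in> B i")
      case True
      then obtain i where i: "i \<le> n" "\<omega> \<in> B i" by blast
      have "(1::real) \<le> indicat_real (B i) \<omega> + e n" using i e0[of n] by simp
      also have "\<dots> \<le> (\<Sum>i\<le>n. indicat_real (B i) \<omega> + e n)"
        using i e0[of n] by (intro member_le_sum) auto
      finally show ?thesis using Z1[of n \<omega>] by linarith
    next
      case F: False
      have "Z n \<omega> \<le> (\<Sum>i\<le>n. def n (r n) i \<omega>)" using False by (simp add: Z_def)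
      also have "\<dots> \<le> (\<Sum>i\<le>n. indicat_real (B i) \<omega> + e n)"
      proof (rule sum_mono)
        fix i assume "i \<in> {..n}"
        with F that have "def n (r n) i \<omega> \<le> e n" by (auto simp: B_def not_less)
        then show "def n (r n) i \<omega> \<le> indicat_real (B i) \<omega> + e n"
          by (metis add_increasing indicator_pos_le)
      qed
      finally show ?thesis .
    qed
    have "expectation (Z n) \<le> expectation (\<lambda>\<omega>. \<Sum>i\<le>n. indicat_real (B i) \<omega> + e n)"
      by (rule integral_mono)
        (use Zi B le in \<open>auto intro!: Bochner_Integration.integrable_sum Bochner_Integration.integrable_add integrable_real_indicator simp: emeasure_eq_measure\<close>)
    also have "\<dots> = (\<Sum>i\<le>n. measure M (B i) + e n)"
    proof -
      have "integrable M (indicat_real (B i))" for i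
        using B by (intro integrable_real_indicator) (auto simp: emeasure_eq_measure)
      then have "expectation (\<lambda>\<omega>. \<Sum>i\<le>n. indicat_real (B i) \<omega> + e n) = (\<Sum>i\<le>n. expectation (indicat_real (B i)) + e n)"
        by (simp add: prob_space)
      then show ?thesis using B by simp
    qed
    also have "\<dots> \<le> (\<Sum>i\<le>n. e n + e n)"
      using r[of n] False unfolding B_def by (intro sum_mono add_right_mono) (auto intro: less_imp_le)
    also have "\<dots> = 2 * (1 / real (Suc n))"
      by (simp add: e_def power2_eq_square del: of_nat_Suc)
    finally show ?thesis .
  qed
  have lim: "(\<lambda>n. expectation (Z n)) \<longlonglongrightarrow> 0"
  proof (rule real_tendsto_sandwich[OF _ _ tendsto_const])
    show "(\<lambda>n. 2 * (1 / real (Suc n))) \<longlonglongrightarrow> 0"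
      by (rule tendsto_mult_right_zero[OF LIMSEQ_Suc[OF lim_1_over_n]])
  qed (use EZ Z0 in \<open>auto intro!: always_eventually\<close>)
  \<comment> \<open>The error on a cell is the difference of the Riemann defects at its two ends, so
    each defect is counted at most twice.\<close>
  have err: "(\<Sum>i<n. norm (ito_error \<Psi> W I t n i \<omega> - block \<Psi> W t n (r n) i \<omega>)) \<le> 2 * (\<Sum>i\<le>n. def n (r n) i \<omega>)" for n :: nat and \<omega>
  proof (cases "n = 0")
    case True then show ?thesis using def0 by (simp add: sum_nonneg)
  next
    case False
    define R where "R = (\<lambda>i. riemann_sum \<Psi> W (grid t n i) (i * r n) \<omega> - I (grid t n i) \<omega>)"
    have "ito_error \<Psi> W I t n i \<omega> - block \<Psi> W t n (r n) i \<omega> = R i - R (Suc i)" for i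
    proof -
      have "block \<Psi> W t n (r n) i \<omega> =
        (\<Sum>l<r n. of_real (fine_increment W t n (r n) i l \<omega>) * \<Psi> (fine_node t n (r n) i l) \<omega>)
        - \<Psi> (grid t n i) \<omega> * of_real (\<Sum>l<r n. fine_increment W t n (r n) i l \<omega>)"
        unfolding block_def by (simp add: algebra_simps sum_subtractf sum_distrib_left)
      moreover have "riemann_sum \<Psi> W (grid t n (Suc i)) (Suc i * r n) \<omega> - riemann_sum \<Psi> W (grid t n i) (i * r n) \<omega>
        = (\<Sum>l<r n. of_real (fine_increment W t n (r n) i l \<omega>) * \<Psi> (fine_node t n (r n) i l) \<omega>)"
        unfolding riemann_sum_fine[OF False[unfolded neq0_conv] r0] sum.lessThan_Suc by simp
      ultimately show ?thesis
        unfolding ito_error_def R_def sum_fine_increment[OF r0] by (simp add: algebra_simps)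
    qed
    then have "(\<Sum>i<n. norm (ito_error \<Psi> W I t n i \<omega> - block \<Psi> W t n (r n) i \<omega>)) = (\<Sum>i<n. norm (R i - R (Suc i)))" by simp
    also have "\<dots> \<le> (\<Sum>i<n. norm (R i) + norm (R (Suc i)))"
      by (intro sum_mono norm_triangle_ineq4)
    also have "\<dots> = (\<Sum>i<n. norm (R i)) + (\<Sum>i<n. norm (R (Suc i)))" by (rule sum.distrib)
    also have "\<dots> \<le> (\<Sum>i\<le>n. norm (R i)) + (\<Sum>i\<le>n. norm (R i))"
    proof (rule add_mono)
      show "(\<Sum>i<n. norm (R i)) \<le> (\<Sum>i\<le>n. norm (R i))" by (intro sum_mono2) auto
      have "(\<Sum>i<n. norm (R (Suc i))) \<le> norm (R 0) + (\<Sum>i<n. norm (R (Suc i)))" by simp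
      also have "\<dots> = (\<Sum>i\<le>n. norm (R i))"
        using sum.lessThan_Suc_shift[of "\<lambda>i. norm (R i)" n] by (simp add: lessThan_Suc_atMost)
      finally show "(\<Sum>i<n. norm (R (Suc i))) \<le> (\<Sum>i\<le>n. norm (R i))" .
    qed
    finally show ?thesis by (simp add: def_def R_def)
  qed
  have "ip_null M UNIV (\<lambda>n \<omega>. \<Sum>i<n. norm (ito_error \<Psi> W I t n i \<omega> - block \<Psi> W t n (r n) i \<omega>))"
  proof (rule ip_nullI[OF Zi Z0 lim])
    fix \<omega> and k :: "nat \<Rightarrow> nat" assume k: "strict_mono k" and lim: "(\<lambda>m. Z (k m) \<omega>) \<longlonglongrightarrow> 0"
    have "\<forall>\<^sub>F m in sequentially. Z (k m) \<omega> < 1" using lim by (rule order_tendstoD) simp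
    then have ev: "\<forall>\<^sub>F m in sequentially. (\<Sum>i<k m. norm (ito_error \<Psi> W I t (k m) i \<omega> - block \<Psi> W t (k m) (r (k m)) i \<omega>)) \<le> 2 * Z (k m) \<omega>"
    proof eventually_elim
      case (elim m)
      show ?case
      proof (cases "k m = 0")
        case False
        then have "Z (k m) \<omega> = (\<Sum>i\<le>k m. def (k m) (r (k m)) i \<omega>)" using elim by (auto simp: Z_def min_def)
        then show ?thesis using err[of "k m" \<omega>] by simp
      qed (use Z0 in auto)
    qed
    show "(\<lambda>m. \<Sum>i<k m. norm (ito_error \<Psi> W I t (k m) i \<omega> - block \<Psi> W t (k m) (r (k m)) i \<omega>)) \<longlonglongrightarrow> 0"
      by (rule real_tendsto_sandwich[OF _ ev tendsto_const tendsto_mult_right_zero[OF lim]])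
        (auto intro!: always_eventually sum_nonneg)
  qed
  with r0 show ?thesis by blast
qed

text \<open>Two kinds of smallness are recorded because errors enter the quotient in two ways:
  summed squares for products of errors, weighted sums for the linear terms. On paths bounded by
  \<open>C\<close> the truncation changes nothing, and the refinement error is small even as a sum
  of norms, hence harmless for both.\<close>

lemma ito_error_null:
  fixes v :: "real \<Rightarrow> 'a \<Rightarrow> complex"
  assumes C: "0 \<le> C"
    and \<Psi>c: "\<And>\<omega>. \<omega> \<in> space M \<Longrightarrow> continuous_on {0..} (\<lambda>s. \<Psi> s \<omega>)"
    and v: "\<And>s. 0 \<le> s \<Longrightarrow> v s \<in> borel_measurable (F s)" and bnd: "\<And>s \<omega>. norm (v s \<omega>) \<le> B"
  shows "ip_null M {\<omega>. \<forall>s\<in>{0..t}. norm (\<Psi> s \<omega>) \<le> C} (\<lambda>n \<omega>.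
     (\<Sum>i<n. (norm (ito_error \<Psi> W I t n i \<omega>))\<^sup>2,
      \<Sum>i<n. v (grid t n i) \<omega> * ito_error \<Psi> W I t n i \<omega>))"
proof -
  obtain r where r: "\<And>n. 0 < r n" and
    D: "ip_null M UNIV (\<lambda>n \<omega>. \<Sum>i<n. norm (ito_error \<Psi> W I t n i \<omega> - block \<Psi> W t n (r n) i \<omega>))"
    using ito_refinement by blast
  have B: "0 \<le> B" using bnd norm_ge_zero order_trans by blast
  note E = cut_block_squares_null[of t C r \<Psi>, OF t C r \<Psi>F \<Psi>c]
  note V = weighted_cut_block_null[of t C r \<Psi> v B, OF t C r \<Psi>F \<Psi>c v bnd]
  show ?thesis
  proof (rule ip_null_imp[OF ip_null_Pair[OF D ip_null_Pair[OF E V]]])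
    fix \<omega> and k :: "nat \<Rightarrow> nat"
    assume \<omega>: "\<omega> \<in> {\<omega>. \<forall>s\<in>{0..t}. norm (\<Psi> s \<omega>) \<le> C}"
    let ?er = "\<lambda>m i. ito_error \<Psi> W I t (k m) i \<omega>" and ?b = "\<lambda>m i. cut_block C \<Psi> W t (k m) (r (k m)) i \<omega>"
    let ?v = "\<lambda>m i. v (grid t (k m) i) \<omega>"
    assume lim: "(\<lambda>m. (\<Sum>i<k m. norm (?er m i - block \<Psi> W t (k m) (r (k m)) i \<omega>), \<Sum>i<k m. (norm (?b m i))\<^sup>2,
        \<Sum>i<k m. ?v m i * ?b m i)) \<longlonglongrightarrow> 0"
    have bb: "block \<Psi> W t n (r n) i \<omega> = cut_block C \<Psi> W t n (r n) i \<omega>" if i: "i < n" for n i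
    proof -
      have "norm (\<Psi> (fine_node t n (r n) i l) \<omega>) \<le> C" if "l < r n" for l
        using \<omega> fine_node_less(1)[of t i n l "r n"] fine_node_nonneg[of t n "r n" i l] i r[of n] t that by auto
      moreover have "norm (\<Psi> (grid t n i) \<omega>) \<le> C"
      proof -
        have "0 \<le> grid t n i" "grid t n i \<le> t"
          using i t by (auto simp: divide_le_eq)
        then show ?thesis using \<omega> by auto
      qed
      ultimately show ?thesis unfolding block_def cut_block_def
        by (intro sum.cong refl) (simp add: cutdiff_def)
    qed
    have dl: "(\<lambda>m. \<Sum>i<k m. norm (?er m i - ?b m i)) \<longlonglongrightarrow> 0"
      using tendsto_fst[OF lim] bb by (simp add: zero_prod_def)
    have el: "(\<lambda>m. \<Sum>i<k m. (norm (?b m i))\<^sup>2) \<longlonglongrightarrow> 0"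
      using tendsto_fst[OF tendsto_snd[OF lim]] by (simp add: zero_prod_def)
    have vl: "(\<lambda>m. \<Sum>i<k m. ?v m i * ?b m i) \<longlonglongrightarrow> 0"
      using tendsto_snd[OF tendsto_snd[OF lim]] by (simp add: zero_prod_def)
    have sq: "(\<Sum>i<k m. (norm (?er m i))\<^sup>2) \<le> 2 * (\<Sum>i<k m. norm (?er m i - ?b m i))\<^sup>2 + 2 * (\<Sum>i<k m. (norm (?b m i))\<^sup>2)" for m
    proof -
      have "(norm (?er m i))\<^sup>2 \<le> 2 * (norm (?er m i - ?b m i))\<^sup>2 + 2 * (norm (?b m i))\<^sup>2" for i
      proof -
        have "norm (?er m i) \<le> norm (?er m i - ?b m i) + norm (?b m i)"
          using norm_triangle_ineq[of "?er m i - ?b m i" "?b m i"] by simp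
        then have "(norm (?er m i))\<^sup>2 \<le> (norm (?er m i - ?b m i) + norm (?b m i))\<^sup>2"
          by (intro power_mono) auto
        also have "\<dots> \<le> 2 * (norm (?er m i - ?b m i))\<^sup>2 + 2 * (norm (?b m i))\<^sup>2"
          using sum_squares_bound[of "norm (?er m i - ?b m i)" "norm (?b m i)"] by (simp add: power2_sum)
        finally show ?thesis .
      qed
      then have "(\<Sum>i<k m. (norm (?er m i))\<^sup>2) \<le> (\<Sum>i<k m. 2 * (norm (?er m i - ?b m i))\<^sup>2 + 2 * (norm (?b m i))\<^sup>2)"
        by (intro sum_mono)
      also have "\<dots> = 2 * (\<Sum>i<k m. (norm (?er m i - ?b m i))\<^sup>2) + 2 * (\<Sum>i<k m. (norm (?b m i))\<^sup>2)"
        by (simp add: sum.distrib sum_distrib_left)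
      also have "(\<Sum>i<k m. (norm (?er m i - ?b m i))\<^sup>2) \<le> (\<Sum>i<k m. norm (?er m i - ?b m i))\<^sup>2"
        by (rule sum_squares_le_square_sum) auto
      finally show ?thesis by simp
    qed
    have s1: "(\<lambda>m. \<Sum>i<k m. (norm (?er m i))\<^sup>2) \<longlonglongrightarrow> 0"
    proof (rule real_tendsto_sandwich[OF _ _ tendsto_const])
      show "(\<lambda>m. 2 * (\<Sum>i<k m. norm (?er m i - ?b m i))\<^sup>2 + 2 * (\<Sum>i<k m. (norm (?b m i))\<^sup>2)) \<longlonglongrightarrow> 0"
        by (rule tendsto_eq_intros dl el | simp)+
    qed (use sq in \<open>auto intro!: always_eventually sum_nonneg\<close>)
    have "(\<lambda>m. \<Sum>i<k m. ?v m i * (?er m i - ?b m i)) \<longlonglongrightarrow> 0"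
    proof (rule Lim_null_comparison)
      show "\<forall>\<^sub>F m in sequentially. norm (\<Sum>i<k m. ?v m i * (?er m i - ?b m i)) \<le> B * (\<Sum>i<k m. norm (?er m i - ?b m i))"
        unfolding sum_distrib_left using bnd
        by (intro always_eventually allI sum_norm_le) (simp add: norm_mult mult_right_mono)
      show "(\<lambda>m. B * (\<Sum>i<k m. norm (?er m i - ?b m i))) \<longlonglongrightarrow> 0"
        by (rule tendsto_mult_right_zero[OF dl])
    qed
    from tendsto_add[OF this vl]
    have s2: "(\<lambda>m. \<Sum>i<k m. ?v m i * ?er m i) \<longlonglongrightarrow> 0"
      by (simp add: sum.distrib[symmetric] algebra_simps)
    show "(\<lambda>m. (\<Sum>i<k m. (norm (?er m i))\<^sup>2, \<Sum>i<k m. ?v m i * ?er m i)) \<longlonglongrightarrow> 0"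
      unfolding zero_prod_def by (rule tendsto_Pair[OF s1 s2])
  qed auto
qed

end

end

section \<open>Pathwise ratio of two solutions\<close>

lemma norm_diff_mono:
  fixes a b :: "'a::real_normed_vector"
  shows "norm a \<le> r \<Longrightarrow> norm b \<le> s \<Longrightarrow> norm (a - b) \<le> r + s"
  using norm_triangle_ineq4[of a b] by linarith

text \<open>The factor \<open>2\<close> is \<open>exp 1\<close>, rounded up to \<open>4\<close>,
  divided by \<open>fact 2\<close>.\<close>

lemma norm_exp_Taylor2:
  fixes z :: complex
  assumes "norm z \<le> 1"
  shows "norm (exp z - (1 + z + z\<^sup>2 / 2)) \<le> 2 * norm z ^ 3"
proof -
  have "norm (exp z - (\<Sum>k\<le>2. z ^ k / fact k)) \<le> exp \<bar>Re z\<bar> * (norm z) ^ Suc 2 / fact 2"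
    by (rule Taylor_exp)
  moreover have "(\<Sum>k\<le>2. z ^ k / fact k) = 1 + z + z\<^sup>2 / 2"
    by (simp add: numeral_2_eq_2)
  moreover have "exp \<bar>Re z\<bar> \<le> exp 1"
    using abs_Re_le_cmod[of z] assms by simp
  then have "exp \<bar>Re z\<bar> \<le> 3" using exp_le by linarith
  then have "exp \<bar>Re z\<bar> * norm z ^ 3 \<le> 4 * norm z ^ 3" by (intro mult_right_mono) auto
  ultimately show ?thesis by (simp add: numeral_3_eq_3)
qed

lemma norm_exp_bounds:
  fixes z :: complex
  assumes "norm z \<le> 1"
  shows "norm (exp z) \<le> 3" and "norm (exp z - 1) \<le> 3 * norm z"
proof -
  have "norm (exp z) \<le> exp (norm z)" by (rule norm_exp)
  also have "\<dots> \<le> exp 1" using assms by simp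
  finally show "norm (exp z) \<le> 3" using exp_le by linarith
  have "exp \<bar>Re z\<bar> \<le> exp 1" using abs_Re_le_cmod[of z] assms by simp
  then have "exp \<bar>Re z\<bar> \<le> 3" using exp_le by linarith
  then have "exp \<bar>Re z\<bar> * norm z \<le> 3 * norm z" by (intro mult_right_mono) auto
  then show "norm (exp z - 1) \<le> 3 * norm z" using Taylor_exp[of z 0] by simp
qed

text \<open>The relations between \<open>b\<close>, \<open>\<kappa>\<close> and \<open>\<nu>\<close> say that the terms of order \<open>w\<close> and \<open>d\<close> cancel in \<open>w\<^sup>2 \<approx> d\<close>.\<close>

lemma step_expansion:
  fixes a a' b b' u z \<kappa> \<nu> :: complex and h w d K \<epsilon> :: real
  assumes z: "z = of_real (h * w) + u" and b: "b = b' - of_real h"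
    and \<kappa>: "\<kappa> = b' * of_real h - of_real (h\<^sup>2) / 2" and \<nu>: "\<nu> = a' - a - \<kappa>"
    and u: "norm (u - \<nu> * of_real d) \<le> \<epsilon> * d" and \<epsilon>: "0 \<le> \<epsilon>" "\<epsilon> \<le> 1" and d: "0 \<le> d" "d \<le> 1"
    and K: "1 \<le> K" "norm b' \<le> K" "norm a' \<le> K" "\<bar>h\<bar> \<le> K" "norm \<nu> + 1 \<le> K"
    and q: "K * (\<bar>w\<bar> + d) \<le> 1"
  shows "norm ((1 + b * of_real w + a * of_real d) - (1 + b' * of_real w + a' * of_real d) * exp (- z)
      - \<kappa> * of_real (w\<^sup>2 - d)) \<le> \<epsilon> * d + 20 * K ^ 3 * (\<bar>w\<bar> + d) * (w\<^sup>2 + d)"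
    and "norm z \<le> K * (\<bar>w\<bar> + d)"
proof -
  \<comment> \<open>\<open>q\<close> is the size of first-order terms and \<open>p\<close> that of
    second-order ones. Since \<open>q^2 \<le> 2 p\<close>, third-order remainders are bounded by
    multiples of \<open>q * p\<close>; these are negligible after summation, because the
    \<open>p\<close> of all cells have bounded sum while \<open>q\<close> becomes uniformly
    small.\<close>
  define p where "p = w\<^sup>2 + d"
  define q where "q = \<bar>w\<bar> + d"
  have p0: "0 \<le> p" and q0: "0 \<le> q" and dp: "d \<le> p" and wq: "\<bar>w\<bar> \<le> q" and dq: "d \<le> q"
    using d by (auto simp: p_def q_def)
  have K0: "0 \<le> K" using K by simp
  have qp: "q\<^sup>2 \<le> 2 * p"
  proof -
    have "q\<^sup>2 \<le> 2 * w\<^sup>2 + 2 * d\<^sup>2"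
      using sum_squares_bound[of "\<bar>w\<bar>" d] by (simp add: q_def power2_sum)
    moreover have "d\<^sup>2 \<le> d" using d by (simp add: power2_eq_square mult_left_le)
    ultimately show ?thesis by (simp add: p_def)
  qed
  have nu: "norm u \<le> K * d"
  proof -
    have "norm u \<le> norm (u - \<nu> * of_real d) + norm (\<nu> * of_real d)"
      by (metis diff_add_cancel norm_triangle_ineq)
    also have "\<dots> \<le> 1 * d + norm \<nu> * d"
      using order_trans[OF u mult_right_mono[OF \<epsilon>(2) d(1)]] d by (intro add_mono) (auto simp: norm_mult)
    also have "\<dots> = (norm \<nu> + 1) * d" by (simp add: algebra_simps)
    also have "\<dots> \<le> K * d" using K d by (intro mult_right_mono) auto
    finally show ?thesis .
  qed
  have hw: "norm (of_real (h * w) :: complex) \<le> K * \<bar>w\<bar>"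
    using K by (simp add: norm_mult mult_right_mono)
  show nz: "norm z \<le> K * (\<bar>w\<bar> + d)"
    unfolding z distrib_left using norm_triangle_le[OF add_mono[OF hw nu]] .
  then have nzq: "norm z \<le> K * q" by (simp add: q_def)
  have nz1: "norm (- z) \<le> 1" using nz q by simp
  define r where "r = exp (- z) - (1 + (- z) + (- z)\<^sup>2 / 2)"
  have z2: "(norm z)\<^sup>2 \<le> 2 * K\<^sup>2 * p"
  proof -
    have "(norm z)\<^sup>2 \<le> (K * q)\<^sup>2" using nzq by (intro power_mono) auto
    also have "\<dots> = K\<^sup>2 * q\<^sup>2" by (simp add: power_mult_distrib)
    also have "\<dots> \<le> K\<^sup>2 * (2 * p)" using qp by (intro mult_left_mono) auto
    finally show ?thesis by simp
  qed
  have z3: "(norm z) ^ 3 \<le> 2 * K ^ 3 * q * p"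
  proof -
    have "(norm z) ^ 3 = norm z * (norm z)\<^sup>2" by (simp add: power2_eq_square power3_eq_cube)
    also have "\<dots> \<le> (K * q) * (2 * K\<^sup>2 * p)" using nzq z2 K0 q0 by (intro mult_mono) auto
    finally show ?thesis by (simp add: power2_eq_square power3_eq_cube algebra_simps)
  qed
  have nr: "norm r \<le> 2 * (norm z) ^ 3"
    using norm_exp_Taylor2[OF nz1] by (simp add: r_def)
  have r1: "norm r \<le> 4 * K ^ 3 * (q * p)" using nr z3 by simp
  have K23: "K\<^sup>2 \<le> K ^ 3" using K by (intro power_increasing) auto
  have qp0: "0 \<le> q * p" using q0 p0 by simp
  have K2q: "K\<^sup>2 * (q * p) \<le> K ^ 3 * (q * p)" using K23 qp0 by (intro mult_right_mono) auto
  define B where "B = b' * of_real w + a' * of_real d"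
  have nB: "norm B \<le> K * q"
  proof -
    have "norm B \<le> norm b' * \<bar>w\<bar> + norm a' * d"
      unfolding B_def using d by (intro norm_triangle_le) (simp add: norm_mult)
    also have "\<dots> \<le> K * \<bar>w\<bar> + K * d" using K d by (intro add_mono mult_right_mono) auto
    finally show ?thesis by (simp add: q_def algebra_simps)
  qed
  have t1: "norm ((of_real (h * w))\<^sup>2 / 2 - z\<^sup>2 / 2) \<le> K ^ 3 * (q * p)"
  proof -
    have "(of_real (h * w))\<^sup>2 / 2 - z\<^sup>2 / 2 = - u * (of_real (h * w) + z) / 2"
      by (simp add: z power2_eq_square algebra_simps)
    then have "norm ((of_real (h * w))\<^sup>2 / 2 - z\<^sup>2 / 2) = norm u * norm (of_real (h * w) + z) / 2"
      by (simp add: norm_mult norm_divide)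
    also have "\<dots> \<le> (K * p) * (K * q + K * q) / 2"
    proof (intro divide_right_mono mult_mono)
      show "norm u \<le> K * p" using nu dp K0 by (meson mult_left_mono order_trans)
      have "norm (of_real (h * w) :: complex) \<le> K * q" using hw wq K0 by (meson mult_left_mono order_trans)
      then show "norm (of_real (h * w) + z) \<le> K * q + K * q" using nzq by (rule norm_triangle_le[OF add_mono])
    qed (use K0 p0 in auto)
    also have "\<dots> = K\<^sup>2 * (q * p)" by (simp add: power2_eq_square)
    finally show ?thesis using K2q by simp
  qed
  have t2: "norm (b' * of_real w * u) \<le> K ^ 3 * (q * p)"
  proof -
    have "norm (b' * of_real w * u) \<le> (K * q) * (K * p)"
      unfolding norm_mult
    proof (intro mult_mono)
      show "norm (of_real w :: complex) \<le> q" using wq by simp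
      show "norm u \<le> K * p" using nu dp K0 by (meson mult_left_mono order_trans)
    qed (use K K0 q0 in auto)
    also have "\<dots> = K\<^sup>2 * (q * p)" by (simp add: power2_eq_square)
    finally show ?thesis using K2q by simp
  qed
  have t3: "norm (a' * of_real d * z) \<le> K ^ 3 * (q * p)"
  proof -
    have "norm (a' * of_real d * z) \<le> (K * p) * (K * q)"
      unfolding norm_mult using nzq dp d K K0 p0 by (intro mult_mono) auto
    also have "\<dots> = K\<^sup>2 * (q * p)" by (simp add: power2_eq_square)
    finally show ?thesis using K2q by simp
  qed
  have t4: "norm (B * (z\<^sup>2 / 2 + r)) \<le> 5 * K ^ 3 * (q * p)"
  proof -
    have "norm z ^ 3 \<le> norm z ^ 2" using nz1 by (intro power_decreasing) auto
    then have "norm (z\<^sup>2 / 2 + r) \<le> (norm z)\<^sup>2 / 2 + 2 * (norm z)\<^sup>2"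
      using nr by (intro norm_triangle_le) (simp add: norm_divide norm_power)
    also have "\<dots> \<le> 5 * K\<^sup>2 * p" using z2 by linarith
    finally have "norm (B * (z\<^sup>2 / 2 + r)) \<le> (K * q) * (5 * K\<^sup>2 * p)"
      unfolding norm_mult using nB K0 q0 by (intro mult_mono) auto
    then show ?thesis by (simp add: power2_eq_square power3_eq_cube algebra_simps)
  qed
  have ez: "exp (- z) = 1 - z + z\<^sup>2 / 2 + r" by (simp add: r_def)
  \<comment> \<open>After the cancellations the six remaining terms are of third order or of size
    \<open>\<epsilon> * d\<close>; the third-order constants add up to \<open>12\<close>, rounded up
    to \<open>20\<close>.\<close>
  have "(1 + b * of_real w + a * of_real d) - (1 + b' * of_real w + a' * of_real d) * exp (- z) - \<kappa> * of_real (w\<^sup>2 - d)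
     = (u - \<nu> * of_real d) + ((of_real (h * w))\<^sup>2 / 2 - z\<^sup>2 / 2) + b' * of_real w * u + a' * of_real d * z
        - B * (z\<^sup>2 / 2 + r) - r"
    unfolding ez unfolding b \<nu> \<kappa> B_def z by (simp add: power2_eq_square field_simps)
  also have "norm \<dots> \<le> \<epsilon> * d + K ^ 3 * (q * p) + K ^ 3 * (q * p) + K ^ 3 * (q * p) + 5 * K ^ 3 * (q * p) + 4 * K ^ 3 * (q * p)"
    by (intro norm_triangle_mono norm_diff_mono u t1 t2 t3 t4 r1)
  also have "\<dots> = \<epsilon> * d + 12 * (K ^ 3 * (q * p))" by simp
  also have "\<dots> \<le> \<epsilon> * d + 20 * (K ^ 3 * (q * p))"
    using mult_nonneg_nonneg[OF zero_le_power[OF K0, of 3] qp0] by linarith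
  finally show "norm ((1 + b * of_real w + a * of_real d) - (1 + b' * of_real w + a' * of_real d) * exp (- z)
      - \<kappa> * of_real (w\<^sup>2 - d)) \<le> \<epsilon> * d + 20 * K ^ 3 * (\<bar>w\<bar> + d) * (w\<^sup>2 + d)"
    by (simp add: p_def q_def mult.assoc)
qed

text \<open>Discrete product rule for \<open>v * x\<close>, where \<open>v\<close> is an exponential
  divided by \<open>y\<close>. To leading order there remain the compensated square
  \<open>w^2 - d\<close> and the two defects, all with factors taken at the left node as the
  stochastic limits require; everything else is a product of small quantities. The condition
  \<open>small\<close> absorbs the remainder of \<open>step_expansion\<close> into
  \<open>\<epsilon> * (w^2 + d)\<close>.\<close>

lemma ratio_step:
  fixes x0 x1 y0 y1 v0 v1 e e' a a' b b' u z \<kappa> \<nu> :: complex and h w d K \<epsilon> :: real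
  assumes x1: "x1 = x0 * (1 + b * of_real w + a * of_real d) + e"
    and y1: "y1 = y0 * (1 + b' * of_real w + a' * of_real d) + e'" and y0: "y0 \<noteq> 0"
    and v0: "v0 = v1 * exp (- z) * y1 / y0"
    and z: "z = of_real (h * w) + u" and b: "b = b' - of_real h"
    and \<kappa>: "\<kappa> = b' * of_real h - of_real (h\<^sup>2) / 2" and \<nu>: "\<nu> = a' - a - \<kappa>"
    and u: "norm (u - \<nu> * of_real d) \<le> \<epsilon> * d" and \<epsilon>: "0 \<le> \<epsilon>" "\<epsilon> \<le> 1" and d: "0 \<le> d" "d \<le> 1"
    and K: "1 \<le> K" "norm b' \<le> K" "norm a' \<le> K" "\<bar>h\<bar> \<le> K" "norm \<nu> + 1 \<le> K" "norm \<kappa> \<le> K"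
      "norm x0 \<le> K" "norm v0 \<le> K" "norm v1 \<le> K" "norm (x0 / y0) \<le> K" "norm (1 / y0) \<le> K"
    and small: "20 * K ^ 3 * (\<bar>w\<bar> + d) \<le> \<epsilon>" and dv: "norm (v1 - v0) \<le> \<epsilon>"
  shows "norm (v1 * x1 - v0 * x0 - (v0 * x0 * \<kappa> * of_real (w\<^sup>2 - d) + v0 * e - v0 * (x0 / y0) * e'))
    \<le> 21 * K ^ 3 * (\<epsilon> * (w\<^sup>2 + d) + (\<bar>w\<bar> + d + norm e') * (norm e + norm e'))"
proof -
  define p where "p = w\<^sup>2 + d"
  define q where "q = \<bar>w\<bar> + d"
  define R where "R = (1 + b * of_real w + a * of_real d) - (1 + b' * of_real w + a' * of_real d) * exp (- z) - \<kappa> * of_real (w\<^sup>2 - d)"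
  have p0: "0 \<le> p" and q0: "0 \<le> q" and dp: "d \<le> p" using d by (auto simp: p_def q_def)
  have K0: "0 \<le> K" using K by simp
  have K3: "K \<le> K ^ 3" "K\<^sup>2 \<le> K ^ 3"
    using power_increasing[of 1 3 K] power_increasing[of 2 3 K] K by auto
  have Kq: "K * (\<bar>w\<bar> + d) \<le> 1"
  proof -
    have "K * q \<le> 20 * K ^ 3 * q" using K3 K0 q0 by (intro mult_right_mono) auto
    then show ?thesis using small \<epsilon> unfolding q_def by linarith
  qed
  note se = step_expansion[OF z b \<kappa> \<nu> u \<epsilon> d K(1-5) Kq]
  have R: "norm R \<le> 2 * (\<epsilon> * p)"
  proof -
    have "norm R \<le> \<epsilon> * d + 20 * K ^ 3 * (\<bar>w\<bar> + d) * (w\<^sup>2 + d)" using se(1) by (simp add: R_def)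
    also have "\<dots> \<le> \<epsilon> * p + \<epsilon> * p"
      using mult_right_mono[OF small p0] mult_left_mono[OF dp \<epsilon>(1)] by (simp add: p_def)
    finally show ?thesis by simp
  qed
  have nz: "norm z \<le> K * q" using se(2) by (simp add: q_def)
  have nz1: "norm (- z) \<le> 1" using se(2) Kq by simp
  have E: "norm (exp (- z)) \<le> 3" "norm (exp (- z) - 1) \<le> 3 * (K * q)"
    using norm_exp_bounds[OF nz1] nz by auto
  define D where "D = x0 * \<kappa> * of_real (w\<^sup>2 - d) + x0 * R + e - (x0 / y0) * e' * exp (- z)"
  have yy: "y1 / y0 = 1 + b' * of_real w + a' * of_real d + e' / y0"
    using y0 by (simp add: y1 add_divide_distrib)
  have D: "D = x1 - x0 * exp (- z) * (y1 / y0)"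
    unfolding yy D_def R_def x1 by (simp add: algebra_simps)
  \<comment> \<open>The increment appears with the factor \<open>v1\<close>, which looks one step
    ahead; replacing it by \<open>v0\<close> costs \<open>(v1 - v0) * D\<close>, a term of higher
    order.\<close>
  have main: "v1 * x1 - v0 * x0 = v1 * D"
    unfolding D v0 by (simp add: algebra_simps)
  have eq: "v1 * x1 - v0 * x0 - (v0 * x0 * \<kappa> * of_real (w\<^sup>2 - d) + v0 * e - v0 * (x0 / y0) * e')
    = v0 * x0 * R - v0 * (x0 / y0) * (e' * (exp (- z) - 1)) + (v1 - v0) * D"
  proof -
    have "v1 * D = v0 * D + (v1 - v0) * D" by (simp add: algebra_simps)
    then show ?thesis unfolding main by (simp add: D_def algebra_simps)
  qed
  define T where "T = (q + norm e') * (norm e + norm e')"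
  have T0: "0 \<le> T" using q0 by (simp add: T_def)
  have ep: "0 \<le> \<epsilon> * p" using \<epsilon> p0 by simp
  have s1: "norm (v0 * x0 * R) \<le> 2 * K ^ 3 * (\<epsilon> * p)"
  proof -
    have "norm (v0 * x0 * R) \<le> K * K * (2 * (\<epsilon> * p))"
      unfolding norm_mult using K R K0 by (intro mult_mono) auto
    also have "\<dots> = 2 * K\<^sup>2 * (\<epsilon> * p)" by (simp add: power2_eq_square)
    also have "\<dots> \<le> 2 * K ^ 3 * (\<epsilon> * p)" using K3 ep by (intro mult_right_mono) auto
    finally show ?thesis .
  qed
  have qe: "norm e' * q \<le> T"
  proof -
    have "norm e' * q \<le> (norm e + norm e') * (q + norm e')" using q0 by (intro mult_mono) auto
    then show ?thesis by (simp add: T_def mult.commute)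
  qed
  have s2: "norm (v0 * (x0 / y0) * (e' * (exp (- z) - 1))) \<le> 3 * K ^ 3 * T"
  proof -
    have "norm (v0 * (x0 / y0) * (e' * (exp (- z) - 1))) = norm v0 * norm (x0 / y0) * (norm e' * norm (exp (- z) - 1))"
      by (simp only: norm_mult)
    also have "\<dots> \<le> K * K * (norm e' * (3 * (K * q)))"
      using K E K0 by (intro mult_mono) auto
    also have "\<dots> = 3 * K ^ 3 * (norm e' * q)" by (simp add: power3_eq_cube)
    also have "\<dots> \<le> 3 * K ^ 3 * T" using qe K0 by (intro mult_left_mono) auto
    finally show ?thesis .
  qed
  \<comment> \<open>Two bounds on \<open>v1 - v0\<close> are used: \<open>\<epsilon>\<close> against
    the second-order part of \<open>D\<close>, and this first-order bound against the defects, for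
    which only sums of squares are controlled.\<close>
  have dv2: "norm (v1 - v0) \<le> 6 * K\<^sup>2 * (q + norm e')"
  proof -
    have "v1 - v0 = - (v1 * ((exp (- z) - 1) + exp (- z) * (b' * of_real w + a' * of_real d + e' * (1 / y0))))"
      unfolding v0 times_divide_eq_right[symmetric] yy by (simp add: algebra_simps)
    also have "norm \<dots> = norm v1 * norm ((exp (- z) - 1) + exp (- z) * (b' * of_real w + a' * of_real d + e' * (1 / y0)))"
      by (simp only: norm_minus_cancel norm_mult)
    also have "\<dots> \<le> K * (3 * (K * q) + 3 * (K * \<bar>w\<bar> + K * d + norm e' * K))"
    proof (intro mult_mono norm_triangle_mono E K)
      have "norm (b' * of_real w + a' * of_real d + e' * (1 / y0)) \<le> K * \<bar>w\<bar> + K * d + norm e' * K"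
      proof (intro norm_triangle_mono)
        show "norm (b' * of_real w) \<le> K * \<bar>w\<bar>" "norm (a' * of_real d) \<le> K * d"
          using K d by (auto simp: norm_mult intro: mult_right_mono)
        show "norm (e' * (1 / y0)) \<le> norm e' * K"
          unfolding norm_mult using K by (intro mult_left_mono) auto
      qed
      then show "norm (exp (- z) * (b' * of_real w + a' * of_real d + e' * (1 / y0))) \<le> 3 * (K * \<bar>w\<bar> + K * d + norm e' * K)"
        unfolding norm_mult[of "exp (- z)"] using E by (intro mult_mono) auto
    qed (use K0 in auto)
    also have "\<dots> = K\<^sup>2 * (6 * q + 3 * norm e')"
      by (simp add: q_def power2_eq_square algebra_simps)
    also have "\<dots> \<le> K\<^sup>2 * (6 * (q + norm e'))" by (intro mult_left_mono) auto
    finally show ?thesis by (simp only: mult.assoc mult.left_commute[of 6])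
  qed
  have s3: "norm ((v1 - v0) * D) \<le> 3 * K ^ 3 * (\<epsilon> * p) + 18 * K ^ 3 * T"
  proof -
    have wd: "\<bar>w\<^sup>2 - d\<bar> \<le> p" using d by (simp add: p_def abs_if)
    have "norm D \<le> K * K * p + K * (2 * p) + norm e + K * norm e' * 3"
      unfolding D_def
    proof (intro norm_triangle_mono norm_diff_mono)
      show "norm (x0 * \<kappa> * of_real (w\<^sup>2 - d)) \<le> K * K * p"
        using K wd K0 by (simp only: norm_mult norm_of_real) (intro mult_mono, auto)
      have "norm R \<le> 2 * p" using R \<epsilon> p0 mult_right_mono[of \<epsilon> 1 p] by simp
      then show "norm (x0 * R) \<le> K * (2 * p)" unfolding norm_mult using K K0 by (intro mult_mono) auto
      show "norm (x0 / y0 * e' * exp (- z)) \<le> K * norm e' * 3"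
        unfolding norm_mult[of "x0 / y0 * e'"] norm_mult[of "x0 / y0"] using K E K0 by (intro mult_mono) auto
    qed auto
    also have "\<dots> \<le> 3 * K\<^sup>2 * p + 3 * K * (norm e + norm e')"
    proof -
      have "K * p \<le> K\<^sup>2 * p" using K p0 by (intro mult_right_mono) (auto simp: power2_eq_square)
      moreover have "norm e \<le> 3 * K * norm e" using K mult_right_mono[of 1 "3 * K" "norm e"] by simp
      ultimately show ?thesis by (simp add: power2_eq_square algebra_simps)
    qed
    finally have nD: "norm D \<le> 3 * K\<^sup>2 * p + 3 * K * (norm e + norm e')" .
    have "norm ((v1 - v0) * D) \<le> norm (v1 - v0) * (3 * K\<^sup>2 * p) + norm (v1 - v0) * (3 * K * (norm e + norm e'))"
      unfolding norm_mult distrib_left[symmetric] using nD by (intro mult_left_mono) auto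
    also have "\<dots> \<le> \<epsilon> * (3 * K\<^sup>2 * p) + 6 * K\<^sup>2 * (q + norm e') * (3 * K * (norm e + norm e'))"
      using dv dv2 p0 K0 by (intro add_mono mult_right_mono) auto
    also have "\<dots> = 3 * K\<^sup>2 * (\<epsilon> * p) + 18 * K ^ 3 * T"
      by (simp add: T_def power2_eq_square power3_eq_cube)
    also have "\<dots> \<le> 3 * K ^ 3 * (\<epsilon> * p) + 18 * K ^ 3 * T"
      using K3 ep by (intro add_mono mult_right_mono order_refl) auto
    finally show ?thesis .
  qed
  have "norm (v1 * x1 - v0 * x0 - (v0 * x0 * \<kappa> * of_real (w\<^sup>2 - d) + v0 * e - v0 * (x0 / y0) * e'))
    \<le> 2 * K ^ 3 * (\<epsilon> * p) + 3 * K ^ 3 * T + (3 * K ^ 3 * (\<epsilon> * p) + 18 * K ^ 3 * T)"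
    unfolding eq by (intro norm_triangle_mono norm_diff_mono s1 s2 s3)
  also have "\<dots> = 5 * (K ^ 3 * (\<epsilon> * p)) + 21 * K ^ 3 * T" by (simp add: algebra_simps)
  also have "\<dots> \<le> 21 * (K ^ 3 * (\<epsilon> * p)) + 21 * K ^ 3 * T"
    using mult_nonneg_nonneg[OF zero_le_power[OF K0, of 3] ep] by linarith
  also have "\<dots> = 21 * K ^ 3 * (\<epsilon> * (w\<^sup>2 + d) + (\<bar>w\<bar> + d + norm e') * (norm e + norm e'))"
    by (simp add: T_def p_def q_def algebra_simps)
  finally show ?thesis .
qed

lemma integral_left_endpoint_error:
  fixes f :: "real \<Rightarrow> complex"
  assumes "p \<le> q" "continuous_on {p..q} f" "\<And>u. u \<in> {p..q} \<Longrightarrow> norm (f u - f p) \<le> \<epsilon>"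
  shows "norm (integral {p..q} f - f p * of_real (q - p)) \<le> \<epsilon> * (q - p)"
proof -
  have i: "f integrable_on {p..q}" using assms(2) by (rule integrable_continuous_real)
  have "integral {p..q} f - f p * of_real (q - p) = integral {p..q} (\<lambda>u. f u - f p)"
    using i assms(1) by (subst Henstock_Kurzweil_Integration.integral_diff) (auto simp: scaleR_conv_of_real mult.commute)
  moreover have "norm (integral {p..q} (\<lambda>u. f u - f p)) \<le> \<epsilon> * (q - p)"
    using assms by (intro integral_bound continuous_intros) auto
  ultimately show ?thesis by simp
qed

lemma grid_bounds:
  assumes "0 \<le> t" "i < n"
  shows "0 \<le> grid t n i" "grid t n i \<le> grid t n (Suc i)"
    "grid t n (Suc i) \<le> t" "grid t n (Suc i) - grid t n i = t / real n"
proof -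
  show d: "grid t n (Suc i) - grid t n i = t / real n"
    unfolding diff_divide_distrib[symmetric] by (simp add: algebra_simps)
  show "0 \<le> grid t n i" using assms by simp
  have "0 \<le> t / real n" using assms by simp
  then show "grid t n i \<le> grid t n (Suc i)" using d by linarith
  have "t * real (Suc i) \<le> t * real n" using assms by (intro mult_left_mono) auto
  then show "grid t n (Suc i) \<le> t" using assms by (simp add: divide_le_eq)
qed

lemma continuous_on_bounded:
  fixes f :: "real \<Rightarrow> complex"
  assumes "continuous_on {a..b} f"
  obtains B where "0 \<le> B" "\<And>u. u \<in> {a..b} \<Longrightarrow> norm (f u) \<le> B"
proof -
  have "bounded (f ` {a..b})"
    using assms by (intro compact_imp_bounded compact_continuous_image) auto
  then obtain B where "\<forall>z\<in>f ` {a..b}. norm z \<le> B" unfolding bounded_iff by blast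
  then have "\<And>u. u \<in> {a..b} \<Longrightarrow> norm (f u) \<le> B" by blast
  then show thesis using that[of "max 0 B"] by (meson max.cobounded1 max.coboundedI2)
qed

text \<open>The increments of \<open>v * x\<close> telescope; the leading terms vanish by
  \<open>L2\<close>, \<open>L2'\<close> and \<open>L3\<close>, and in the limit the remainder is at
  most \<open>42 K^3 t \<epsilon>\<close> for every \<open>\<epsilon>\<close>. Only squares of
  Wiener increments have bounded sums here, by \<open>L4\<close>, so products with the defects are
  treated by the Cauchy-Schwarz inequality.\<close>

lemma ratio_pathwise:
  fixes x y \<mu> Y v \<kappa> :: "real \<Rightarrow> complex" and w :: "real \<Rightarrow> real" and a a' g :: complex
    and s s' c t h :: real and k :: "nat \<Rightarrow> nat" and e e' :: "nat \<Rightarrow> nat \<Rightarrow> complex"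
  assumes t: "0 < t" and cx: "continuous_on {0..t} x" and cy: "continuous_on {0..t} y"
    and c\<mu>: "continuous_on {0..t} \<mu>" and cw: "continuous_on {0..t} w"
    and y0: "\<And>u. u \<in> {0..t} \<Longrightarrow> y u \<noteq> 0" and k: "strict_mono k"
    and h: "h = - (c * (s - s'))" and g: "g = a' - a - of_real (c * s' * h) + of_real (h\<^sup>2) / 2"
    and Y: "\<And>u. Y u = of_real (w u) + of_real c * integral {0..u} \<mu>"
    and v: "\<And>u. v u = exp (of_real h * Y u + g * of_real u) / y u"
    and \<kappa>: "\<And>u. \<kappa> u = of_real c * (of_real s' - \<mu> u) * of_real h - of_real (h\<^sup>2) / 2"
  defines "\<tau> \<equiv> \<lambda>m i. grid t (k m) i"
  defines "dw \<equiv> \<lambda>m i. w (\<tau> m (Suc i)) - w (\<tau> m i)"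
  assumes e: "\<And>m i. x (\<tau> m (Suc i)) = x (\<tau> m i) * (1 + of_real c * (of_real s - \<mu> (\<tau> m i)) * of_real (dw m i) + a * of_real (t / real (k m))) + e m i"
    and e': "\<And>m i. y (\<tau> m (Suc i)) = y (\<tau> m i) * (1 + of_real c * (of_real s' - \<mu> (\<tau> m i)) * of_real (dw m i) + a' * of_real (t / real (k m))) + e' m i"
    and L1: "(\<lambda>m. \<Sum>i<k m. (norm (e m i))\<^sup>2) \<longlonglongrightarrow> 0"
    and L1': "(\<lambda>m. \<Sum>i<k m. (norm (e' m i))\<^sup>2) \<longlonglongrightarrow> 0"
    and L2: "(\<lambda>m. \<Sum>i<k m. v (\<tau> m i) * e m i) \<longlonglongrightarrow> 0"
    and L2': "(\<lambda>m. \<Sum>i<k m. v (\<tau> m i) * (x (\<tau> m i) / y (\<tau> m i)) * e' m i) \<longlonglongrightarrow> 0"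
    and L3: "(\<lambda>m. \<Sum>i<k m. v (\<tau> m i) * x (\<tau> m i) * \<kappa> (\<tau> m i) * of_real ((dw m i)\<^sup>2 - t / real (k m))) \<longlonglongrightarrow> 0"
    and L4: "(\<lambda>m. \<Sum>i<k m. (dw m i)\<^sup>2 - t / real (k m)) \<longlonglongrightarrow> 0"
  shows "v t * x t = v 0 * x 0"
proof -
  have i\<mu>: "\<mu> integrable_on {0..u}" if "u \<le> t" for u
    using continuous_on_subset[OF c\<mu>] that by (intro integrable_continuous_real) auto
  have cI: "continuous_on {0..t} (\<lambda>u. integral {0..u} \<mu>)"
    by (rule indefinite_integral_continuous_1[OF i\<mu>]) simp
  have cY: "continuous_on {0..t} Y" unfolding Y using cw cI by (intro continuous_intros)
  have cv: "continuous_on {0..t} v" unfolding v using cY cy y0 by (intro continuous_intros) auto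
  have c\<kappa>: "continuous_on {0..t} \<kappa>" unfolding \<kappa> using c\<mu> by (intro continuous_intros)
  define b' where "b' = (\<lambda>u. of_real c * (of_real s' - \<mu> u))"
  define b where "b = (\<lambda>u. of_real c * (of_real s - \<mu> u))"
  define \<nu> where "\<nu> = (\<lambda>u. a' - a - \<kappa> u)"
  have cb': "continuous_on {0..t} b'" unfolding b'_def using c\<mu> by (intro continuous_intros)
  have c\<nu>: "continuous_on {0..t} \<nu>" unfolding \<nu>_def using c\<kappa> by (intro continuous_intros)
  have cxy: "continuous_on {0..t} (\<lambda>u. x u / y u)" using cx cy y0 by (intro continuous_intros) auto
  have c1y: "continuous_on {0..t} (\<lambda>u. 1 / y u)" using cy y0 by (intro continuous_intros) auto
  obtain B1 where B1: "0 \<le> B1" "\<And>u. u \<in> {0..t} \<Longrightarrow> norm (b' u) \<le> B1" using continuous_on_bounded[OF cb'] by metis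
  obtain B2 where B2: "0 \<le> B2" "\<And>u. u \<in> {0..t} \<Longrightarrow> norm (\<nu> u) \<le> B2" using continuous_on_bounded[OF c\<nu>] by metis
  obtain B3 where B3: "0 \<le> B3" "\<And>u. u \<in> {0..t} \<Longrightarrow> norm (\<kappa> u) \<le> B3" using continuous_on_bounded[OF c\<kappa>] by metis
  obtain B4 where B4: "0 \<le> B4" "\<And>u. u \<in> {0..t} \<Longrightarrow> norm (x u) \<le> B4" using continuous_on_bounded[OF cx] by metis
  obtain B5 where B5: "0 \<le> B5" "\<And>u. u \<in> {0..t} \<Longrightarrow> norm (v u) \<le> B5" using continuous_on_bounded[OF cv] by metis
  obtain B6 where B6: "0 \<le> B6" "\<And>u. u \<in> {0..t} \<Longrightarrow> norm (x u / y u) \<le> B6" using continuous_on_bounded[OF cxy] by metis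
  obtain B7 where B7: "0 \<le> B7" "\<And>u. u \<in> {0..t} \<Longrightarrow> norm (1 / y u) \<le> B7" using continuous_on_bounded[OF c1y] by metis
  define K where "K = 1 + B1 + B2 + B3 + B4 + B5 + B6 + B7 + norm a' + \<bar>h\<bar>"
  have K1: "1 \<le> K" "norm a' \<le> K" "\<bar>h\<bar> \<le> K"
    using B1(1) B2(1) B3(1) B4(1) B5(1) B6(1) B7(1) norm_ge_zero[of a'] abs_ge_zero[of h] unfolding K_def by linarith+
  have KB: "B1 \<le> K" "B2 + 1 \<le> K" "B3 \<le> K" "B4 \<le> K" "B5 \<le> K" "B6 \<le> K" "B7 \<le> K"
    using B1(1) B2(1) B3(1) B4(1) B5(1) B6(1) B7(1) norm_ge_zero[of a'] abs_ge_zero[of h] unfolding K_def by linarith+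
  have Kb: "norm (b' u) \<le> K" "norm (\<nu> u) + 1 \<le> K" "norm (\<kappa> u) \<le> K" "norm (x u) \<le> K" "norm (v u) \<le> K"
    "norm (x u / y u) \<le> K" "norm (1 / y u) \<le> K" if "u \<in> {0..t}" for u
    using B1(2)[OF that] B2(2)[OF that] B3(2)[OF that] B4(2)[OF that] B5(2)[OF that] B6(2)[OF that] B7(2)[OF that] KB
    by linarith+
  define Fd where "Fd = v t * x t - v 0 * x 0"
  define S where "S = (\<lambda>m. (\<Sum>i<k m. v (\<tau> m i) * x (\<tau> m i) * \<kappa> (\<tau> m i) * of_real ((dw m i)\<^sup>2 - t / real (k m)))
     + (\<Sum>i<k m. v (\<tau> m i) * e m i) - (\<Sum>i<k m. v (\<tau> m i) * (x (\<tau> m i) / y (\<tau> m i)) * e' m i))"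
  define Q where "Q = (\<lambda>m. \<Sum>i<k m. (dw m i)\<^sup>2 - t / real (k m))"
  define E where "E = (\<lambda>m. \<Sum>i<k m. (norm (e m i))\<^sup>2)"
  define E' where "E' = (\<lambda>m. \<Sum>i<k m. (norm (e' m i))\<^sup>2)"
  have klim: "filterlim k sequentially sequentially" using k by (rule filterlim_subseq)
  have bound: "\<forall>\<^sub>F m in sequentially. norm (Fd - S m) \<le> 21 * K ^ 3 * (\<epsilon> * (Q m + 2 * t) +
       sqrt (4 * (Q m + 2 * t) + 2 * E' m) * sqrt (2 * E m + 2 * E' m))"
    if \<epsilon>: "0 < \<epsilon>" "\<epsilon> \<le> 1" for \<epsilon>
  proof -
    have K0: "0 < K" using K1 by simp
    \<comment> \<open>The increment and the cell length are both at most \<open>\<epsilon>1\<close>,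
      which gives the smallness condition of \<open>ratio_step\<close> with its factor
      \<open>20 * K ^ 3\<close>. The \<open>+ 1\<close> in \<open>\<epsilon>2\<close> covers
      \<open>h * c = 0\<close>.\<close>
    define \<epsilon>1 where "\<epsilon>1 = \<epsilon> / (40 * K ^ 3)"
    have \<epsilon>1: "0 < \<epsilon>1" using \<epsilon> K0 by (simp add: \<epsilon>1_def)
    define \<epsilon>2 where "\<epsilon>2 = \<epsilon> / (\<bar>h * c\<bar> + 1)"
    have \<epsilon>2: "0 < \<epsilon>2" using \<epsilon> by (simp add: \<epsilon>2_def add_nonneg_pos)
    have \<epsilon>2': "\<bar>h * c\<bar> * \<epsilon>2 \<le> \<epsilon>"
    proof -
      have "(\<bar>h * c\<bar> + 1) * \<epsilon>2 = \<epsilon>" unfolding \<epsilon>2_def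
        using abs_ge_zero[of "h * c"] by (simp del: abs_ge_zero add: field_simps)
      then show ?thesis using \<epsilon>2 by (simp add: distrib_right)
    qed
    have t0: "0 \<le> t" using t by simp
    have "(\<lambda>n. t * (1 / real n)) \<longlonglongrightarrow> 0" by (rule tendsto_mult_right_zero[OF lim_1_over_n])
    then have "\<forall>\<^sub>F n in sequentially. t * (1 / real n) < min 1 \<epsilon>1" using \<epsilon>1 by (intro order_tendstoD(2)) auto
    note ev = eventually_compose_filterlim[OF this klim]
      eventually_compose_filterlim[OF uniform_grid_continuity[OF t0 cw \<epsilon>1] klim]
      eventually_compose_filterlim[OF uniform_grid_continuity[OF t0 cv \<epsilon>(1)] klim]
      eventually_compose_filterlim[OF uniform_grid_continuity[OF t0 c\<mu> \<epsilon>2] klim]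
      eventually_compose_filterlim[OF eventually_gt_at_top[of 0] klim]
    show ?thesis using ev
    proof eventually_elim
      case (elim m)
      define n where "n = k m"
      define d where "d = t / real n"
      have n: "0 < n" using elim(5) by (simp add: n_def)
      have d: "0 \<le> d" "d \<le> 1" "d \<le> \<epsilon>1" using elim(1) t0 by (auto simp: d_def n_def)
      have nd: "real n * d = t" using n by (simp add: d_def)
      define p where "p = (\<lambda>i. (dw m i)\<^sup>2 + d)"
      define q where "q = (\<lambda>i. \<bar>dw m i\<bar> + d)"
      define A where "A = (\<lambda>i. v (\<tau> m i) * x (\<tau> m i) * \<kappa> (\<tau> m i) * of_real ((dw m i)\<^sup>2 - d)
        + v (\<tau> m i) * e m i - v (\<tau> m i) * (x (\<tau> m i) / y (\<tau> m i)) * e' m i)"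
      have step: "norm (v (\<tau> m (Suc i)) * x (\<tau> m (Suc i)) - v (\<tau> m i) * x (\<tau> m i) - A i)
          \<le> 21 * K ^ 3 * (\<epsilon> * p i + (q i + norm (e' m i)) * (norm (e m i) + norm (e' m i)))"
        if i: "i < n" for i
      proof -
        note gb = grid_bounds[OF t0 i]
        have \<tau>0: "\<tau> m i \<in> {0..t}" and \<tau>1: "\<tau> m (Suc i) \<in> {0..t}" and \<tau>d: "\<tau> m (Suc i) - \<tau> m i = d"
          using gb unfolding \<tau>_def n_def[symmetric] d_def by auto
        have \<tau>le: "\<tau> m i \<le> \<tau> m (Suc i)" using \<tau>d d by linarith
        \<comment> \<open>What remains of the increment of \<open>h Y + g t\<close> after removing
          its Wiener part; it is close to \<open>\<nu> * d\<close>.\<close>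
        define u where "u = of_real (h * c) * integral {\<tau> m i..\<tau> m (Suc i)} \<mu> + g * of_real d"
        define z where "z = of_real (h * dw m i) + u"
        have IY: "Y (\<tau> m (Suc i)) - Y (\<tau> m i) = of_real (dw m i) + of_real c * integral {\<tau> m i..\<tau> m (Suc i)} \<mu>"
        proof -
          have "integral {0..\<tau> m i} \<mu> + integral {\<tau> m i..\<tau> m (Suc i)} \<mu> = integral {0..\<tau> m (Suc i)} \<mu>"
            using \<tau>0 \<tau>1 \<tau>le i\<mu> by (intro Henstock_Kurzweil_Integration.integral_combine) auto
          then show ?thesis unfolding Y dw_def by (simp add: algebra_simps flip: distrib_left)
        qed
        have zY: "of_real h * Y (\<tau> m (Suc i)) + g * of_real (\<tau> m (Suc i)) = (of_real h * Y (\<tau> m i) + g * of_real (\<tau> m i)) + z"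
        proof -
          have "of_real h * Y (\<tau> m (Suc i)) + g * of_real (\<tau> m (Suc i)) - (of_real h * Y (\<tau> m i) + g * of_real (\<tau> m i))
            = of_real h * (Y (\<tau> m (Suc i)) - Y (\<tau> m i)) + g * of_real (\<tau> m (Suc i) - \<tau> m i)"
            by (simp add: algebra_simps)
          also have "\<dots> = z" unfolding IY \<tau>d z_def u_def by (simp add: algebra_simps)
          finally show ?thesis by (simp add: algebra_simps)
        qed
        have vz: "v (\<tau> m i) = v (\<tau> m (Suc i)) * exp (- z) * y (\<tau> m (Suc i)) / y (\<tau> m i)"
          unfolding v zY using y0[OF \<tau>1] by (simp add: exp_add exp_minus)
        have un: "norm (u - \<nu> (\<tau> m i) * of_real d) \<le> \<epsilon> * d"
        proof -
          \<comment> \<open>This identity dictates the value of \<open>g\<close>: the drift of the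
            exponent has to equal the compensated difference of the drifts.\<close>
          have "\<nu> (\<tau> m i) = of_real (h * c) * \<mu> (\<tau> m i) + g"
            unfolding \<nu>_def \<kappa> g by (simp add: algebra_simps)
          then have "u - \<nu> (\<tau> m i) * of_real d = of_real (h * c) * (integral {\<tau> m i..\<tau> m (Suc i)} \<mu> - \<mu> (\<tau> m i) * of_real (\<tau> m (Suc i) - \<tau> m i))"
            unfolding u_def \<tau>d by (simp add: algebra_simps)
          then have "norm (u - \<nu> (\<tau> m i) * of_real d) = \<bar>h * c\<bar> * norm (integral {\<tau> m i..\<tau> m (Suc i)} \<mu> - \<mu> (\<tau> m i) * of_real (\<tau> m (Suc i) - \<tau> m i))"
            by (simp only: norm_mult norm_of_real)
          also have "\<dots> \<le> \<bar>h * c\<bar> * (\<epsilon>2 * (\<tau> m (Suc i) - \<tau> m i))"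
          proof (intro mult_left_mono integral_left_endpoint_error \<tau>le)
            show "continuous_on {\<tau> m i..\<tau> m (Suc i)} \<mu>"
              using \<tau>0 \<tau>1 by (intro continuous_on_subset[OF c\<mu>]) auto
            show "norm (\<mu> r - \<mu> (\<tau> m i)) \<le> \<epsilon>2" if "r \<in> {\<tau> m i..\<tau> m (Suc i)}" for r
            proof -
              have "r \<in> {0..t}" "\<bar>r - \<tau> m i\<bar> \<le> t / real (k m)"
                using that \<tau>0 \<tau>1 \<tau>d by (auto simp: d_def n_def)
              then show ?thesis using elim(4) \<tau>0 by (force simp: dist_norm)
            qed
          qed auto
          also have "\<dots> \<le> \<epsilon> * d"
            unfolding \<tau>d using mult_right_mono[OF \<epsilon>2' d(1)] by (simp add: mult.assoc)
          finally show ?thesis .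
        qed
        have close: "\<bar>\<tau> m (Suc i) - \<tau> m i\<bar> \<le> t / real (k m)" using \<tau>d d by (simp add: d_def n_def)
        have dwe: "\<bar>dw m i\<bar> \<le> \<epsilon>1"
          using elim(2) \<tau>0 \<tau>1 close unfolding dw_def by (force simp: dist_real_def)
        have dv: "norm (v (\<tau> m (Suc i)) - v (\<tau> m i)) \<le> \<epsilon>"
          using elim(3) \<tau>0 \<tau>1 close by (force simp: dist_norm)
        have small: "20 * K ^ 3 * (\<bar>dw m i\<bar> + d) \<le> \<epsilon>"
        proof -
          have "20 * K ^ 3 * (\<bar>dw m i\<bar> + d) \<le> 20 * K ^ 3 * (\<epsilon>1 + \<epsilon>1)"
            using dwe d K0 by (intro mult_left_mono add_mono) auto
          also have "\<dots> = \<epsilon>" using K0 by (simp add: \<epsilon>1_def)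
          finally show ?thesis .
        qed
        have bb: "b (\<tau> m i) = b' (\<tau> m i) - of_real h" unfolding b_def b'_def h by (simp add: algebra_simps)
        have kk: "\<kappa> (\<tau> m i) = b' (\<tau> m i) * of_real h - of_real (h\<^sup>2) / 2" unfolding \<kappa> b'_def ..
        have nn: "\<nu> (\<tau> m i) = a' - a - \<kappa> (\<tau> m i)" by (simp add: \<nu>_def)
        have ex: "x (\<tau> m (Suc i)) = x (\<tau> m i) * (1 + b (\<tau> m i) * of_real (dw m i) + a * of_real d) + e m i"
          using e[of m i] by (simp add: b_def d_def n_def)
        have ey: "y (\<tau> m (Suc i)) = y (\<tau> m i) * (1 + b' (\<tau> m i) * of_real (dw m i) + a' * of_real d) + e' m i"
          using e'[of m i] by (simp add: b'_def d_def n_def)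
        show ?thesis unfolding A_def p_def q_def add_diff_eq[symmetric]
          using ratio_step[OF ex ey y0[OF \<tau>0] vz z_def bb kk nn un less_imp_le[OF \<epsilon>(1)] \<epsilon>(2) d(1,2) K1(1) Kb(1)[OF \<tau>0] K1(2,3)
              Kb(2)[OF \<tau>0] Kb(3)[OF \<tau>0] Kb(4)[OF \<tau>0] Kb(5)[OF \<tau>0] Kb(5)[OF \<tau>1] Kb(6)[OF \<tau>0] Kb(7)[OF \<tau>0] small dv]
          by (simp only: add_diff_eq)
      qed
      have tel: "(\<Sum>i<n. v (\<tau> m (Suc i)) * x (\<tau> m (Suc i)) - v (\<tau> m i) * x (\<tau> m i)) = Fd"
      proof -
        have "\<tau> m n = t" "\<tau> m 0 = 0" using n by (auto simp: \<tau>_def n_def)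
        then show ?thesis
          using sum_lessThan_telescope[of "\<lambda>i. v (\<tau> m i) * x (\<tau> m i)" n] by (simp add: Fd_def)
      qed
      have SA: "S m = (\<Sum>i<n. A i)"
        unfolding S_def A_def n_def[symmetric] d_def by (simp add: sum.distrib sum_subtractf)
      have sp: "(\<Sum>i<n. p i) = Q m + 2 * t"
      proof -
        have "(\<Sum>i<n. p i) = (\<Sum>i<n. ((dw m i)\<^sup>2 - d) + 2 * d)" by (simp add: p_def add.commute)
        also have "\<dots> = Q m + 2 * (real n * d)" unfolding sum.distrib Q_def n_def[symmetric] d_def[symmetric] by simp
        finally show ?thesis unfolding nd .
      qed
      have cs: "(\<Sum>i<n. (q i + norm (e' m i)) * (norm (e m i) + norm (e' m i))) \<le> sqrt (4 * (Q m + 2 * t) + 2 * E' m) * sqrt (2 * E m + 2 * E' m)"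
      proof -
        have two: "(\<alpha> + \<beta>)\<^sup>2 \<le> 2 * \<alpha>\<^sup>2 + 2 * \<beta>\<^sup>2" for \<alpha> \<beta> :: real
          using sum_squares_bound[of \<alpha> \<beta>] by (simp add: power2_sum)
        have "(\<Sum>i<n. (q i + norm (e' m i)) * (norm (e m i) + norm (e' m i))) \<le> L2_set (\<lambda>i. q i + norm (e' m i)) {..<n} * L2_set (\<lambda>i. norm (e m i) + norm (e' m i)) {..<n}"
          using L2_set_mult_ineq[of "\<lambda>i. q i + norm (e' m i)" "\<lambda>i. norm (e m i) + norm (e' m i)" "{..<n}"] d(1)
          by (simp add: q_def abs_of_nonneg)
        also have "\<dots> \<le> sqrt (4 * (Q m + 2 * t) + 2 * E' m) * sqrt (2 * E m + 2 * E' m)"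
        proof (intro mult_mono)
          have "(q i + norm (e' m i))\<^sup>2 \<le> 4 * p i + 2 * (norm (e' m i))\<^sup>2" for i
          proof -
            have "(q i)\<^sup>2 \<le> 2 * (dw m i)\<^sup>2 + 2 * d\<^sup>2" using two[of "\<bar>dw m i\<bar>" d] by (simp add: q_def)
            moreover have "d\<^sup>2 \<le> d" using d by (simp add: power2_eq_square mult_left_le)
            ultimately have "(q i)\<^sup>2 \<le> 2 * p i" by (simp add: p_def)
            then show ?thesis using two[of "q i" "norm (e' m i)"] by linarith
          qed
          then have "(\<Sum>i<n. (q i + norm (e' m i))\<^sup>2) \<le> (\<Sum>i<n. 4 * p i + 2 * (norm (e' m i))\<^sup>2)" by (intro sum_mono)
          also have "\<dots> = 4 * (Q m + 2 * t) + 2 * E' m"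
            unfolding sp[symmetric] by (simp add: sum.distrib sum_distrib_left E'_def n_def)
          finally show "L2_set (\<lambda>i. q i + norm (e' m i)) {..<n} \<le> sqrt (4 * (Q m + 2 * t) + 2 * E' m)"
            unfolding L2_set_def by (rule real_sqrt_le_mono)
          have "(\<Sum>i<n. (norm (e m i) + norm (e' m i))\<^sup>2) \<le> (\<Sum>i<n. 2 * (norm (e m i))\<^sup>2 + 2 * (norm (e' m i))\<^sup>2)"
            by (intro sum_mono two)
          also have "\<dots> = 2 * E m + 2 * E' m"
            by (simp add: sum.distrib sum_distrib_left E_def E'_def n_def)
          finally show "L2_set (\<lambda>i. norm (e m i) + norm (e' m i)) {..<n} \<le> sqrt (2 * E m + 2 * E' m)"
            unfolding L2_set_def by (rule real_sqrt_le_mono)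
          have "0 \<le> (\<Sum>i<n. p i)" using d by (intro sum_nonneg) (simp add: p_def)
          then show "0 \<le> sqrt (4 * (Q m + 2 * t) + 2 * E' m)" unfolding sp E'_def by (simp add: sum_nonneg)
        qed (rule L2_set_nonneg)
        finally show ?thesis .
      qed
      have "norm (Fd - S m) = norm (\<Sum>i<n. v (\<tau> m (Suc i)) * x (\<tau> m (Suc i)) - v (\<tau> m i) * x (\<tau> m i) - A i)"
        unfolding sum_subtractf[of _ A] tel SA ..
      also have "\<dots> \<le> (\<Sum>i<n. 21 * K ^ 3 * (\<epsilon> * p i + (q i + norm (e' m i)) * (norm (e m i) + norm (e' m i))))"
        by (rule sum_norm_le) (use step in auto)
      also have "\<dots> = 21 * K ^ 3 * (\<epsilon> * (Q m + 2 * t) + (\<Sum>i<n. (q i + norm (e' m i)) * (norm (e m i) + norm (e' m i))))"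
        unfolding sum_distrib_left[symmetric] sum.distrib sp ..
      also have "\<dots> \<le> 21 * K ^ 3 * (\<epsilon> * (Q m + 2 * t) + sqrt (4 * (Q m + 2 * t) + 2 * E' m) * sqrt (2 * E m + 2 * E' m))"
        using cs K0 by (intro mult_left_mono add_left_mono) auto
      finally show ?case .
    qed
  qed
  have Q: "Q \<longlonglongrightarrow> 0" using L4 unfolding Q_def .
  have E: "E \<longlonglongrightarrow> 0" and E': "E' \<longlonglongrightarrow> 0" using L1 L1' unfolding E_def E'_def .
  have S: "S \<longlonglongrightarrow> 0" unfolding S_def using tendsto_diff[OF tendsto_add[OF L3 L2] L2'] by simp
  have le: "norm Fd \<le> 42 * K ^ 3 * t * \<epsilon>" if \<epsilon>: "0 < \<epsilon>" "\<epsilon> \<le> 1" for \<epsilon>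
  proof (rule tendsto_le[OF _ _ _ bound[OF \<epsilon>]])
    show "(\<lambda>m. norm (Fd - S m)) \<longlonglongrightarrow> norm Fd"
      using tendsto_norm[OF tendsto_diff[OF tendsto_const S], of Fd] by simp
    show "(\<lambda>m. 21 * K ^ 3 * (\<epsilon> * (Q m + 2 * t) + sqrt (4 * (Q m + 2 * t) + 2 * E' m) * sqrt (2 * E m + 2 * E' m)))
       \<longlonglongrightarrow> 42 * K ^ 3 * t * \<epsilon>"
      by (rule tendsto_eq_intros Q E E' | simp)+
  qed simp
  have "norm Fd \<le> 0"
  proof (rule ccontr)
    assume "\<not> norm Fd \<le> 0"
    then have pos: "0 < norm Fd" by simp
    define G where "G = 42 * K ^ 3 * t"
    have G: "0 < G" using K1 t by (simp add: G_def)
    define \<epsilon> where "\<epsilon> = min 1 (norm Fd / (2 * G))"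
    have "0 < \<epsilon>" "\<epsilon> \<le> 1" using pos G by (auto simp: \<epsilon>_def)
    from le[OF this] have "norm Fd \<le> G * \<epsilon>" by (simp add: G_def)
    also have "\<dots> \<le> G * (norm Fd / (2 * G))" using G by (intro mult_left_mono) (auto simp: \<epsilon>_def)
    also have "\<dots> = norm Fd / 2" using G by simp
    finally show False using pos by simp
  qed
  then show ?thesis by (simp add: Fd_def)
qed

section \<open>Linear stochastic differential equations\<close>

text \<open>Norms are taken cell by cell, which is stronger than convergence of Riemann sums: the
  errors may afterwards be squared or carry bounded weights. By uniform continuity each is at most
  \<open>\<epsilon> * (t / n)\<close>.\<close>

lemma left_endpoint_errors_tendsto_0:
  fixes f :: "real \<Rightarrow> complex"
  assumes t: "0 \<le> t" and f: "continuous_on {0..t} f"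
  shows "(\<lambda>n. \<Sum>i<n. norm (integral {grid t n i..grid t n (Suc i)} f
     - f (grid t n i) * of_real (t / real n))) \<longlonglongrightarrow> 0"
proof (rule LIMSEQ_I)
  fix e :: real assume e: "0 < e"
  define \<epsilon> where "\<epsilon> = e / (t + 1)"
  have \<epsilon>: "0 < \<epsilon>" using e t by (simp add: \<epsilon>_def)
  have \<epsilon>t: "\<epsilon> * t < e"
  proof -
    have "\<epsilon> * (t + 1) = e" using t by (simp add: \<epsilon>_def)
    then show ?thesis using \<epsilon> by (simp add: distrib_left)
  qed
  obtain n0 where n0: "\<And>n u v. n \<ge> n0 \<Longrightarrow> u \<in> {0..t} \<Longrightarrow> v \<in> {0..t} \<Longrightarrow> \<bar>u - v\<bar> \<le> t / real n \<Longrightarrow> dist (f u) (f v) < \<epsilon>"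
    using uniform_grid_continuity[OF t f \<epsilon>] unfolding eventually_sequentially by metis
  have "norm ((\<Sum>i<n. norm (integral {grid t n i..grid t n (Suc i)} f
     - f (grid t n i) * of_real (t / real n))) - 0) < e" if n: "n \<ge> n0" for n
  proof -
    have "(\<Sum>i<n. norm (integral {grid t n i..grid t n (Suc i)} f
       - f (grid t n i) * of_real (t / real n))) \<le> (\<Sum>i<n. \<epsilon> * (t / real n))"
    proof (rule sum_mono)
      fix i assume "i \<in> {..<n}"
      then have i: "i < n" by simp
      note gb = grid_bounds[OF t i]
      show "norm (integral {grid t n i..grid t n (Suc i)} f - f (grid t n i) * of_real (t / real n)) \<le> \<epsilon> * (t / real n)"
        unfolding gb(4)[symmetric]
      proof (rule integral_left_endpoint_error[OF gb(2)])
        show "continuous_on {grid t n i..grid t n (Suc i)} f"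
          using gb by (intro continuous_on_subset[OF f]) auto
        show "norm (f u - f (grid t n i)) \<le> \<epsilon>" if "u \<in> {grid t n i..grid t n (Suc i)}" for u
          using n0[OF n, of u "grid t n i"] that gb by (auto simp: dist_norm)
      qed
    qed
    also have "\<dots> \<le> \<epsilon> * t" using t \<epsilon> by (cases "n = 0") auto
    finally show ?thesis using \<epsilon>t by (simp add: abs_of_nonneg sum_nonneg)
  qed
  then show "\<exists>no. \<forall>n\<ge>no. norm ((\<Sum>i<n. norm (integral {grid t n i..grid t n (Suc i)} f
     - f (grid t n i) * of_real (t / real n))) - 0) < e" by blast
qed

lemma integral_grid_telescope:
  fixes f :: "real \<Rightarrow> complex"
  assumes t: "0 \<le> t" and f: "continuous_on {0..t} f" and n: "0 < n"
  shows "(\<Sum>i<n. integral {grid t n i..grid t n (Suc i)} f) = integral {0..t} f"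
proof -
  have "integral {grid t n i..grid t n (Suc i)} f = integral {0..grid t n (Suc i)} f - integral {0..grid t n i} f"
    if i: "i < n" for i
  proof -
    note gb = grid_bounds[OF t i]
    have "f integrable_on {0..grid t n (Suc i)}"
      using gb by (intro integrable_continuous_real continuous_on_subset[OF f]) auto
    then have "integral {0..grid t n i} f + integral {grid t n i..grid t n (Suc i)} f = integral {0..grid t n (Suc i)} f"
      using gb by (intro Henstock_Kurzweil_Integration.integral_combine) auto
    then show ?thesis by (simp add: algebra_simps)
  qed
  then have "(\<Sum>i<n. integral {grid t n i..grid t n (Suc i)} f) =
     (\<Sum>i<n. integral {0..grid t n (Suc i)} f - integral {0..grid t n i} f)" by simp
  also have "\<dots> = integral {0..t} f"
    using sum_lessThan_telescope[of "\<lambda>i. integral {0..grid t n i} f" n] n by simp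
  finally show ?thesis .
qed

section \<open>Scalar equations with a common random coefficient\<close>

context wiener
begin

definition adapted :: "(real \<Rightarrow> 'a \<Rightarrow> 'b::topological_space) \<Rightarrow> bool" where
  "adapted X \<longleftrightarrow> (\<forall>t\<ge>0. X t \<in> borel_measurable (F t))"

definition continuous_paths :: "(real \<Rightarrow> 'a \<Rightarrow> 'b::topological_space) \<Rightarrow> bool" where
  "continuous_paths X \<longleftrightarrow> (\<forall>\<omega>\<in>space M. continuous_on {0..} (\<lambda>t. X t \<omega>))"

lemma continuous_paths_on: "continuous_paths X \<Longrightarrow> \<omega> \<in> space M \<Longrightarrow> continuous_on {0..t} (\<lambda>t. X t \<omega>)"
  unfolding continuous_paths_def by (rule continuous_on_subset[of "{0..}"]) auto

text \<open>Left-point sums use only values at times up to \<open>t\<close>, and measurability with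
  respect to \<open>F t\<close> passes to their limit.\<close>

lemma adapted_integral:
  fixes f :: "real \<Rightarrow> 'a \<Rightarrow> complex"
  assumes "adapted f" "continuous_paths f" "0 \<le> t"
  shows "(\<lambda>\<omega>. integral {0..t} (\<lambda>u. f u \<omega>)) \<in> borel_measurable (F t)"
proof (rule borel_measurable_LIMSEQ_metric)
  fix n
  show "(\<lambda>\<omega>. \<Sum>i<n. f (grid t n i) \<omega> * of_real (t / real n)) \<in> borel_measurable (F t)"
  proof (intro borel_measurable_sum borel_measurable_times borel_measurable_const)
    fix i assume "i \<in> {..<n}"
    then have i: "i < n" by simp
    have "grid t n i \<le> t" using grid_bounds[OF assms(3) i] by linarith
    then show "f (grid t n i) \<in> borel_measurable (F t)"
      using measurable_F_mono[of "f (grid t n i)" "grid t n i" borel t] assms(1,3) by (auto simp: adapted_def)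
  qed
next
  fix \<omega> assume "\<omega> \<in> space (F t)"
  then have \<omega>: "\<omega> \<in> space M" using subalgebra_F by (auto simp: subalgebra_def)
  let ?f = "\<lambda>u. f u \<omega>"
  have c: "continuous_on {0..t} ?f" using continuous_paths_on assms(2) \<omega> by blast
  have "(\<lambda>n. (\<Sum>i<n. ?f (grid t n i) * of_real (t / real n)) - integral {0..t} ?f) \<longlonglongrightarrow> 0"
  proof (rule Lim_null_comparison[OF _ left_endpoint_errors_tendsto_0[OF assms(3) c]])
    show "\<forall>\<^sub>F n in sequentially. norm ((\<Sum>i<n. ?f (grid t n i) * of_real (t / real n)) - integral {0..t} ?f)
       \<le> (\<Sum>i<n. norm (integral {grid t n i..grid t n (Suc i)} ?f - ?f (grid t n i) * of_real (t / real n)))"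
      using eventually_gt_at_top[of 0]
    proof eventually_elim
      case (elim n)
      have "(\<Sum>i<n. ?f (grid t n i) * of_real (t / real n)) - integral {0..t} ?f =
        - (\<Sum>i<n. integral {grid t n i..grid t n (Suc i)} ?f - ?f (grid t n i) * of_real (t / real n))"
        unfolding integral_grid_telescope[OF assms(3) c elim, symmetric] sum_subtractf by simp
      then show ?case by (simp only: norm_minus_cancel norm_sum)
    qed
  qed
  then show "(\<lambda>n. \<Sum>i<n. ?f (grid t n i) * of_real (t / real n)) \<longlonglongrightarrow> integral {0..t} ?f"
    by (rule LIM_zero_cancel)
qed

text \<open>As in \<open>solves_quantum_filter\<close>, the equation is an identity at each fixed
  time, with its own integral variable and its own exceptional null set.\<close>

definition lin_sol :: "real \<Rightarrow> (real \<Rightarrow> 'a \<Rightarrow> complex) \<Rightarrow> complex \<Rightarrow> real \<Rightarrow> (real \<Rightarrow> 'a \<Rightarrow> complex) \<Rightarrow> bool" where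
  "lin_sol c \<mu> a s X \<longleftrightarrow> continuous_paths X \<and> adapted X \<and>
     (\<forall>t\<ge>0. \<exists>I. is_ito_integral M (\<lambda>u \<omega>. of_real c * (of_real s - \<mu> u \<omega>) * X u \<omega>) W t I \<and>
        (AE \<omega> in M. X t \<omega> = X 0 \<omega> + integral {0..t} (\<lambda>u. a * X u \<omega>) + I \<omega>))"

definition lin_sol_defect where
  "lin_sol_defect c \<mu> a s X t n i \<omega> = X (grid t n (Suc i)) \<omega> - X (grid t n i) \<omega> *
     (1 + of_real c * (of_real s - \<mu> (grid t n i) \<omega>) * of_real (W (grid t n (Suc i)) \<omega> - W (grid t n i) \<omega>)
       + a * of_real (t / real n))"

text \<open>The residual of an Euler step is the Ito error plus the quadrature error of the drift,
  and the norms of the latter have sum tending to \<open>0\<close>. The set \<open>G\<close> deals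
  with countably many grid times at once and is fixed before the weights \<open>v\<close> are
  chosen.\<close>

lemma lin_sol_defect_null:
  assumes t: "0 < t" and C: "0 \<le> C" and \<mu>: "adapted \<mu>" "continuous_paths \<mu>"
    and X: "lin_sol c \<mu> a s X"
  shows "\<exists>G. (AE \<omega> in M. \<omega> \<in> G) \<and> G \<subseteq> space M \<and> (\<forall>v B. adapted v \<longrightarrow> (\<forall>u \<omega>. norm (v u \<omega>) \<le> B) \<longrightarrow>
     ip_null M {\<omega>\<in>G. \<forall>u\<in>{0..t}. norm (of_real c * (of_real s - \<mu> u \<omega>) * X u \<omega>) \<le> C} (\<lambda>n \<omega>.
       (\<Sum>i<n. (norm (lin_sol_defect c \<mu> a s X t n i \<omega>))\<^sup>2,
        \<Sum>i<n. v (grid t n i) \<omega> * lin_sol_defect c \<mu> a s X t n i \<omega>)))"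
proof -
  have Xc: "continuous_paths X" and Xa: "adapted X" using X by (auto simp: lin_sol_def)
  define \<Psi> where "\<Psi> = (\<lambda>u \<omega>. of_real c * (of_real s - \<mu> u \<omega>) * X u \<omega>)"
  have \<Psi>F: "\<Psi> u \<in> borel_measurable (F u)" if "0 \<le> u" for u
  proof -
    have "\<mu> u \<in> borel_measurable (F u)" "X u \<in> borel_measurable (F u)" using \<mu> Xa that by (auto simp: adapted_def)
    then show ?thesis unfolding \<Psi>_def by measurable
  qed
  have \<Psi>c: "continuous_on {0..} (\<lambda>u. \<Psi> u \<omega>)" if "\<omega> \<in> space M" for \<omega>
    using \<mu> Xc that unfolding \<Psi>_def continuous_paths_def by (intro continuous_intros) auto
  have "\<forall>u. \<exists>I. 0 \<le> u \<longrightarrow> is_ito_integral M \<Psi> W u I \<and> (AE \<omega> in M. X u \<omega> = X 0 \<omega> + integral {0..u} (\<lambda>u. a * X u \<omega>) + I \<omega>)"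
    using X unfolding lin_sol_def \<Psi>_def by blast
  from choice[OF this] obtain I where II: "\<forall>u. 0 \<le> u \<longrightarrow> is_ito_integral M \<Psi> W u (I u) \<and> (AE \<omega> in M. X u \<omega> = X 0 \<omega> + integral {0..u} (\<lambda>u. a * X u \<omega>) + I u \<omega>)" ..
  have I: "is_ito_integral M \<Psi> W u (I u)" if "0 \<le> u" for u using II that by simp
  have IX: "AE \<omega> in M. X u \<omega> = X 0 \<omega> + integral {0..u} (\<lambda>u. a * X u \<omega>) + I u \<omega>" if "0 \<le> u" for u using II that by simp
  define G where "G = {\<omega>\<in>space M. \<forall>n i::nat. X (grid t n i) \<omega> = X 0 \<omega> + integral {0..grid t n i} (\<lambda>u. a * X u \<omega>) + I (grid t n i) \<omega>}"
  have "AE \<omega> in M. \<forall>n i::nat. X (grid t n i) \<omega> = X 0 \<omega> + integral {0..grid t n i} (\<lambda>u. a * X u \<omega>) + I (grid t n i) \<omega>"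
    unfolding AE_all_countable using t by (intro allI IX) simp
  then have "AE \<omega> in M. \<omega> \<in> G" by (auto simp: G_def)
  moreover have "ip_null M {\<omega>\<in>G. \<forall>u\<in>{0..t}. norm (\<Psi> u \<omega>) \<le> C} (\<lambda>n \<omega>.
       (\<Sum>i<n. (norm (lin_sol_defect c \<mu> a s X t n i \<omega>))\<^sup>2,
        \<Sum>i<n. v (grid t n i) \<omega> * lin_sol_defect c \<mu> a s X t n i \<omega>))"
    if v: "adapted v" and vb: "\<And>u \<omega>. norm (v u \<omega>) \<le> B" for v B
  proof (rule ip_null_imp)
    have vF: "v u \<in> borel_measurable (F u)" if "0 \<le> u" for u using v that by (simp add: adapted_def)
    show "ip_null M {\<omega>. \<forall>u\<in>{0..t}. norm (\<Psi> u \<omega>) \<le> C} (\<lambda>n \<omega>.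
     (\<Sum>i<n. (norm (ito_error \<Psi> W I t n i \<omega>))\<^sup>2,
      \<Sum>i<n. v (grid t n i) \<omega> * ito_error \<Psi> W I t n i \<omega>))"
      by (rule ito_error_null[OF t \<Psi>F I C \<Psi>c vF vb])
    show "{\<omega> \<in> G. \<forall>u\<in>{0..t}. norm (\<Psi> u \<omega>) \<le> C} \<subseteq> {\<omega>. \<forall>u\<in>{0..t}. norm (\<Psi> u \<omega>) \<le> C}" by auto
    fix \<omega> and r :: "nat \<Rightarrow> nat" assume "\<omega> \<in> {\<omega> \<in> G. \<forall>u\<in>{0..t}. norm (\<Psi> u \<omega>) \<le> C}" and r: "strict_mono r"
    then have \<omega>: "\<omega> \<in> space M" and eqG: "\<And>n i::nat. X (grid t n i) \<omega> = X 0 \<omega> + integral {0..grid t n i} (\<lambda>u. a * X u \<omega>) + I (grid t n i) \<omega>"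
      by (auto simp: G_def)
    let ?ie = "\<lambda>m i. ito_error \<Psi> W I t (r m) i \<omega>" and ?d = "\<lambda>m i. lin_sol_defect c \<mu> a s X t (r m) i \<omega>"
    let ?v = "\<lambda>m i. v (grid t (r m) i) \<omega>"
    let ?f = "\<lambda>u. a * X u \<omega>"
    define dr where "dr = (\<lambda>n i. integral {grid t n i..grid t n (Suc i)} ?f - ?f (grid t n i) * of_real (t / real n))"
    assume lim: "(\<lambda>m. (\<Sum>i<r m. (norm (?ie m i))\<^sup>2, \<Sum>i<r m. ?v m i * ?ie m i)) \<longlonglongrightarrow> 0"
    have t0: "0 \<le> t" using t by simp
    have fc: "continuous_on {0..t} ?f"
      using continuous_paths_on[OF Xc \<omega>] by (intro continuous_intros)
    have drl: "(\<lambda>m. \<Sum>i<r m. norm (dr (r m) i)) \<longlonglongrightarrow> 0"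
      using LIMSEQ_subseq_LIMSEQ[OF left_endpoint_errors_tendsto_0[OF t0 fc] r] unfolding dr_def comp_def .
    have dec: "?d m i = ?ie m i + dr (r m) i" if i: "i < r m" for m i
    proof -
      note gb = grid_bounds[OF t0 i]
      have "?f integrable_on {0..grid t (r m) (Suc i)}"
        using gb by (intro integrable_continuous_real continuous_on_subset[OF fc]) auto
      then have "integral {0..grid t (r m) i} ?f + integral {grid t (r m) i..grid t (r m) (Suc i)} ?f = integral {0..grid t (r m) (Suc i)} ?f"
        using gb by (intro Henstock_Kurzweil_Integration.integral_combine) auto
      then show ?thesis
        unfolding lin_sol_defect_def ito_error_def dr_def \<Psi>_def
        using eqG[of "Suc i" "r m"] eqG[of i "r m"] by (simp add: algebra_simps)
    qed
    have l1: "(\<lambda>m. \<Sum>i<r m. (norm (?ie m i))\<^sup>2) \<longlonglongrightarrow> 0"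
      using tendsto_fst[OF lim] by (simp add: zero_prod_def)
    have l2: "(\<lambda>m. \<Sum>i<r m. ?v m i * ?ie m i) \<longlonglongrightarrow> 0"
      using tendsto_snd[OF lim] by (simp add: zero_prod_def)
    have sq: "(\<Sum>i<r m. (norm (?d m i))\<^sup>2) \<le> 2 * (\<Sum>i<r m. (norm (?ie m i))\<^sup>2) + 2 * (\<Sum>i<r m. norm (dr (r m) i))\<^sup>2" for m
    proof -
      have "(\<Sum>i<r m. (norm (?d m i))\<^sup>2) \<le> (\<Sum>i<r m. 2 * (norm (?ie m i))\<^sup>2 + 2 * (norm (dr (r m) i))\<^sup>2)"
      proof (rule sum_mono)
        fix i assume "i \<in> {..<r m}"
        then have "norm (?d m i) \<le> norm (?ie m i) + norm (dr (r m) i)" using dec norm_triangle_ineq by simp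
        then have "(norm (?d m i))\<^sup>2 \<le> (norm (?ie m i) + norm (dr (r m) i))\<^sup>2" by (intro power_mono) auto
        then show "(norm (?d m i))\<^sup>2 \<le> 2 * (norm (?ie m i))\<^sup>2 + 2 * (norm (dr (r m) i))\<^sup>2"
          using sum_squares_bound[of "norm (?ie m i)" "norm (dr (r m) i)"] by (simp add: power2_sum)
      qed
      also have "\<dots> = 2 * (\<Sum>i<r m. (norm (?ie m i))\<^sup>2) + 2 * (\<Sum>i<r m. (norm (dr (r m) i))\<^sup>2)"
        by (simp add: sum.distrib sum_distrib_left)
      also have "(\<Sum>i<r m. (norm (dr (r m) i))\<^sup>2) \<le> (\<Sum>i<r m. norm (dr (r m) i))\<^sup>2"
        by (rule sum_squares_le_square_sum) auto
      finally show ?thesis by simp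
    qed
    have s1: "(\<lambda>m. \<Sum>i<r m. (norm (?d m i))\<^sup>2) \<longlonglongrightarrow> 0"
    proof (rule real_tendsto_sandwich[OF _ _ tendsto_const])
      show "(\<lambda>m. 2 * (\<Sum>i<r m. (norm (?ie m i))\<^sup>2) + 2 * (\<Sum>i<r m. norm (dr (r m) i))\<^sup>2) \<longlonglongrightarrow> 0"
        by (rule tendsto_eq_intros l1 drl | simp)+
    qed (use sq in \<open>auto intro!: always_eventually sum_nonneg\<close>)
    have "(\<lambda>m. \<Sum>i<r m. ?v m i * dr (r m) i) \<longlonglongrightarrow> 0"
    proof (rule Lim_null_comparison)
      show "\<forall>\<^sub>F m in sequentially. norm (\<Sum>i<r m. ?v m i * dr (r m) i) \<le> B * (\<Sum>i<r m. norm (dr (r m) i))"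
        unfolding sum_distrib_left using vb
        by (intro always_eventually allI sum_norm_le) (simp add: norm_mult mult_right_mono)
      show "(\<lambda>m. B * (\<Sum>i<r m. norm (dr (r m) i))) \<longlonglongrightarrow> 0"
        by (rule tendsto_mult_right_zero[OF drl])
    qed
    from tendsto_add[OF l2 this]
    have s2: "(\<lambda>m. \<Sum>i<r m. ?v m i * ?d m i) \<longlonglongrightarrow> 0"
      by (simp add: sum.distrib[symmetric] distrib_left[symmetric] dec)
    show "(\<lambda>m. (\<Sum>i<r m. (norm (?d m i))\<^sup>2, \<Sum>i<r m. ?v m i * ?d m i)) \<longlonglongrightarrow> 0"
      unfolding zero_prod_def by (rule tendsto_Pair[OF s1 s2])
  qed
  ultimately show ?thesis unfolding \<Psi>_def by (intro exI[of _ G]) (auto simp: G_def)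
qed

text \<open>Weights in the stochastic limits must be adapted and bounded everywhere, so they are
  clipped at \<open>C\<close>; on the paths considered the clipping is invisible. One subsequence is
  extracted for all limits, after which \<open>ratio_pathwise\<close> applies path by path.\<close>

lemma lin_sol_ratio_bounded:
  fixes \<mu> X X' :: "real \<Rightarrow> 'a \<Rightarrow> complex"
  assumes t: "0 < t" and C: "0 \<le> C" and \<mu>: "adapted \<mu>" "continuous_paths \<mu>"
    and X: "lin_sol c \<mu> a s X" and X': "lin_sol c \<mu> a' s' X'"
    and h: "h = - (c * (s - s'))" and g: "g = a' - a - of_real (c * s' * h) + of_real (h\<^sup>2) / 2"
  defines "Y \<equiv> \<lambda>u \<omega>. of_real (W u \<omega>) + of_real c * integral {0..u} (\<lambda>r. \<mu> r \<omega>)"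
  defines "v \<equiv> \<lambda>u \<omega>. exp (of_real h * Y u \<omega> + g * of_real u) / X' u \<omega>"
  defines "\<kappa> \<equiv> \<lambda>u \<omega>. of_real c * (of_real s' - \<mu> u \<omega>) * of_real h - of_real (h\<^sup>2) / 2"
  shows "AE \<omega> in M. (\<forall>u\<in>{0..t}. X' u \<omega> \<noteq> 0 \<and> norm (of_real c * (of_real s - \<mu> u \<omega>) * X u \<omega>) \<le> C
      \<and> norm (of_real c * (of_real s' - \<mu> u \<omega>) * X' u \<omega>) \<le> C \<and> norm (v u \<omega>) \<le> C
      \<and> norm (v u \<omega> * (X u \<omega> / X' u \<omega>)) \<le> C \<and> norm (v u \<omega> * X u \<omega> * \<kappa> u \<omega>) \<le> C)
    \<longrightarrow> v t \<omega> * X t \<omega> = v 0 \<omega> * X 0 \<omega>"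
proof -
  have XF: "X u \<in> borel_measurable (F u)" "X' u \<in> borel_measurable (F u)" "\<mu> u \<in> borel_measurable (F u)" if "0 \<le> u" for u
    using X X' \<mu> that by (auto simp: lin_sol_def adapted_def)
  have Xc: "continuous_paths X" "continuous_paths X'" using X X' by (auto simp: lin_sol_def)
  have YF: "Y u \<in> borel_measurable (F u)" if "0 \<le> u" for u
    unfolding Y_def using W_measurable[OF that] adapted_integral[OF \<mu> that] by simp
  \<comment> \<open>Division by \<open>0\<close> yields \<open>0\<close>, so the quotient is
    measurable also where \<open>X'\<close> vanishes.\<close>
  have vF: "v u \<in> borel_measurable (F u)" if "0 \<le> u" for u
    unfolding v_def using YF[OF that] XF[OF that] by measurable
  have \<kappa>F: "\<kappa> u \<in> borel_measurable (F u)" if "0 \<le> u" for u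
    unfolding \<kappa>_def using XF[OF that] by measurable
  define clip where "clip = (\<lambda>z::complex. if norm z \<le> C then z else 0)"
  have clipm: "clip \<in> borel_measurable borel" unfolding clip_def by measurable
  have clipb: "norm (clip z) \<le> C" for z using C by (simp add: clip_def)
  have clipid: "norm z \<le> C \<Longrightarrow> clip z = z" for z by (simp add: clip_def)
  have clipad: "adapted (\<lambda>u \<omega>. clip (f u \<omega>))" if "\<And>u. 0 \<le> u \<Longrightarrow> f u \<in> borel_measurable (F u)" for f
    unfolding adapted_def using measurable_compose[OF that clipm] by blast
  define w1 where "w1 = (\<lambda>u \<omega>. clip (v u \<omega>))"
  define w2 where "w2 = (\<lambda>u \<omega>. clip (v u \<omega> * (X u \<omega> / X' u \<omega>)))"
  define w3 where "w3 = (\<lambda>u \<omega>. clip (v u \<omega> * X u \<omega> * \<kappa> u \<omega>))"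
  have a1: "adapted w1" unfolding w1_def using vF by (rule clipad)
  have a2: "adapted w2" unfolding w2_def
  proof (rule clipad)
    fix u :: real assume "0 \<le> u"
    show "(\<lambda>\<omega>. v u \<omega> * (X u \<omega> / X' u \<omega>)) \<in> borel_measurable (F u)"
      using vF[OF \<open>0 \<le> u\<close>] XF[OF \<open>0 \<le> u\<close>] by measurable
  qed
  have a3: "adapted w3" unfolding w3_def
  proof (rule clipad)
    fix u :: real assume "0 \<le> u"
    show "(\<lambda>\<omega>. v u \<omega> * X u \<omega> * \<kappa> u \<omega>) \<in> borel_measurable (F u)"
      using vF[OF \<open>0 \<le> u\<close>] XF[OF \<open>0 \<le> u\<close>] \<kappa>F[OF \<open>0 \<le> u\<close>] by measurable
  qed
  obtain G where G: "AE \<omega> in M. \<omega> \<in> G" "G \<subseteq> space M" and N1: "\<And>v B. adapted v \<Longrightarrow> (\<forall>u \<omega>. norm (v u \<omega>) \<le> B) \<Longrightarrow>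
     ip_null M {\<omega>\<in>G. \<forall>u\<in>{0..t}. norm (of_real c * (of_real s - \<mu> u \<omega>) * X u \<omega>) \<le> C} (\<lambda>n \<omega>.
       (\<Sum>i<n. (norm (lin_sol_defect c \<mu> a s X t n i \<omega>))\<^sup>2,
        \<Sum>i<n. v (grid t n i) \<omega> * lin_sol_defect c \<mu> a s X t n i \<omega>))"
    using lin_sol_defect_null[OF t C \<mu> X] by blast
  obtain G' where G': "AE \<omega> in M. \<omega> \<in> G'" and N2: "\<And>v B. adapted v \<Longrightarrow> (\<forall>u \<omega>. norm (v u \<omega>) \<le> B) \<Longrightarrow>
     ip_null M {\<omega>\<in>G'. \<forall>u\<in>{0..t}. norm (of_real c * (of_real s' - \<mu> u \<omega>) * X' u \<omega>) \<le> C} (\<lambda>n \<omega>.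
       (\<Sum>i<n. (norm (lin_sol_defect c \<mu> a' s' X' t n i \<omega>))\<^sup>2,
        \<Sum>i<n. v (grid t n i) \<omega> * lin_sol_defect c \<mu> a' s' X' t n i \<omega>))"
    using lin_sol_defect_null[OF t C \<mu> X'] by blast
  define A where "A = {\<omega>\<in>G \<inter> G'. \<forall>u\<in>{0..t}. X' u \<omega> \<noteq> 0 \<and> norm (of_real c * (of_real s - \<mu> u \<omega>) * X u \<omega>) \<le> C
      \<and> norm (of_real c * (of_real s' - \<mu> u \<omega>) * X' u \<omega>) \<le> C \<and> norm (v u \<omega>) \<le> C
      \<and> norm (v u \<omega> * (X u \<omega> / X' u \<omega>)) \<le> C \<and> norm (v u \<omega> * X u \<omega> * \<kappa> u \<omega>) \<le> C}"
  have n1: "ip_null M A (\<lambda>n \<omega>. (\<Sum>i<n. (norm (lin_sol_defect c \<mu> a s X t n i \<omega>))\<^sup>2,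
        \<Sum>i<n. w1 (grid t n i) \<omega> * lin_sol_defect c \<mu> a s X t n i \<omega>))"
    by (rule ip_null_mono[OF N1[OF a1, of C]]) (auto simp: w1_def clipb A_def)
  have n2: "ip_null M A (\<lambda>n \<omega>. (\<Sum>i<n. (norm (lin_sol_defect c \<mu> a' s' X' t n i \<omega>))\<^sup>2,
        \<Sum>i<n. w2 (grid t n i) \<omega> * lin_sol_defect c \<mu> a' s' X' t n i \<omega>))"
    by (rule ip_null_mono[OF N2[OF a2, of C]]) (auto simp: w2_def clipb A_def)
  have n3: "ip_null M A (\<lambda>n \<omega>. \<Sum>i<n. w3 (grid t n i) \<omega> *
     of_real ((W (grid t n (Suc i)) \<omega> - W (grid t n i) \<omega>)\<^sup>2 - t / real n))"
    by (rule ip_null_mono[OF quadratic_variation_null[OF t, of w3 C]]) (use a3 in \<open>auto simp: w3_def clipb adapted_def\<close>)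
  \<comment> \<open>The weight \<open>1\<close> gives the plain quadratic variation, which bounds
    the sum of squared increments.\<close>
  have n4: "ip_null M A (\<lambda>n \<omega>. \<Sum>i<n. 1 *
     of_real ((W (grid t n (Suc i)) \<omega> - W (grid t n i) \<omega>)\<^sup>2 - t / real n) :: complex)"
    by (rule ip_null_mono[OF quadratic_variation_null[OF t, of "\<lambda>_ _. 1" 1]]) auto
  obtain r :: "nat \<Rightarrow> nat" where r: "strict_mono r" and lim: "AE \<omega> in M. \<omega> \<in> A \<longrightarrow> (\<lambda>m.
      (((\<Sum>i<r m. (norm (lin_sol_defect c \<mu> a s X t (r m) i \<omega>))\<^sup>2,
        \<Sum>i<r m. w1 (grid t (r m) i) \<omega> * lin_sol_defect c \<mu> a s X t (r m) i \<omega>),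
      (\<Sum>i<r m. (norm (lin_sol_defect c \<mu> a' s' X' t (r m) i \<omega>))\<^sup>2,
        \<Sum>i<r m. w2 (grid t (r m) i) \<omega> * lin_sol_defect c \<mu> a' s' X' t (r m) i \<omega>)),
      (\<Sum>i<r m. w3 (grid t (r m) i) \<omega> *
        of_real ((W (grid t (r m) (Suc i)) \<omega> - W (grid t (r m) i) \<omega>)\<^sup>2 - t / real (r m)),
       \<Sum>i<r m. 1 * complex_of_real ((W (grid t (r m) (Suc i)) \<omega> - W (grid t (r m) i) \<omega>)\<^sup>2 - t / real (r m))))) \<longlonglongrightarrow> 0"
    using ip_null_AE_subseq[OF ip_null_Pair[OF ip_null_Pair[OF n1 n2] ip_null_Pair[OF n3 n4]]] by blast
  show ?thesis using lim G(1) G'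
  proof eventually_elim
    case (elim \<omega>)
    show ?case
    proof
      assume asm: "\<forall>u\<in>{0..t}. X' u \<omega> \<noteq> 0 \<and> norm (of_real c * (of_real s - \<mu> u \<omega>) * X u \<omega>) \<le> C
      \<and> norm (of_real c * (of_real s' - \<mu> u \<omega>) * X' u \<omega>) \<le> C \<and> norm (v u \<omega>) \<le> C
      \<and> norm (v u \<omega> * (X u \<omega> / X' u \<omega>)) \<le> C \<and> norm (v u \<omega> * X u \<omega> * \<kappa> u \<omega>) \<le> C"
      have \<omega>: "\<omega> \<in> space M" using elim(2) G(2) by blast
      have A: "\<omega> \<in> A" using asm elim by (simp add: A_def)
      note lm = elim(1)[rule_format, OF A]
      note l12 = tendsto_fst[OF lm, unfolded zero_prod_def fst_conv]
      note l34 = tendsto_snd[OF lm, unfolded zero_prod_def snd_conv]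
      note l1 = tendsto_fst[OF l12, unfolded zero_prod_def fst_conv]
      note l2 = tendsto_snd[OF l12, unfolded zero_prod_def snd_conv]
      have grid: "grid t n i \<in> {0..t}" if "i < n" for i n
        using that t grid_bounds[of t i n] by auto
      have c1: "w1 (grid t n i) \<omega> = v (grid t n i) \<omega>"
        and c2: "w2 (grid t n i) \<omega> = v (grid t n i) \<omega> * (X (grid t n i) \<omega> / X' (grid t n i) \<omega>)"
        and c3: "w3 (grid t n i) \<omega> = v (grid t n i) \<omega> * X (grid t n i) \<omega> * \<kappa> (grid t n i) \<omega>"
        if "i < n" for i n
        using asm grid[OF that] by (auto simp: w1_def w2_def w3_def intro!: clipid)
      show "v t \<omega> * X t \<omega> = v 0 \<omega> * X 0 \<omega>"
      proof (rule ratio_pathwise[where x = "\<lambda>u. X u \<omega>" and y = "\<lambda>u. X' u \<omega>" and \<mu> = "\<lambda>u. \<mu> u \<omega>" and w = "\<lambda>u. W u \<omega>"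
            and v = "\<lambda>u. v u \<omega>" and \<kappa> = "\<lambda>u. \<kappa> u \<omega>" and Y = "\<lambda>u. Y u \<omega>" and k = r
            and e = "\<lambda>m i. lin_sol_defect c \<mu> a s X t (r m) i \<omega>" and e' = "\<lambda>m i. lin_sol_defect c \<mu> a' s' X' t (r m) i \<omega>",
            OF t _ _ _ _ _ r h g])
        show "continuous_on {0..t} (\<lambda>u. X u \<omega>)" "continuous_on {0..t} (\<lambda>u. X' u \<omega>)" "continuous_on {0..t} (\<lambda>u. \<mu> u \<omega>)"
          using continuous_paths_on \<omega> Xc \<mu> by auto
        show "continuous_on {0..t} (\<lambda>u. W u \<omega>)"
          using W_continuous[OF \<omega>] by (rule continuous_on_subset) auto
        show "X' u \<omega> \<noteq> 0" if "u \<in> {0..t}" for u using asm that by blast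
        show "Y u \<omega> = of_real (W u \<omega>) + of_real c * integral {0..u} (\<lambda>u. \<mu> u \<omega>)" for u by (simp add: Y_def)
        show "v u \<omega> = exp (of_real h * Y u \<omega> + g * of_real u) / X' u \<omega>" for u by (simp add: v_def)
        show "\<kappa> u \<omega> = of_real c * (of_real s' - \<mu> u \<omega>) * of_real h - of_real (h\<^sup>2) / 2" for u by (simp add: \<kappa>_def)
        show "(\<lambda>m. \<Sum>i<r m. (norm (lin_sol_defect c \<mu> a s X t (r m) i \<omega>))\<^sup>2) \<longlonglongrightarrow> 0"
          using tendsto_fst[OF l1] by (simp add: zero_prod_def)
        show "(\<lambda>m. \<Sum>i<r m. (norm (lin_sol_defect c \<mu> a' s' X' t (r m) i \<omega>))\<^sup>2) \<longlonglongrightarrow> 0"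
          using tendsto_fst[OF l2] by (simp add: zero_prod_def)
        show "(\<lambda>m. \<Sum>i<r m. v (grid t (r m) i) \<omega> * lin_sol_defect c \<mu> a s X t (r m) i \<omega>) \<longlonglongrightarrow> 0"
          using tendsto_snd[OF l1] by (simp add: zero_prod_def c1)
        show "(\<lambda>m. \<Sum>i<r m. v (grid t (r m) i) \<omega> * (X (grid t (r m) i) \<omega> / X' (grid t (r m) i) \<omega>)
            * lin_sol_defect c \<mu> a' s' X' t (r m) i \<omega>) \<longlonglongrightarrow> 0"
          using tendsto_snd[OF l2] by (simp add: zero_prod_def c2)
        show "(\<lambda>m. \<Sum>i<r m. v (grid t (r m) i) \<omega> * X (grid t (r m) i) \<omega> * \<kappa> (grid t (r m) i) \<omega> *
            of_real ((W (grid t (r m) (Suc i)) \<omega> - W (grid t (r m) i) \<omega>)\<^sup>2 - t / real (r m))) \<longlonglongrightarrow> 0"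
          using tendsto_fst[OF l34] by (simp add: zero_prod_def c3)
        have "(\<lambda>m. complex_of_real (\<Sum>i<r m. (W (grid t (r m) (Suc i)) \<omega> - W (grid t (r m) i) \<omega>)\<^sup>2 - t / real (r m))) \<longlonglongrightarrow> complex_of_real 0"
          using tendsto_snd[OF l34] by (simp only: zero_prod_def snd_conv mult_1 of_real_sum of_real_0)
        then show "(\<lambda>m. \<Sum>i<r m. (W (grid t (r m) (Suc i)) \<omega> - W (grid t (r m) i) \<omega>)\<^sup>2 - t / real (r m)) \<longlonglongrightarrow> 0"
          unfolding tendsto_of_real_iff .
      qed (simp_all add: lin_sol_defect_def)
    qed
  qed
qed

text \<open>On a path without zeros of the denominator all quantities to be bounded are continuous
  on a compact interval, so some integer cutoff works; countably many cutoffs cost only a null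
  set.\<close>

lemma lin_sol_ratio:
  fixes \<mu> X X' :: "real \<Rightarrow> 'a \<Rightarrow> complex"
  assumes t: "0 \<le> t" and \<mu>: "adapted \<mu>" "continuous_paths \<mu>"
    and X: "lin_sol c \<mu> a s X" and X': "lin_sol c \<mu> a' s' X'"
    and h: "h = - (c * (s - s'))" and g: "g = a' - a - of_real (c * s' * h) + of_real (h\<^sup>2) / 2"
  defines "Y \<equiv> \<lambda>u \<omega>. of_real (W u \<omega>) + of_real c * integral {0..u} (\<lambda>r. \<mu> r \<omega>)"
  shows "AE \<omega> in M. (\<forall>u\<in>{0..t}. X' u \<omega> \<noteq> 0) \<longrightarrow>
     exp (of_real h * Y t \<omega> + g * of_real t) * X t \<omega> * X' 0 \<omega> = X 0 \<omega> * X' t \<omega>"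
proof -
  have W0: "W 0 \<omega> = 0" if "\<omega> \<in> space M" for \<omega>
    using wiener_process that by (auto simp: wiener_process_def)
  have Y0: "Y 0 \<omega> = 0" if "\<omega> \<in> space M" for \<omega> using W0[OF that] by (simp add: Y_def)
  show ?thesis
  proof (cases "t = 0")
    case True
    then show ?thesis using Y0 by (intro AE_I2) simp
  next
    case False
    with t have t: "0 < t" by simp
    define v where "v = (\<lambda>u \<omega>. exp (of_real h * Y u \<omega> + g * of_real u) / X' u \<omega>)"
    define \<kappa> where "\<kappa> = (\<lambda>u \<omega>. of_real c * (of_real s' - \<mu> u \<omega>) * of_real h - of_real (h\<^sup>2) / 2)"
    have "AE \<omega> in M. \<forall>C::nat. (\<forall>u\<in>{0..t}. X' u \<omega> \<noteq> 0 \<and> norm (of_real c * (of_real s - \<mu> u \<omega>) * X u \<omega>) \<le> real C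
      \<and> norm (of_real c * (of_real s' - \<mu> u \<omega>) * X' u \<omega>) \<le> real C \<and> norm (v u \<omega>) \<le> real C
      \<and> norm (v u \<omega> * (X u \<omega> / X' u \<omega>)) \<le> real C \<and> norm (v u \<omega> * X u \<omega> * \<kappa> u \<omega>) \<le> real C)
      \<longrightarrow> v t \<omega> * X t \<omega> = v 0 \<omega> * X 0 \<omega>"
      unfolding AE_all_countable v_def \<kappa>_def Y_def
      by (intro allI lin_sol_ratio_bounded[OF t _ \<mu> X X' h g]) simp
    then show ?thesis
      using AE_space
    proof eventually_elim
      case (elim \<omega>)
      show ?case
      proof
        assume nz: "\<forall>u\<in>{0..t}. X' u \<omega> \<noteq> 0"
        have cX: "continuous_on {0..t} (\<lambda>u. X u \<omega>)" "continuous_on {0..t} (\<lambda>u. X' u \<omega>)" "continuous_on {0..t} (\<lambda>u. \<mu> u \<omega>)"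
          using continuous_paths_on elim(2) X X' \<mu> by (auto simp: lin_sol_def)
        have cW: "continuous_on {0..t} (\<lambda>u. W u \<omega>)"
          using W_continuous[OF elim(2)] by (rule continuous_on_subset) auto
        have cI: "continuous_on {0..t} (\<lambda>u. integral {0..u} (\<lambda>r. \<mu> r \<omega>))"
          by (rule indefinite_integral_continuous_1) (rule integrable_continuous_real[OF cX(3)])
        have cY: "continuous_on {0..t} (\<lambda>u. Y u \<omega>)" unfolding Y_def using cW cI by (intro continuous_intros)
        have cv: "continuous_on {0..t} (\<lambda>u. v u \<omega>)" unfolding v_def using cY cX nz by (intro continuous_intros) auto
        have c\<kappa>: "continuous_on {0..t} (\<lambda>u. \<kappa> u \<omega>)" unfolding \<kappa>_def using cX by (intro continuous_intros)
        have f1: "continuous_on {0..t} (\<lambda>u. of_real c * (of_real s - \<mu> u \<omega>) * X u \<omega>)" using cX by (intro continuous_intros)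
        have f2: "continuous_on {0..t} (\<lambda>u. of_real c * (of_real s' - \<mu> u \<omega>) * X' u \<omega>)" using cX by (intro continuous_intros)
        have f3: "continuous_on {0..t} (\<lambda>u. v u \<omega> * (X u \<omega> / X' u \<omega>))" using cX cv nz by (intro continuous_intros) auto
        have f4: "continuous_on {0..t} (\<lambda>u. v u \<omega> * X u \<omega> * \<kappa> u \<omega>)" using cX cv c\<kappa> by (intro continuous_intros)
        obtain B1 where B1: "0 \<le> B1" "\<And>u. u \<in> {0..t} \<Longrightarrow> norm (of_real c * (of_real s - \<mu> u \<omega>) * X u \<omega>) \<le> B1" using continuous_on_bounded[OF f1] by metis
        obtain B2 where B2: "0 \<le> B2" "\<And>u. u \<in> {0..t} \<Longrightarrow> norm (of_real c * (of_real s' - \<mu> u \<omega>) * X' u \<omega>) \<le> B2" using continuous_on_bounded[OF f2] by metis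
        obtain B3 where B3: "0 \<le> B3" "\<And>u. u \<in> {0..t} \<Longrightarrow> norm (v u \<omega>) \<le> B3" using continuous_on_bounded[OF cv] by metis
        obtain B4 where B4: "0 \<le> B4" "\<And>u. u \<in> {0..t} \<Longrightarrow> norm (v u \<omega> * (X u \<omega> / X' u \<omega>)) \<le> B4" using continuous_on_bounded[OF f3] by metis
        obtain B5 where B5: "0 \<le> B5" "\<And>u. u \<in> {0..t} \<Longrightarrow> norm (v u \<omega> * X u \<omega> * \<kappa> u \<omega>) \<le> B5" using continuous_on_bounded[OF f4] by metis
        obtain C :: nat where C: "B1 + B2 + B3 + B4 + B5 \<le> real C" using real_arch_simple by blast
        have CB: "B1 \<le> real C" "B2 \<le> real C" "B3 \<le> real C" "B4 \<le> real C" "B5 \<le> real C"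
          using C B1(1) B2(1) B3(1) B4(1) B5(1) by linarith+
        have "v t \<omega> * X t \<omega> = v 0 \<omega> * X 0 \<omega>"
          by (rule elim(1)[rule_format, of C], intro conjI)
            (use nz order_trans[OF B1(2) CB(1)] order_trans[OF B2(2) CB(2)] order_trans[OF B3(2) CB(3)]
              order_trans[OF B4(2) CB(4)] order_trans[OF B5(2) CB(5)] in blast)+
        then show "exp (of_real h * Y t \<omega> + g * of_real t) * X t \<omega> * X' 0 \<omega> = X 0 \<omega> * X' t \<omega>"
          using nz t Y0[OF elim(2)] by (simp add: v_def field_simps)
      qed
    qed
  qed
qed

end

section \<open>Resolutions of the identity\<close>

lemma csmult_component [simp]: "csmult c A $ i $ j = c * A $ i $ j"
  by (simp add: csmult_def)

lemma matrix_mult_component: "(A ** B) $ i $ j = (\<Sum>k\<in>UNIV. A $ i $ k * B $ k $ j)"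
  by (simp add: matrix_matrix_mult_def)

lemma scaleR_eq_csmult: "r *\<^sub>R A = csmult (of_real r) A"
  by (simp add: vec_eq_iff scaleR_conv_of_real[symmetric])

lemma csmult_matrix_mult:
  "csmult c A ** B = csmult c (A ** B)" "A ** csmult c B = csmult c (A ** B)"
  by (simp_all add: vec_eq_iff matrix_mult_component sum_distrib_left mult.assoc mult.left_commute)

lemma csmult_csmult [simp]: "csmult c (csmult d A) = csmult (c * d) A"
  by (simp add: vec_eq_iff)

lemma csmult_one [simp]: "csmult 1 A = A"
  by (simp add: vec_eq_iff)

lemma csmult_zero [simp]: "csmult 0 A = 0" "csmult c 0 = 0"
  by (simp_all add: vec_eq_iff)

lemma csmult_distrib:
  "csmult c (A + B) = csmult c A + csmult c B" "csmult c (A - B) = csmult c A - csmult c B"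
  "csmult (c + d) A = csmult c A + csmult d A" "csmult (c - d) A = csmult c A - csmult d A"
  by (simp_all add: vec_eq_iff algebra_simps)

lemma csmult_sum: "csmult c (\<Sum>i\<in>S. f i) = (\<Sum>i\<in>S. csmult c (f i))"
  by (induction S rule: infinite_finite_induct) (simp_all add: csmult_distrib)

lemma matrix_mult_add:
  fixes A B C :: "'n::finite cmat"
  shows "A ** (B + C) = A ** B + A ** C" "(B + C) ** A = B ** A + C ** A"
  by (simp_all add: vec_eq_iff matrix_mult_component sum.distrib algebra_simps)

lemma matrix_mult_sum:
  fixes A :: "'n::finite cmat"
  shows "A ** (\<Sum>i\<in>S. f i) = (\<Sum>i\<in>S. A ** f i)" "(\<Sum>i\<in>S. f i) ** A = (\<Sum>i\<in>S. f i ** A)"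
  by (induction S rule: infinite_finite_induct) (simp_all add: matrix_mult_add)

lemma matrix_mult_diff:
  fixes A B C :: "'n::finite cmat"
  shows "A ** (B - C) = A ** B - A ** C" "(B - C) ** A = B ** A - C ** A"
  by (simp_all add: vec_eq_iff matrix_mult_component sum_subtractf algebra_simps)

lemma mtrace_linear:
  "mtrace (A + B) = mtrace A + mtrace B" "mtrace (A - B) = mtrace A - mtrace B" "mtrace (csmult c A) = c * mtrace A"
  by (simp_all add: mtrace_def sum.distrib sum_subtractf sum_distrib_left)

lemma mtrace_0 [simp]: "mtrace 0 = 0"
  by (simp add: mtrace_def)

lemma mtrace_sum: "mtrace (\<Sum>i\<in>S. f i) = (\<Sum>i\<in>S. mtrace (f i))"
  by (induction S rule: infinite_finite_induct) (simp_all add: mtrace_linear)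

lemma mtrace_commute: "mtrace (A ** B) = mtrace (B ** A)"
  unfolding mtrace_def matrix_mult_component by (subst sum.swap) (simp add: mult.commute)

lemma mtrace_cadj: "mtrace (cadj A) = cnj (mtrace A)"
  by (simp add: mtrace_def cadj_def)

lemma cadj_mult: "cadj (A ** B) = cadj B ** cadj A"
  by (simp add: cadj_def vec_eq_iff matrix_mult_component mult.commute)

lemma hermitian_diff: "hermitian A \<Longrightarrow> hermitian B \<Longrightarrow> hermitian (A - B)"
  by (simp add: hermitian_def cadj_def vec_eq_iff)

lemma hermitian_sum: "(\<And>i. i \<in> S \<Longrightarrow> hermitian (f i)) \<Longrightarrow> hermitian (\<Sum>i\<in>S. f i)"
  by (induction S rule: infinite_finite_induct) (simp_all add: hermitian_def cadj_def vec_eq_iff)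

lemma hermitian_mat_1: "hermitian (mat 1)"
  by (simp add: hermitian_def cadj_def vec_eq_iff mat_def)

locale resolution =
  fixes J :: "'i set" and E :: "'i \<Rightarrow> 'n::finite cmat"
  assumes finite_J: "finite J"
    and E_mult: "\<And>i j. i \<in> J \<Longrightarrow> j \<in> J \<Longrightarrow> E i ** E j = (if i = j then E i else 0)"
    and E_sum: "(\<Sum>i\<in>J. E i) = mat 1"
begin

lemma combination_mult:
  assumes "i \<in> J"
  shows "(\<Sum>j\<in>J. csmult (z j) (E j)) ** E i = csmult (z i) (E i)" "E i ** (\<Sum>j\<in>J. csmult (z j) (E j)) = csmult (z i) (E i)"
proof -
  have "(\<Sum>j\<in>J. csmult (z j) (E j)) ** E i = (\<Sum>j\<in>J. if j = i then csmult (z i) (E i) else 0)"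
    unfolding matrix_mult_sum csmult_matrix_mult by (rule sum.cong) (use assms E_mult in auto)
  then show "(\<Sum>j\<in>J. csmult (z j) (E j)) ** E i = csmult (z i) (E i)" using finite_J assms by simp
  have "E i ** (\<Sum>j\<in>J. csmult (z j) (E j)) = (\<Sum>j\<in>J. if j = i then csmult (z i) (E i) else 0)"
    unfolding matrix_mult_sum csmult_matrix_mult by (rule sum.cong) (use assms E_mult in auto)
  then show "E i ** (\<Sum>j\<in>J. csmult (z j) (E j)) = csmult (z i) (E i)" using finite_J assms by simp
qed

lemma block_decomposition: "A = (\<Sum>i\<in>J. \<Sum>j\<in>J. E i ** A ** E j)"
proof -
  have "A = mat 1 ** A ** mat 1" by simp
  also have "\<dots> = (\<Sum>i\<in>J. \<Sum>j\<in>J. E i ** A ** E j)"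
    unfolding E_sum[symmetric] matrix_mult_sum by (rule sum.swap)
  finally show ?thesis .
qed

lemma mtrace_decomposition: "mtrace A = (\<Sum>i\<in>J. mtrace (E i ** A))"
proof -
  have "mtrace A = mtrace ((\<Sum>i\<in>J. E i) ** A)" by (simp add: E_sum)
  then show ?thesis by (simp add: matrix_mult_sum mtrace_sum)
qed

lemma mpow_combination: "mpow (\<Sum>i\<in>J. csmult (z i) (E i)) k = (\<Sum>i\<in>J. csmult (z i ^ k) (E i))"
proof (induction k)
  case 0
  then show ?case by (simp add: E_sum)
next
  case (Suc k)
  have "mpow (\<Sum>i\<in>J. csmult (z i) (E i)) (Suc k) = (\<Sum>i\<in>J. csmult (z i ^ k) ((\<Sum>j\<in>J. csmult (z j) (E j)) ** E i))"
    by (simp add: Suc matrix_mult_sum csmult_matrix_mult)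
  also have "\<dots> = (\<Sum>i\<in>J. csmult (z i ^ Suc k) (E i))"
    by (rule sum.cong) (simp_all add: combination_mult mult.commute)
  finally show ?case .
qed

text \<open>Functional calculus: powers act on the coefficients, and the exponential series
  converges in each of the finitely many coefficients.\<close>

lemma mexp_combination: "mexp (\<Sum>i\<in>J. csmult (z i) (E i)) = (\<Sum>i\<in>J. csmult (exp (z i)) (E i))"
proof -
  have lin: "bounded_linear (\<lambda>c. csmult c A)" for A :: "'n cmat"
    unfolding linear_conv_bounded_linear[symmetric]
    by (rule linearI) (simp_all add: csmult_distrib scaleR_eq_csmult, simp add: scaleR_conv_of_real)
  have "(\<lambda>k. csmult (z i ^ k /\<^sub>R fact k) (E i)) sums csmult (exp (z i)) (E i)" for i
    by (rule bounded_linear.sums[OF lin exp_converges])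
  then have "(\<lambda>k. \<Sum>i\<in>J. csmult (z i ^ k /\<^sub>R fact k) (E i)) sums (\<Sum>i\<in>J. csmult (exp (z i)) (E i))"
    by (intro sums_sum)
  moreover have "(\<Sum>i\<in>J. csmult (z i ^ k /\<^sub>R fact k) (E i)) = (1 / fact k) *\<^sub>R mpow (\<Sum>i\<in>J. csmult (z i) (E i)) k" for k
    unfolding mpow_combination scaleR_eq_csmult csmult_sum
    by (intro sum.cong refl) (simp add: scaleR_conv_of_real divide_inverse)
  ultimately show ?thesis unfolding mexp_def by (simp add: sums_iff)
qed

end

text \<open>Adjoining the complementary projection \<open>1 - \<Sum>P\<^sub>k\<close> as an extra index, with eigenvalue \<open>0\<close>,
  turns an orthogonal family of projections into a resolution of the identity.\<close>

definition completed :: "nat \<Rightarrow> (nat \<Rightarrow> 'n::finite cmat) \<Rightarrow> nat \<Rightarrow> 'n cmat" where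
  "completed K P k = (if k < K then P k else mat 1 - (\<Sum>l<K. P l))"

definition extend_zero :: "nat \<Rightarrow> (nat \<Rightarrow> real) \<Rightarrow> nat \<Rightarrow> real" where
  "extend_zero K f k = (if k < K then f k else 0)"

lemma completed_mult:
  assumes "\<forall>k<K. \<forall>l<K. P k ** P l = kdelta k l *\<^sub>R P l" "k \<le> K" "l \<le> K"
  shows "completed K P k ** completed K P l = (if k = l then completed K P k else 0)"
proof -
  have PP: "P k ** P l = (if k = l then P l else 0)" if "k < K" "l < K" for k l
    using assms(1) that by (simp add: kdelta_def)
  have S1: "P k ** (\<Sum>l<K. P l) = P k" if "k < K" for k
  proof -
    have "P k ** (\<Sum>l<K. P l) = (\<Sum>l<K. if l = k then P k else 0)"
      unfolding matrix_mult_sum by (rule sum.cong) (use that PP in auto)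
    then show ?thesis using that by simp
  qed
  have S2: "(\<Sum>l<K. P l) ** P k = P k" if "k < K" for k
  proof -
    have "(\<Sum>l<K. P l) ** P k = (\<Sum>l<K. if l = k then P k else 0)"
      unfolding matrix_mult_sum by (rule sum.cong) (use that PP in auto)
    then show ?thesis using that by simp
  qed
  have S3: "(\<Sum>l<K. P l) ** (\<Sum>l<K. P l) = (\<Sum>l<K. P l)"
    unfolding matrix_mult_sum(2)[of P] by (rule sum.cong) (simp_all add: S1)
  show ?thesis
    using assms(2,3) PP S1 S2 S3 by (cases "k < K"; cases "l < K") (auto simp: completed_def matrix_mult_diff)
qed

lemma completed_sum: "(\<Sum>k\<le>K. completed K P k) = mat 1"
proof -
  have "(\<Sum>k<K. completed K P k) = (\<Sum>k<K. P k)" by (rule sum.cong) (auto simp: completed_def)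
  then have "(\<Sum>k<Suc K. completed K P k) = mat 1" by (simp add: completed_def)
  then show ?thesis by (simp add: lessThan_Suc_atMost)
qed

lemma completed_hermitian: "\<forall>k<K. hermitian (P k) \<Longrightarrow> hermitian (completed K P k)"
  by (auto simp: completed_def intro!: hermitian_diff hermitian_sum hermitian_mat_1)

lemma completed_commute:
  assumes "\<And>k. k < K \<Longrightarrow> P k ** A = A ** P k"
  shows "completed K P k ** A = A ** completed K P k"
proof -
  have "(\<Sum>l<K. P l) ** A = A ** (\<Sum>l<K. P l)"
    unfolding matrix_mult_sum by (rule sum.cong) (use assms in auto)
  then show ?thesis using assms by (simp add: completed_def matrix_mult_diff)
qed

lemma completed_combination:
  "(\<Sum>k<K. f k *\<^sub>R P k) = (\<Sum>k\<le>K. csmult (of_real (extend_zero K f k)) (completed K P k))"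
proof -
  have "(\<Sum>k<K. f k *\<^sub>R P k) = (\<Sum>k<K. csmult (of_real (extend_zero K f k)) (completed K P k))"
    by (rule sum.cong) (auto simp: completed_def extend_zero_def scaleR_eq_csmult)
  also have "\<dots> = (\<Sum>k<Suc K. csmult (of_real (extend_zero K f k)) (completed K P k))"
    by (simp add: extend_zero_def)
  finally show ?thesis by (simp add: lessThan_Suc_atMost)
qed

section \<open>Joint spectral projections of two commuting families\<close>

locale commuting_projections =
  fixes K D :: nat and P Q :: "nat \<Rightarrow> 'n::finite cmat"
  assumes P_hermitian: "\<forall>k<K. hermitian (P k)" and Q_hermitian: "\<forall>j<D. hermitian (Q j)"
    and P_mult: "\<forall>k<K. \<forall>l<K. P k ** P l = kdelta k l *\<^sub>R P l"
    and Q_mult: "\<forall>j<D. \<forall>l<D. Q j ** Q l = kdelta j l *\<^sub>R Q l"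
    and PQ: "\<forall>k<K. \<forall>j<D. commutator (P k) (Q j) = 0"
begin

definition JE :: "(nat \<times> nat) set" where "JE = {..K} \<times> {..D}"

text \<open>Some of these products may be \<open>0\<close>, which the laws of
  \<open>resolution\<close> permit.\<close>

definition EE :: "nat \<times> nat \<Rightarrow> 'n cmat" where
  "EE = (\<lambda>(k, j). completed K P k ** completed D Q j)"

lemma PQ_commute: "completed K P k ** completed D Q j = completed D Q j ** completed K P k"
proof -
  have 1: "P k ** Q j = Q j ** P k" if "k < K" "j < D" for k j
    using PQ that by (simp add: commutator_def)
  have 2: "completed K P k ** Q j = Q j ** completed K P k" if "j < D" for j
    by (rule completed_commute) (use 1 that in auto)
  show ?thesis by (rule completed_commute[symmetric]) (use 2 in auto)
qed

lemma EE_mult: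
  assumes "\<mu> \<in> JE" "\<nu> \<in> JE" shows "EE \<mu> ** EE \<nu> = (if \<mu> = \<nu> then EE \<mu> else 0)"
proof -
  obtain k j l i where eq: "\<mu> = (k, j)" "\<nu> = (l, i)" by (cases \<mu>, cases \<nu>)
  have b: "k \<le> K" "j \<le> D" "l \<le> K" "i \<le> D" using assms by (auto simp: eq JE_def)
  let ?P = "completed K P" and ?Q = "completed D Q"
  have "EE \<mu> ** EE \<nu> = ?P k ** (?Q j ** ?P l) ** ?Q i" by (simp add: eq EE_def matrix_mul_assoc)
  also have "\<dots> = (?P k ** ?P l) ** (?Q j ** ?Q i)" by (simp add: PQ_commute[symmetric] matrix_mul_assoc)
  also have "\<dots> = (if \<mu> = \<nu> then EE \<mu> else 0)"
    unfolding completed_mult[OF P_mult b(1,3)] completed_mult[OF Q_mult b(2,4)] by (auto simp: eq EE_def)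
  finally show ?thesis .
qed

sublocale resolution JE EE
proof
  show "finite JE" by (simp add: JE_def)
  show "(\<Sum>i\<in>JE. EE i) = mat 1"
  proof -
    have "(\<Sum>i\<in>JE. EE i) = (\<Sum>k\<le>K. \<Sum>j\<le>D. completed K P k ** completed D Q j)"
      unfolding JE_def EE_def by (simp add: sum.cartesian_product)
    also have "\<dots> = mat 1"
      unfolding matrix_mult_sum[symmetric] completed_sum by simp
    finally show ?thesis .
  qed
qed (rule EE_mult)

lemma EE_hermitian: "hermitian (EE \<mu>)"
proof -
  obtain k j where "\<mu> = (k, j)" by (cases \<mu>)
  then show ?thesis
    using completed_hermitian[OF P_hermitian, of k] completed_hermitian[OF Q_hermitian, of j] PQ_commute[of k j]
    by (simp add: EE_def hermitian_def cadj_mult)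
qed

lemma P_combination: "(\<Sum>k<K. f k *\<^sub>R P k) = (\<Sum>\<mu>\<in>JE. csmult (of_real (extend_zero K f (fst \<mu>))) (EE \<mu>))"
proof -
  have "(\<Sum>\<mu>\<in>JE. csmult (of_real (extend_zero K f (fst \<mu>))) (EE \<mu>))
    = (\<Sum>k\<le>K. \<Sum>j\<le>D. csmult (of_real (extend_zero K f k)) (completed K P k ** completed D Q j))"
    unfolding JE_def EE_def by (simp add: sum.cartesian_product case_prod_beta)
  also have "\<dots> = (\<Sum>k\<le>K. csmult (of_real (extend_zero K f k)) (completed K P k))"
    unfolding csmult_sum[symmetric] matrix_mult_sum[symmetric] completed_sum by simp
  finally show ?thesis using completed_combination[of f P K] by simp
qed

lemma Q_combination: "(\<Sum>j<D. f j *\<^sub>R Q j) = (\<Sum>\<mu>\<in>JE. csmult (of_real (extend_zero D f (snd \<mu>))) (EE \<mu>))"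
proof -
  have "(\<Sum>\<mu>\<in>JE. csmult (of_real (extend_zero D f (snd \<mu>))) (EE \<mu>))
    = (\<Sum>k\<le>K. \<Sum>j\<le>D. csmult (of_real (extend_zero D f j)) (completed K P k ** completed D Q j))"
    unfolding JE_def EE_def by (simp add: sum.cartesian_product case_prod_beta)
  also have "\<dots> = (\<Sum>j\<le>D. csmult (of_real (extend_zero D f j)) (\<Sum>k\<le>K. completed K P k ** completed D Q j))"
    by (subst sum.swap) (simp add: csmult_sum)
  also have "\<dots> = (\<Sum>j\<le>D. csmult (of_real (extend_zero D f j)) (completed D Q j))"
    unfolding matrix_mult_sum[symmetric] completed_sum by simp
  finally show ?thesis using completed_combination[of f Q D] by simp
qed

text \<open>\<open>P k\<close> is itself a combination of the joint projections, with the indicator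
  of \<open>k\<close> as coefficients; the added index \<open>K\<close> never equals
  \<open>k\<close>.\<close>

lemma P_EE:
  assumes "k < K" "\<mu> \<in> JE"
  shows "P k ** EE \<mu> = (if fst \<mu> = k then EE \<mu> else 0)" "EE \<mu> ** P k = (if fst \<mu> = k then EE \<mu> else 0)"
proof -
  have eq: "P k = (\<Sum>\<nu>\<in>JE. csmult (of_real (extend_zero K (\<lambda>l. if l = k then 1 else 0) (fst \<nu>))) (EE \<nu>))"
  proof -
    have "(\<Sum>l<K. (if l = k then 1 else 0 :: real) *\<^sub>R P l) = (\<Sum>l<K. if l = k then P k else 0)"
      by (rule sum.cong) auto
    then show ?thesis using assms(1) by (simp flip: P_combination)
  qed
  have z: "extend_zero K (\<lambda>l. if l = k then 1 else 0) (fst \<mu>) = (if fst \<mu> = k then 1 else 0)"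
    using assms(1) by (simp add: extend_zero_def)
  show "P k ** EE \<mu> = (if fst \<mu> = k then EE \<mu> else 0)"
    by (subst eq, subst combination_mult(1)[OF assms(2)]) (simp add: z)
  show "EE \<mu> ** P k = (if fst \<mu> = k then EE \<mu> else 0)"
    by (subst eq, subst combination_mult(2)[OF assms(2)]) (simp add: z)
qed

text \<open>The sum over \<open>k \<le> j\<close> in \<open>rho_alpha\<close> is the symmetrisation of a full double sum.\<close>

lemma EE_rho_alpha:
  assumes \<mu>: "\<mu> \<in> JE" and \<nu>: "\<nu> \<in> JE" and sym: "\<And>k j. \<alpha> k j = \<alpha> j k"
  shows "EE \<mu> ** rho_alpha K P \<rho>0 \<alpha> ** EE \<nu> =
    csmult (of_real (if fst \<mu> < K \<and> fst \<nu> < K then exp (\<alpha> (fst \<mu>) (fst \<nu>)) else 1)) (EE \<mu> ** \<rho>0 ** EE \<nu>)"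
proof -
  let ?X = "EE \<mu> ** \<rho>0 ** EE \<nu>"
  let ?k = "fst \<mu>" and ?j = "fst \<nu>"
  define S where "S = {(k, j). k \<le> j \<and> j < K}"
  have finS: "finite S" unfolding S_def by (rule finite_subset[of _ "{..<K} \<times> {..<K}"]) auto
  have term1: "EE \<mu> ** (P k ** \<rho>0 ** P j) ** EE \<nu> = (if ?k = k \<and> ?j = j then ?X else 0)" if "k < K" "j < K" for k j
  proof -
    have "EE \<mu> ** (P k ** \<rho>0 ** P j) ** EE \<nu> = (EE \<mu> ** P k) ** \<rho>0 ** (P j ** EE \<nu>)" by (simp add: matrix_mul_assoc)
    then show ?thesis using P_EE(2)[OF that(1) \<mu>] P_EE(1)[OF that(2) \<nu>] by simp
  qed
  have "EE \<mu> ** rho_alpha K P \<rho>0 \<alpha> ** EE \<nu> = ?X + (\<Sum>(k, j)\<in>S. csmult (of_real (exp (\<alpha> k j) - 1))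
      (EE \<mu> ** (P k ** \<rho>0 ** P j) ** EE \<nu> + csmult (of_real (1 - kdelta k j)) (EE \<mu> ** (P j ** \<rho>0 ** P k) ** EE \<nu>)))"
    unfolding rho_alpha_def S_def[symmetric]
    by (simp add: matrix_mult_add matrix_mult_sum scaleR_eq_csmult csmult_matrix_mult case_prod_beta)
  also have "(\<Sum>(k, j)\<in>S. csmult (of_real (exp (\<alpha> k j) - 1))
      (EE \<mu> ** (P k ** \<rho>0 ** P j) ** EE \<nu> + csmult (of_real (1 - kdelta k j)) (EE \<mu> ** (P j ** \<rho>0 ** P k) ** EE \<nu>)))
     = (\<Sum>x\<in>S. if x = (min ?k ?j, max ?k ?j) then csmult (of_real (exp (\<alpha> ?k ?j) - 1)) ?X else 0)"
  proof (rule sum.cong[OF refl])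
    fix x assume "x \<in> S"
    then obtain k j where x: "x = (k, j)" "k \<le> j" "j < K" by (auto simp: S_def)
    then have kj: "k < K" "j < K" by auto
    \<comment> \<open>A pair \<open>k \<le> j\<close> contributes exactly when it is the ordered
      form of the two outer indices. For \<open>k = j\<close> both summands would match, and
      \<open>1 - kdelta k j\<close> removes the second.\<close>
    have iff: "(k, j) = (min ?k ?j, max ?k ?j) \<longleftrightarrow> (?k = k \<and> ?j = j) \<or> (?k = j \<and> ?j = k)"
      using x(2) by (auto simp: min_def max_def)
    show "(case x of (k, j) \<Rightarrow> csmult (of_real (exp (\<alpha> k j) - 1))
      (EE \<mu> ** (P k ** \<rho>0 ** P j) ** EE \<nu> + csmult (of_real (1 - kdelta k j)) (EE \<mu> ** (P j ** \<rho>0 ** P k) ** EE \<nu>)))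
      = (if x = (min ?k ?j, max ?k ?j) then csmult (of_real (exp (\<alpha> ?k ?j) - 1)) ?X else 0)"
      unfolding x(1) prod.case term1[OF kj] term1[OF kj(2,1)] iff
    proof (cases "?k = k \<and> ?j = j")
      case True
      then show "csmult (of_real (exp (\<alpha> k j) - 1)) ((if ?k = k \<and> ?j = j then ?X else 0) + csmult (of_real (1 - kdelta k j)) (if ?k = j \<and> ?j = k then ?X else 0))
        = (if ?k = k \<and> ?j = j \<or> ?k = j \<and> ?j = k then csmult (of_real (exp (\<alpha> ?k ?j) - 1)) ?X else 0)"
        by (cases "k = j") (simp_all add: kdelta_def)
    next
      case False
      show "csmult (of_real (exp (\<alpha> k j) - 1)) ((if ?k = k \<and> ?j = j then ?X else 0) + csmult (of_real (1 - kdelta k j)) (if ?k = j \<and> ?j = k then ?X else 0))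
        = (if ?k = k \<and> ?j = j \<or> ?k = j \<and> ?j = k then csmult (of_real (exp (\<alpha> ?k ?j) - 1)) ?X else 0)"
      proof (cases "?k = j \<and> ?j = k")
        case True
        with False have "k \<noteq> j" by auto
        moreover have "\<alpha> ?k ?j = \<alpha> k j" using True sym[of j k] by simp
        ultimately show ?thesis using True False by (simp add: kdelta_def)
      next
        case F: False
        show ?thesis unfolding if_not_P[OF False] if_not_P[OF F] using F False by auto
      qed
    qed
  qed
  \<comment> \<open>The surviving pair lies in \<open>S\<close> exactly when both outer indices are
    below \<open>K\<close>; blocks that touch the complementary projection keep the factor
    \<open>1\<close>.\<close>
  also have "\<dots> = (if ?k < K \<and> ?j < K then csmult (of_real (exp (\<alpha> ?k ?j) - 1)) ?X else 0)"
    using finS by (auto simp: S_def)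
  finally show ?thesis by (auto simp: csmult_distrib)
qed

text \<open>Both exponents are combinations of the joint projections, so the matrix exponentials
  multiply a block by scalars from the left and from the right.\<close>

lemma rho_tilde_expansion:
  assumes sym: "\<And>k j. \<alpha> k j = \<alpha> j k"
  shows "rho_tilde K P D Q \<rho>0 \<theta> \<gamma> \<alpha> = (\<Sum>\<mu>\<in>JE. \<Sum>\<nu>\<in>JE. csmult
     (exp (of_real (extend_zero K \<theta> (fst \<mu>) / 2) + \<i> * of_real (extend_zero D \<gamma> (snd \<mu>) / 2))
      * exp (of_real (extend_zero K \<theta> (fst \<nu>) / 2) - \<i> * of_real (extend_zero D \<gamma> (snd \<nu>) / 2))
      * of_real (if fst \<mu> < K \<and> fst \<nu> < K then exp (\<alpha> (fst \<mu>) (fst \<nu>)) else 1)) (EE \<mu> ** \<rho>0 ** EE \<nu>))"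
proof -
  define z where "z = (\<lambda>\<mu>. of_real (extend_zero K \<theta> (fst \<mu>) / 2) + \<i> * of_real (extend_zero D \<gamma> (snd \<mu>) / 2))"
  define z' where "z' = (\<lambda>\<mu>. of_real (extend_zero K \<theta> (fst \<mu>) / 2) - \<i> * of_real (extend_zero D \<gamma> (snd \<mu>) / 2))"
  have 1: "(1/2) *\<^sub>R (\<Sum>k<K. \<theta> k *\<^sub>R P k) + csmult (\<i>/2) (\<Sum>j<D. \<gamma> j *\<^sub>R Q j) = (\<Sum>\<mu>\<in>JE. csmult (z \<mu>) (EE \<mu>))"
    unfolding P_combination Q_combination unfolding scaleR_eq_csmult csmult_sum sum.distrib[symmetric]
    by (rule sum.cong) (simp_all add: z_def flip: csmult_distrib)
  have 2: "(1/2) *\<^sub>R (\<Sum>k<K. \<theta> k *\<^sub>R P k) - csmult (\<i>/2) (\<Sum>j<D. \<gamma> j *\<^sub>R Q j) = (\<Sum>\<mu>\<in>JE. csmult (z' \<mu>) (EE \<mu>))"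
    unfolding P_combination Q_combination unfolding scaleR_eq_csmult csmult_sum sum_subtractf[symmetric]
    by (rule sum.cong) (simp_all add: z'_def flip: csmult_distrib)
  have "rho_tilde K P D Q \<rho>0 \<theta> \<gamma> \<alpha> = (\<Sum>\<mu>\<in>JE. csmult (exp (z \<mu>)) (EE \<mu>)) ** rho_alpha K P \<rho>0 \<alpha> ** (\<Sum>\<mu>\<in>JE. csmult (exp (z' \<mu>)) (EE \<mu>))"
    unfolding rho_tilde_def Let_def 1 2 mexp_combination ..
  also have "\<dots> = (\<Sum>\<nu>\<in>JE. \<Sum>\<mu>\<in>JE. csmult (exp (z \<mu>) * exp (z' \<nu>)) (EE \<mu> ** rho_alpha K P \<rho>0 \<alpha> ** EE \<nu>))"
    by (simp add: matrix_mult_sum csmult_matrix_mult csmult_sum mult.commute)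
  also have "\<dots> = (\<Sum>\<mu>\<in>JE. \<Sum>\<nu>\<in>JE. csmult (exp (z \<mu>) * exp (z' \<nu>)) (EE \<mu> ** rho_alpha K P \<rho>0 \<alpha> ** EE \<nu>))"
    by (rule sum.swap)
  finally show ?thesis by (simp add: EE_rho_alpha[OF _ _ sym] z_def z'_def)
qed

end

section \<open>The quantum filter\<close>

lemma linear_matrix_mult_left:
  fixes A :: "'n::finite cmat"
  shows "linear (\<lambda>r::'n cmat. A ** r)"
  by (rule linearI) (simp_all add: matrix_mult_add scaleR_eq_csmult csmult_matrix_mult)

lemma linear_matrix_mult_right:
  fixes A :: "'n::finite cmat"
  shows "linear (\<lambda>r::'n cmat. r ** A)"
  by (rule linearI) (simp_all add: matrix_mult_add scaleR_eq_csmult csmult_matrix_mult)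

lemma linear_mtrace: "linear (mtrace :: 'n::finite cmat \<Rightarrow> complex)"
  by (rule linearI) (simp_all add: mtrace_linear scaleR_eq_csmult scaleR_conv_of_real)

lemma linear_component: "linear (\<lambda>r::'n::finite cmat. r $ i $ j)"
  by (rule linearI) simp_all

lemma continuous_csmult:
  fixes f :: "'a::topological_space \<Rightarrow> 'n::finite cmat"
  assumes "continuous_on S g" "continuous_on S f"
  shows "continuous_on S (\<lambda>x. csmult (g x) (f x))"
  unfolding csmult_def using assms by (intro continuous_intros continuous_on_vec_lambda)

lemma continuous_linear_compose:
  fixes f :: "'b::euclidean_space \<Rightarrow> 'c::real_normed_vector"
  assumes "linear f" "continuous_on S g" shows "continuous_on S (\<lambda>x. f (g x))"
  using continuous_on_compose2[OF linear_continuous_on[OF assms(1)[unfolded linear_conv_bounded_linear], of UNIV] assms(2)] by auto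

lemma continuous_qf_diffusion: "continuous_on S (qf_diffusion \<eta> L)"
proof -
  have "continuous_on S (\<lambda>r. mtrace ((L + cadj L) ** r))"
    by (intro continuous_linear_compose[OF linear_mtrace] continuous_linear_compose[OF linear_matrix_mult_left] continuous_on_id)
  then show ?thesis unfolding qf_diffusion_def[abs_def]
    by (intro continuous_intros continuous_csmult continuous_linear_compose[OF linear_matrix_mult_left]
        continuous_linear_compose[OF linear_matrix_mult_right])
qed

lemma continuous_qf_drift: "continuous_on S (qf_drift H L)"
  unfolding qf_drift_def[abs_def] commutator_def
  by (intro continuous_intros continuous_csmult continuous_linear_compose[OF linear_matrix_mult_left]
        continuous_linear_compose[OF linear_matrix_mult_right])

text \<open>The weighted square \<open>f\<close> has nonpositive derivative and starts at
  \<open>0\<close>; squaring avoids differentiating an absolute value.\<close>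

lemma gronwall_zero:
  fixes j :: "real \<Rightarrow> real"
  assumes t: "0 \<le> t" and j: "continuous_on {0..t} j"
    and J: "\<And>u. u \<in> {0..t} \<Longrightarrow> J u = integral {0..u} j"
    and le: "\<And>u. u \<in> {0..t} \<Longrightarrow> \<bar>j u\<bar> \<le> C * \<bar>J u\<bar>"
  shows "J t = 0"
proof (cases "t = 0")
  case True
  then show ?thesis using J by simp
next
  case False
  with t have t: "0 < t" by simp
  define I where "I = (\<lambda>u. integral {0..u} j)"
  define f where "f = (\<lambda>u. (I u)\<^sup>2 * exp (- 2 * C * u))"
  have ji: "j integrable_on {0..t}" by (rule integrable_continuous_real[OF j])
  have cI: "continuous_on {0..t} I" unfolding I_def by (rule indefinite_integral_continuous_1[OF ji])
  have "f t \<le> f 0"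
  proof (rule DERIV_nonpos_imp_decreasing_open[where f = f])
    fix x assume x: "0 < x" "x < t"
    have "(I has_real_derivative j x) (at x within {0..t})"
      unfolding I_def by (rule integral_has_real_derivative[OF j]) (use x in auto)
    then have d: "(I has_real_derivative j x) (at x)"
      using x at_within_interior[of x "{0..t}"] by (simp only: interior_atLeastAtMost_real greaterThanLessThan_iff)
    have "(f has_real_derivative (2 * I x * j x - 2 * C * (I x)\<^sup>2) * exp (- 2 * C * x)) (at x)"
      unfolding f_def
      by (rule DERIV_cong, (rule derivative_eq_intros d refl)+) (simp add: algebra_simps power2_eq_square)
    moreover have "(2 * I x * j x - 2 * C * (I x)\<^sup>2) * exp (- 2 * C * x) \<le> 0"
    proof -
      have "I x * j x \<le> \<bar>I x\<bar> * \<bar>j x\<bar>" by (metis abs_ge_self abs_mult)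
      also have "\<dots> \<le> \<bar>I x\<bar> * (C * \<bar>I x\<bar>)"
        using le[of x] J[of x] x by (intro mult_left_mono) (auto simp: I_def)
      also have "\<dots> = C * (I x)\<^sup>2" by (simp add: power2_eq_square)
      finally show ?thesis by (simp add: mult_nonpos_nonneg)
    qed
    ultimately show "\<exists>y. DERIV f x :> y \<and> y \<le> 0" by blast
  next
    show "continuous_on {0..t} f" unfolding f_def using cI by (intro continuous_intros)
  qed (use t in auto)
  moreover have "f 0 = 0" by (simp add: f_def I_def)
  moreover have "0 \<le> f t" by (simp add: f_def)
  ultimately have "(I t)\<^sup>2 \<le> 0" by (simp add: f_def mult_le_0_iff)
  then have "I t = 0" by simp
  then show ?thesis using J[of t] t by (simp add: I_def)
qed

section \<open>Blocks, populations and trace of the filter as scalar equations\<close>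

locale quantum_filter = wiener M F W + resolution J E
  for M :: "'a measure" and F W and J :: "'i set" and E :: "'i \<Rightarrow> 'n::finite cmat" +
  fixes \<eta> :: real and H L \<rho>0 :: "'n cmat" and \<rho> :: "real \<Rightarrow> 'a \<Rightarrow> 'n cmat" and lam \<beta> :: "'i \<Rightarrow> real"
  assumes \<eta>: "0 < \<eta>"
    and L_eq: "L = (\<Sum>i\<in>J. csmult (of_real (lam i)) (E i))"
    and H_eq: "H = (\<Sum>i\<in>J. csmult (of_real (\<beta> i)) (E i))"
    and L_hermitian: "cadj L = L" and E_hermitian: "\<And>i. i \<in> J \<Longrightarrow> hermitian (E i)"
    and \<rho>0: "density_matrix \<rho>0"
    and solves: "solves_quantum_filter M F W \<eta> H L \<rho>0 \<rho>"
begin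

lemma LE: "i \<in> J \<Longrightarrow> L ** E i = csmult (of_real (lam i)) (E i)" "i \<in> J \<Longrightarrow> E i ** L = csmult (of_real (lam i)) (E i)"
  unfolding L_eq by (simp_all add: combination_mult)

lemma HE: "i \<in> J \<Longrightarrow> H ** E i = csmult (of_real (\<beta> i)) (E i)" "i \<in> J \<Longrightarrow> E i ** H = csmult (of_real (\<beta> i)) (E i)"
  unfolding H_eq by (simp_all add: combination_mult)

text \<open>Complex-valued, since \<open>solves_quantum_filter\<close> does not state that the
  solution is Hermitian; \<open>obs_process\<close> takes the real part.\<close>

definition meas :: "'n cmat \<Rightarrow> complex" where "meas r = mtrace ((L + cadj L) ** r)"

definition \<mu> :: "real \<Rightarrow> 'a \<Rightarrow> complex" where "\<mu> u \<omega> = meas (\<rho> u \<omega>)"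

abbreviation c :: real where "c \<equiv> sqrt \<eta>"

lemma linear_meas: "linear meas"
  unfolding meas_def[abs_def] using linear_compose[OF linear_matrix_mult_left linear_mtrace] by (simp add: comp_def)

lemma \<rho>_facts: "\<omega> \<in> space M \<Longrightarrow> \<rho> 0 \<omega> = \<rho>0" "continuous_paths \<rho>" "adapted \<rho>"
  using solves by (auto simp: solves_quantum_filter_def continuous_paths_def adapted_def)

lemma linear_continuous_paths:
  fixes \<phi> :: "'n cmat \<Rightarrow> complex"
  assumes "linear \<phi>" shows "continuous_paths (\<lambda>u \<omega>. \<phi> (\<rho> u \<omega>))"
  using \<rho>_facts(2) unfolding continuous_paths_def by (auto intro: continuous_linear_compose[OF assms])

lemma linear_adapted:
  fixes \<phi> :: "'n cmat \<Rightarrow> complex"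
  assumes "linear \<phi>" shows "adapted (\<lambda>u \<omega>. \<phi> (\<rho> u \<omega>))"
proof -
  have "\<phi> \<in> borel_measurable borel"
    by (intro borel_measurable_continuous_onI continuous_linear_compose[OF assms] continuous_on_id)
  then show ?thesis using \<rho>_facts(3) unfolding adapted_def by (auto intro: measurable_compose)
qed

lemma \<mu>_adapted: "adapted \<mu>" and \<mu>_continuous: "continuous_paths \<mu>"
  unfolding \<mu>_def[abs_def] using linear_adapted[OF linear_meas] linear_continuous_paths[OF linear_meas] by auto

text \<open>A linear functional commutes with Riemann sums and with the drift integral, and its
  boundedness preserves convergence in probability. The constant \<open>\<kappa>\<close> makes room
  for \<open>1 - Tr\<close>, which is affine but not linear.\<close>

lemma lin_sol_functional:
  fixes \<phi> :: "'n cmat \<Rightarrow> complex" and \<kappa> a :: complex and s :: real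
  assumes \<phi>: "linear \<phi>"
    and drift: "\<And>r. \<phi> (qf_drift H L r) = a * (\<kappa> + \<phi> r)"
    and diffusion: "\<And>r. \<phi> (qf_diffusion \<eta> L r) = of_real c * (of_real s - meas r) * (\<kappa> + \<phi> r)"
  shows "lin_sol c \<mu> a s (\<lambda>u \<omega>. \<kappa> + \<phi> (\<rho> u \<omega>))"
  unfolding lin_sol_def
proof (intro conjI allI impI)
  show "continuous_paths (\<lambda>u \<omega>. \<kappa> + \<phi> (\<rho> u \<omega>))"
    using linear_continuous_paths[OF \<phi>] unfolding continuous_paths_def by (auto intro!: continuous_intros)
  show "adapted (\<lambda>u \<omega>. \<kappa> + \<phi> (\<rho> u \<omega>))"
    using linear_adapted[OF \<phi>] unfolding adapted_def by (auto intro!: borel_measurable_add)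
  have bl: "bounded_linear \<phi>" using \<phi> by (simp add: linear_conv_bounded_linear)
  have \<phi>m: "\<phi> \<in> borel_measurable borel"
    by (intro borel_measurable_continuous_onI continuous_linear_compose[OF \<phi>] continuous_on_id)
  fix t :: real assume t: "0 \<le> t"
  obtain I where I: "is_ito_integral M (\<lambda>u \<omega>. qf_diffusion \<eta> L (\<rho> u \<omega>)) W t I"
    and eq: "AE \<omega> in M. \<rho> t \<omega> = \<rho>0 + integral {0..t} (\<lambda>u. qf_drift H L (\<rho> u \<omega>)) + I \<omega>"
    using solves t unfolding solves_quantum_filter_def by blast
  have Im: "I \<in> borel_measurable M" using I by (simp add: is_ito_integral_def)
  let ?D = "\<lambda>u \<omega>. qf_diffusion \<eta> L (\<rho> u \<omega>)"
  obtain B where B: "0 < B" "\<And>x. norm (\<phi> x) \<le> norm x * B"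
    using bounded_linear.pos_bounded[OF bl] by blast
  have RS: "riemann_sum (\<lambda>u \<omega>. \<phi> (?D u \<omega>)) W t N \<omega> = \<phi> (riemann_sum ?D W t N \<omega>)" for N \<omega>
    unfolding riemann_sum_def by (simp add: linear_sum[OF \<phi>] linear_scale[OF \<phi>])
  have Dm: "?D u \<in> borel_measurable M" if "0 \<le> u" for u
  proof -
    have "\<rho> u \<in> borel_measurable M" using \<rho>_facts(3) that measurable_F_M unfolding adapted_def by blast
    moreover have "qf_diffusion \<eta> L \<in> borel_measurable borel"
      by (rule borel_measurable_continuous_onI) (rule continuous_qf_diffusion)
    ultimately show ?thesis by (rule measurable_compose)
  qed
  have RSm: "riemann_sum ?D W t N \<in> borel_measurable M" for N
  proof -
    have "W (t * real i / real N) \<in> borel_measurable M" "?D (t * real i / real N) \<in> borel_measurable M" for i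
      using t by (auto intro!: measurable_F_M[OF W_measurable] Dm)
    then show ?thesis unfolding riemann_sum_def[abs_def] by measurable
  qed
  have ito: "is_ito_integral M (\<lambda>u \<omega>. \<phi> (?D u \<omega>)) W t (\<lambda>\<omega>. \<phi> (I \<omega>))"
    unfolding is_ito_integral_def
  proof (intro conjI allI impI)
    show "(\<lambda>\<omega>. \<phi> (I \<omega>)) \<in> borel_measurable M" using measurable_compose[OF Im \<phi>m] .
    fix e :: real assume e: "0 < e"
    have lim: "(\<lambda>N. measure M {\<omega>\<in>space M. e / B < norm (riemann_sum ?D W t N \<omega> - I \<omega>)}) \<longlonglongrightarrow> 0"
      using I e B(1) by (simp add: is_ito_integral_def)
    show "(\<lambda>N. measure M {\<omega>\<in>space M. e < norm (riemann_sum (\<lambda>u \<omega>. \<phi> (?D u \<omega>)) W t N \<omega> - \<phi> (I \<omega>))}) \<longlonglongrightarrow> 0"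
    proof (rule real_tendsto_sandwich[OF _ _ tendsto_const lim])
      show "\<forall>\<^sub>F N in sequentially. measure M {\<omega>\<in>space M. e < norm (riemann_sum (\<lambda>u \<omega>. \<phi> (?D u \<omega>)) W t N \<omega> - \<phi> (I \<omega>))}
         \<le> measure M {\<omega>\<in>space M. e / B < norm (riemann_sum ?D W t N \<omega> - I \<omega>)}"
      proof (intro always_eventually allI finite_measure_mono)
        fix N
        show "{\<omega>\<in>space M. e < norm (riemann_sum (\<lambda>u \<omega>. \<phi> (?D u \<omega>)) W t N \<omega> - \<phi> (I \<omega>))}
          \<subseteq> {\<omega>\<in>space M. e / B < norm (riemann_sum ?D W t N \<omega> - I \<omega>)}"
        proof safe
          fix \<omega> assume "e < norm (riemann_sum (\<lambda>u \<omega>. \<phi> (?D u \<omega>)) W t N \<omega> - \<phi> (I \<omega>))"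
          also have "\<dots> \<le> norm (riemann_sum ?D W t N \<omega> - I \<omega>) * B"
            unfolding RS linear_diff[OF \<phi>, symmetric] by (rule B(2))
          finally show "e / B < norm (riemann_sum ?D W t N \<omega> - I \<omega>)" using B(1) by (simp add: divide_less_eq)
        qed
        show "{\<omega>\<in>space M. e / B < norm (riemann_sum ?D W t N \<omega> - I \<omega>)} \<in> events"
          using RSm[of N] Im by measurable
      qed
    qed (auto intro!: always_eventually)
  qed
  have "AE \<omega> in M. \<kappa> + \<phi> (\<rho> t \<omega>) = \<kappa> + \<phi> (\<rho> 0 \<omega>) + integral {0..t} (\<lambda>u. a * (\<kappa> + \<phi> (\<rho> u \<omega>))) + \<phi> (I \<omega>)"
    using eq AE_space
  proof eventually_elim
    case (elim \<omega>)
    have "continuous_on {0..t} (\<lambda>u. qf_drift H L (\<rho> u \<omega>))"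
      by (rule continuous_on_compose2[OF continuous_qf_drift[of UNIV] continuous_paths_on[OF \<rho>_facts(2) elim(2)]]) simp
    then have "(\<lambda>u. qf_drift H L (\<rho> u \<omega>)) integrable_on {0..t}" by (rule integrable_continuous_real)
    from integral_linear[OF this bl]
    have "\<phi> (integral {0..t} (\<lambda>u. qf_drift H L (\<rho> u \<omega>))) = integral {0..t} (\<lambda>u. a * (\<kappa> + \<phi> (\<rho> u \<omega>)))"
      by (simp add: comp_def drift)
    then show ?case unfolding elim(1) by (simp add: linear_add[OF \<phi>] \<rho>_facts(1)[OF elim(2)])
  qed
  with ito show "\<exists>I. is_ito_integral M (\<lambda>u \<omega>. of_real c * (of_real s - \<mu> u \<omega>) * (\<kappa> + \<phi> (\<rho> u \<omega>))) W t I \<and>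
        (AE \<omega> in M. \<kappa> + \<phi> (\<rho> t \<omega>) = \<kappa> + \<phi> (\<rho> 0 \<omega>) + integral {0..t} (\<lambda>u. a * (\<kappa> + \<phi> (\<rho> u \<omega>))) + I \<omega>)"
    unfolding diffusion \<mu>_def by blast
qed

text \<open>On a block, \<open>L\<close> acts as \<open>lam i\<close> from the left and as
  \<open>lam j\<close> from the right, so the dissipative part contributes
  \<open>lam i lam j - (lam i ^ 2 + lam j ^ 2) / 2\<close>, which is minus half a square; the
  commutator gives the phase.\<close>

lemma block_drift:
  assumes "i \<in> J" "j \<in> J"
  shows "E i ** qf_drift H L r ** E j = csmult (- \<i> * of_real (\<beta> i - \<beta> j) - of_real ((lam i - lam j)\<^sup>2) / 2) (E i ** r ** E j)"
proof -
  let ?X = "E i ** r ** E j"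
  have 1: "E i ** (A ** r) ** E j = (E i ** A) ** r ** E j" "E i ** (r ** A) ** E j = E i ** r ** (A ** E j)" for A
    by (simp_all add: matrix_mul_assoc)
  have a: "E i ** (H ** r) ** E j = csmult (of_real (\<beta> i)) ?X" "E i ** (r ** H) ** E j = csmult (of_real (\<beta> j)) ?X"
    unfolding 1 HE[OF assms(1)] HE[OF assms(2)] by (simp_all add: csmult_matrix_mult)
  have b: "E i ** (L ** r ** L) ** E j = csmult (of_real (lam i * lam j)) ?X"
  proof -
    have "E i ** (L ** r ** L) ** E j = (E i ** L) ** r ** (L ** E j)" by (simp add: matrix_mul_assoc)
    then show ?thesis by (simp add: LE assms csmult_matrix_mult mult.commute)
  qed
  have d: "E i ** (L ** L ** r) ** E j = csmult (of_real ((lam i)\<^sup>2)) ?X"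
  proof -
    have "E i ** (L ** L ** r) ** E j = (E i ** L) ** L ** r ** E j" by (simp add: matrix_mul_assoc)
    then show ?thesis by (simp add: LE assms csmult_matrix_mult power2_eq_square)
  qed
  have e: "E i ** (r ** L ** L) ** E j = csmult (of_real ((lam j)\<^sup>2)) ?X"
  proof -
    have "E i ** (r ** L ** L) ** E j = E i ** r ** (L ** (L ** E j))" by (simp add: matrix_mul_assoc)
    then show ?thesis by (simp add: LE assms csmult_matrix_mult power2_eq_square)
  qed
  have "E i ** qf_drift H L r ** E j = csmult (- \<i>) (E i ** (H ** r) ** E j - E i ** (r ** H) ** E j) + E i ** (L ** r ** L) ** E j
     - csmult (1/2) (E i ** (L ** L ** r) ** E j + E i ** (r ** L ** L) ** E j)"
    unfolding qf_drift_def commutator_def L_hermitian scaleR_eq_csmult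
    by (simp add: matrix_mult_add matrix_mult_diff csmult_matrix_mult)
  also have "\<dots> = csmult (- \<i> * of_real (\<beta> i - \<beta> j) - of_real ((lam i - lam j)\<^sup>2) / 2) ?X"
    unfolding a b d e by (simp add: vec_eq_iff power2_diff algebra_simps add_divide_distrib diff_divide_distrib)
  finally show ?thesis .
qed

lemma block_diffusion:
  assumes "i \<in> J" "j \<in> J"
  shows "E i ** qf_diffusion \<eta> L r ** E j = csmult (of_real c * (of_real (lam i + lam j) - meas r)) (E i ** r ** E j)"
proof -
  let ?X = "E i ** r ** E j"
  have 1: "E i ** (L ** r) ** E j = csmult (of_real (lam i)) ?X"
  proof -
    have "E i ** (L ** r) ** E j = (E i ** L) ** r ** E j" by (simp add: matrix_mul_assoc)
    then show ?thesis by (simp add: LE assms csmult_matrix_mult)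
  qed
  have 2: "E i ** (r ** L) ** E j = csmult (of_real (lam j)) ?X"
  proof -
    have "E i ** (r ** L) ** E j = E i ** r ** (L ** E j)" by (simp add: matrix_mul_assoc)
    then show ?thesis by (simp add: LE assms csmult_matrix_mult)
  qed
  have "E i ** qf_diffusion \<eta> L r ** E j = csmult (of_real c) (E i ** (L ** r) ** E j + E i ** (r ** L) ** E j - csmult (meas r) ?X)"
    unfolding qf_diffusion_def meas_def[symmetric] unfolding scaleR_eq_csmult L_hermitian
    by (simp add: matrix_mult_add matrix_mult_diff csmult_matrix_mult)
  then show ?thesis unfolding 1 2 by (simp add: vec_eq_iff algebra_simps)
qed

lemma lin_sol_block:
  assumes "i \<in> J" "j \<in> J"
  shows "lin_sol c \<mu> (- \<i> * of_real (\<beta> i - \<beta> j) - of_real ((lam i - lam j)\<^sup>2) / 2) (lam i + lam j)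
    (\<lambda>u \<omega>. (E i ** \<rho> u \<omega> ** E j) $ k $ l)"
proof -
  let ?\<phi> = "\<lambda>r. (E i ** r ** E j) $ k $ l"
  have lin: "linear ?\<phi>"
    using linear_compose[OF linear_compose[OF linear_matrix_mult_left linear_matrix_mult_right] linear_component] by (simp add: comp_def)
  have "lin_sol c \<mu> (- \<i> * of_real (\<beta> i - \<beta> j) - of_real ((lam i - lam j)\<^sup>2) / 2) (lam i + lam j) (\<lambda>u \<omega>. 0 + ?\<phi> (\<rho> u \<omega>))"
    by (rule lin_sol_functional[OF lin]) (simp_all only: block_drift[OF assms] block_diffusion[OF assms] csmult_component add_0)
  then show ?thesis by simp
qed

text \<open>Idempotence and cyclicity of the trace: populations are traces of diagonal
  blocks.\<close>

lemma mtrace_block: "i \<in> J \<Longrightarrow> mtrace (E i ** A) = mtrace (E i ** A ** E i)"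
  using mtrace_commute[of "E i ** A" "E i"] by (simp add: matrix_mul_assoc E_mult)

text \<open>For \<open>i = j\<close> the block rate vanishes, so populations have no drift.\<close>

lemma lin_sol_population:
  assumes "i \<in> J"
  shows "lin_sol c \<mu> 0 (2 * lam i) (\<lambda>u \<omega>. mtrace (E i ** \<rho> u \<omega>))"
proof -
  let ?\<phi> = "\<lambda>r. mtrace (E i ** r)"
  have lin: "linear ?\<phi>"
    using linear_compose[OF linear_matrix_mult_left linear_mtrace] by (simp add: comp_def)
  have "lin_sol c \<mu> 0 (2 * lam i) (\<lambda>u \<omega>. 0 + ?\<phi> (\<rho> u \<omega>))"
    by (rule lin_sol_functional[OF lin])
      (simp_all add: mtrace_block[OF assms] block_drift[OF assms assms] block_diffusion[OF assms assms] mtrace_linear)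
  then show ?thesis by simp
qed

text \<open>By cyclicity the drift is traceless and the diffusion has trace
  \<open>c * meas r * (1 - mtrace r)\<close>, which is the required form with \<open>s = 0\<close>.
  As the defect starts at \<open>0\<close>, its quotient by a nonvanishing solution stays
  \<open>0\<close>.\<close>

lemma lin_sol_trace_defect: "lin_sol c \<mu> 0 0 (\<lambda>u \<omega>. 1 - mtrace (\<rho> u \<omega>))"
proof -
  let ?\<phi> = "\<lambda>r. - mtrace r"
  have lin: "linear ?\<phi>" using linear_compose_neg[OF linear_mtrace] .
  have t1: "mtrace (L ** r ** L) = mtrace (L ** L ** r)" "mtrace (r ** L ** L) = mtrace (L ** L ** r)" "mtrace (r ** H) = mtrace (H ** r)" for r
    using mtrace_commute[of "L ** r" L] mtrace_commute[of r "L ** L"] mtrace_commute[of r H] by (simp_all add: matrix_mul_assoc)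
  have "lin_sol c \<mu> 0 0 (\<lambda>u \<omega>. 1 + ?\<phi> (\<rho> u \<omega>))"
  proof (rule lin_sol_functional[OF lin])
    show "- mtrace (qf_drift H L r) = 0 * (1 + - mtrace r)" for r
      unfolding qf_drift_def commutator_def L_hermitian scaleR_eq_csmult by (simp add: mtrace_linear t1)
    show "- mtrace (qf_diffusion \<eta> L r) = of_real c * (of_real 0 - meas r) * (1 + - mtrace r)" for r
    proof -
      have "meas r = mtrace (L ** r) + mtrace (r ** L)"
        unfolding meas_def L_hermitian matrix_mult_add mtrace_linear using mtrace_commute[of r L] by simp
      then show ?thesis unfolding qf_diffusion_def meas_def[symmetric] unfolding L_hermitian scaleR_eq_csmult
        by (simp add: mtrace_linear algebra_simps)
    qed
  qed
  then show ?thesis by simp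
qed

end

text \<open>From \<open>\<bar>sin x\<bar> \<le> \<bar>x\<bar>\<close>; this turns the imaginary part
  of an exponent into a linear bound for the Gronwall argument.\<close>

lemma abs_Im_exp_le: "\<bar>Im (exp z)\<bar> \<le> norm (exp z) * \<bar>Im z\<bar>"
  by (simp add: Im_exp abs_mult abs_sin_x_le_abs_x mult_left_mono)

section \<open>From quotients to the explicit solution\<close>

context quantum_filter
begin

definition Y :: "real \<Rightarrow> 'a \<Rightarrow> complex" where
  "Y u \<omega> = of_real (W u \<omega>) + of_real c * integral {0..u} (\<lambda>r. \<mu> r \<omega>)"

definition expo :: "complex \<Rightarrow> real \<Rightarrow> real \<Rightarrow> 'a \<Rightarrow> complex" where
  "expo a s u \<omega> = exp (of_real (c * s) * Y u \<omega> + (a - of_real ((c * s)\<^sup>2) / 2) * of_real u)"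

lemma Y_continuous: "\<omega> \<in> space M \<Longrightarrow> continuous_on {0..t} (\<lambda>u. Y u \<omega>)"
proof -
  assume \<omega>: "\<omega> \<in> space M"
  have "continuous_on {0..t} (\<lambda>u. W u \<omega>)"
    using W_continuous[OF \<omega>] by (rule continuous_on_subset) auto
  moreover have "continuous_on {0..t} (\<lambda>u. integral {0..u} (\<lambda>r. \<mu> r \<omega>))"
    by (intro indefinite_integral_continuous_1 integrable_continuous_real continuous_paths_on[OF \<mu>_continuous \<omega>])
  ultimately show ?thesis unfolding Y_def by (intro continuous_intros)
qed

lemma expo_continuous: "\<omega> \<in> space M \<Longrightarrow> continuous_on {0..t} (\<lambda>u. expo a s u \<omega>)"
  unfolding expo_def using Y_continuous by (intro continuous_intros) auto

lemma Y_0: "\<omega> \<in> space M \<Longrightarrow> Y 0 \<omega> = 0"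
  using wiener_process by (simp add: wiener_process_def Y_def)

text \<open>With \<open>h = c (s' - s)\<close> the shift \<open>- c s' h + h^2 / 2\<close> equals
  \<open>((c s)^2 - (c s')^2) / 2\<close>, so the exponential in \<open>lin_sol_ratio\<close> is a
  quotient of two values of \<open>expo\<close>.\<close>

lemma lin_sol_ratio_expo:
  assumes "0 \<le> t" and X: "lin_sol c \<mu> a s X" and X': "lin_sol c \<mu> a' s' X'"
  shows "AE \<omega> in M. (\<forall>u\<in>{0..t}. X' u \<omega> \<noteq> 0) \<longrightarrow> X t \<omega> * X' 0 \<omega> * expo a' s' t \<omega> = X 0 \<omega> * X' t \<omega> * expo a s t \<omega>"
proof -
  define h where "h = - (c * (s - s'))"
  define g where "g = a' - a - of_real (c * s' * h) + of_real (h\<^sup>2) / 2"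
  have ratio: "expo a' s' t \<omega> = exp (of_real h * Y t \<omega> + g * of_real t) * expo a s t \<omega>" for \<omega>
  proof -
    have "of_real (c * s') * Y t \<omega> + (a' - of_real ((c * s')\<^sup>2) / 2) * of_real t
      = (of_real h * Y t \<omega> + g * of_real t) + (of_real (c * s) * Y t \<omega> + (a - of_real ((c * s)\<^sup>2) / 2) * of_real t)"
      unfolding g_def h_def by (simp add: power2_eq_square field_simps)
    then show ?thesis unfolding expo_def by (simp only: exp_add)
  qed
  show ?thesis
    using lin_sol_ratio[OF assms(1) \<mu>_adapted \<mu>_continuous X X' h_def g_def]
  proof eventually_elim
    case (elim \<omega>)
    show ?case
    proof
      assume "\<forall>u\<in>{0..t}. X' u \<omega> \<noteq> 0"
      with elim have *: "exp (of_real h * Y t \<omega> + g * of_real t) * X t \<omega> * X' 0 \<omega> = X 0 \<omega> * X' t \<omega>"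
        by (simp add: Y_def)
      show "X t \<omega> * X' 0 \<omega> * expo a' s' t \<omega> = X 0 \<omega> * X' t \<omega> * expo a s t \<omega>"
        unfolding ratio *[symmetric] by (simp add: mult_ac)
    qed
  qed
qed

text \<open>By continuity it suffices to know the identity at rational times; this also yields it at the
  first zero of the reference solution.\<close>

lemma lin_sol_ratio_all_times:
  assumes X: "lin_sol c \<mu> a s X" and X': "lin_sol c \<mu> a' s' X'"
  shows "AE \<omega> in M. \<forall>t\<ge>0. (\<forall>u\<in>{0..<t}. X' u \<omega> \<noteq> 0) \<longrightarrow>
    X t \<omega> * X' 0 \<omega> * expo a' s' t \<omega> = X 0 \<omega> * X' t \<omega> * expo a s t \<omega>"
proof -
  have "AE \<omega> in M. 0 \<le> real_of_rat q \<longrightarrow> (\<forall>u\<in>{0..real_of_rat q}. X' u \<omega> \<noteq> 0) \<longrightarrow>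
    X (real_of_rat q) \<omega> * X' 0 \<omega> * expo a' s' (real_of_rat q) \<omega> = X 0 \<omega> * X' (real_of_rat q) \<omega> * expo a s (real_of_rat q) \<omega>" for q
    using lin_sol_ratio_expo[of "real_of_rat q", OF _ X X'] by (cases "0 \<le> real_of_rat q") auto
  then have "AE \<omega> in M. \<forall>q. 0 \<le> real_of_rat q \<longrightarrow> (\<forall>u\<in>{0..real_of_rat q}. X' u \<omega> \<noteq> 0) \<longrightarrow>
    X (real_of_rat q) \<omega> * X' 0 \<omega> * expo a' s' (real_of_rat q) \<omega> = X 0 \<omega> * X' (real_of_rat q) \<omega> * expo a s (real_of_rat q) \<omega>"
    by (simp add: AE_all_countable)
  then show ?thesis using AE_space
  proof eventually_elim
    case (elim \<omega>)
    show ?case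
    proof (intro allI impI)
      fix t :: real assume t: "0 \<le> t" and nz: "\<forall>u\<in>{0..<t}. X' u \<omega> \<noteq> 0"
      define f where "f = (\<lambda>u. X u \<omega> * X' 0 \<omega> * expo a' s' u \<omega> - X 0 \<omega> * X' u \<omega> * expo a s u \<omega>)"
      have "f t = 0"
      proof (cases "t = 0")
        case True
        then show ?thesis using elim(2) by (simp add: f_def expo_def Y_0)
      next
        case False
        with t have t: "0 < t" by simp
        \<comment> \<open>The rational times lie strictly below \<open>t\<close>, so that only zeros
          in the half-open interval matter; the lower bound keeps them nonnegative.\<close>
        have "\<exists>q. t - t / real (Suc n) \<le> real_of_rat q \<and> real_of_rat q < t" for n
        proof -
          have "t - t / real (Suc n) < t" using t by simp
          from of_rat_dense[OF this] show ?thesis by (auto intro: less_imp_le)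
        qed
        then obtain q where q: "\<And>n. t - t / real (Suc n) \<le> real_of_rat (q n)" "\<And>n. real_of_rat (q n) < t" by metis
        have q0: "0 \<le> real_of_rat (q n)" for n
        proof -
          have "t / real (Suc n) \<le> t" using t by (simp add: divide_le_eq)
          then show ?thesis using q(1)[of n] by linarith
        qed
        have "f (real_of_rat (q n)) = 0" for n
          using elim(1) q0[of n] q(2)[of n] nz unfolding f_def by auto
        moreover have "(\<lambda>n. real_of_rat (q n)) \<longlonglongrightarrow> t"
        proof (rule real_tendsto_sandwich[where f = "\<lambda>n. t - t / real (Suc n)" and h = "\<lambda>_. t"])
          have "(\<lambda>n. t - t * (1 / real (Suc n))) \<longlonglongrightarrow> t - t * 0"
            by (intro tendsto_intros LIMSEQ_Suc[OF lim_1_over_n])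
          then show "(\<lambda>n. t - t / real (Suc n)) \<longlonglongrightarrow> t" by simp
        qed (use q in \<open>auto intro!: always_eventually less_imp_le\<close>)
        moreover have "continuous_on {0..t} f"
          unfolding f_def using X X' continuous_paths_on elim(2)
          by (intro continuous_intros expo_continuous) (auto simp: lin_sol_def)
        then have "(\<lambda>n. f (real_of_rat (q n))) \<longlonglongrightarrow> f t"
          by (rule continuous_on_tendsto_compose[OF _ calculation(2)])
            (use t q q0 in \<open>auto intro!: always_eventually less_imp_le\<close>)
        ultimately show ?thesis using LIMSEQ_unique[of "\<lambda>_. 0" "0::complex" "f t"] by simp
      qed
      then show "X t \<omega> * X' 0 \<omega> * expo a' s' t \<omega> = X 0 \<omega> * X' t \<omega> * expo a s t \<omega>" by (simp add: f_def)
    qed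
  qed
qed

lemma mtrace_\<rho>0: "mtrace \<rho>0 = 1"
  using \<rho>0 by (simp add: density_matrix_def)

lemma population_real:
  assumes "i \<in> J" shows "cnj (mtrace (E i ** \<rho>0)) = mtrace (E i ** \<rho>0)"
proof -
  have "cadj \<rho>0 = \<rho>0" using \<rho>0 by (simp add: density_matrix_def psd_def hermitian_def)
  moreover have "cadj (E i) = E i" using E_hermitian[OF assms] by (simp add: hermitian_def)
  ultimately show ?thesis
    unfolding mtrace_cadj[symmetric] cadj_mult using mtrace_commute[of \<rho>0 "E i"] by simp
qed

lemma meas_populations: "meas r = (\<Sum>i\<in>J. of_real (2 * lam i) * mtrace (E i ** r))"
proof -
  have "meas r = (\<Sum>i\<in>J. mtrace ((E i ** (L + L)) ** r))"
    unfolding meas_def L_hermitian mtrace_decomposition[of "(L + L) ** r"] by (simp only: matrix_mul_assoc)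
  also have "\<dots> = (\<Sum>i\<in>J. of_real (2 * lam i) * mtrace (E i ** r))"
  proof (rule sum.cong[OF refl])
    fix i assume i: "i \<in> J"
    show "mtrace ((E i ** (L + L)) ** r) = of_real (2 * lam i) * mtrace (E i ** r)"
      unfolding matrix_mult_add LE(2)[OF i] csmult_matrix_mult mtrace_linear by simp
  qed
  finally show ?thesis .
qed

abbreviation rate :: "'i \<Rightarrow> 'i \<Rightarrow> complex" where
  "rate i j \<equiv> - \<i> * of_real (\<beta> i - \<beta> j) - of_real ((lam i - lam j)\<^sup>2) / 2"

text \<open>The coefficient \<open>\<mu>\<close> is not known to be real beforehand: \<open>Im \<mu>\<close> is bounded by a multiple of \<open>Im Y\<close>,
  since \<open>\<mu>\<close> is a real function of \<open>Y\<close>.\<close>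

lemma filter_pathwise:
  "AE \<omega> in M. \<forall>t\<ge>0. Im (Y t \<omega>) = 0 \<and> mtrace (\<rho> t \<omega>) = 1 \<and>
     (\<exists>\<theta>. \<rho> t \<omega> = csmult \<theta> (\<Sum>i\<in>J. \<Sum>j\<in>J. csmult (expo (rate i j) (lam i + lam j) t \<omega>) (E i ** \<rho>0 ** E j)))"
proof -
  have "(\<Sum>i\<in>J. mtrace (E i ** \<rho>0)) \<noteq> 0"
    unfolding mtrace_decomposition[symmetric] by (simp add: mtrace_\<rho>0)
  \<comment> \<open>The initial trace is \<open>1\<close>, so some population starts away from
    \<open>0\<close>; it becomes the common denominator.\<close>
  then obtain m where m: "m \<in> J" "mtrace (E m ** \<rho>0) \<noteq> 0" by (meson sum.not_neutral_contains_not_neutral)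
  define y where "y = (\<lambda>u \<omega>. mtrace (E m ** \<rho> u \<omega>))"
  define e0 where "e0 = expo 0 (2 * lam m)"
  note yl = lin_sol_population[OF m(1), folded y_def]
  have A1: "AE \<omega> in M. \<forall>i\<in>J. \<forall>j\<in>J. \<forall>k l. \<forall>t\<ge>0. (\<forall>u\<in>{0..<t}. y u \<omega> \<noteq> 0) \<longrightarrow>
    (E i ** \<rho> t \<omega> ** E j) $ k $ l * y 0 \<omega> * e0 t \<omega> = (E i ** \<rho> 0 \<omega> ** E j) $ k $ l * y t \<omega> * expo (rate i j) (lam i + lam j) t \<omega>"
    unfolding e0_def
    by (intro AE_finite_allI finite_J AE_all_countable[THEN iffD2] allI lin_sol_ratio_all_times lin_sol_block yl)
  have A2: "AE \<omega> in M. \<forall>i\<in>J. \<forall>t\<ge>0. (\<forall>u\<in>{0..<t}. y u \<omega> \<noteq> 0) \<longrightarrow>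
    mtrace (E i ** \<rho> t \<omega>) * y 0 \<omega> * e0 t \<omega> = mtrace (E i ** \<rho> 0 \<omega>) * y t \<omega> * expo 0 (2 * lam i) t \<omega>"
    unfolding e0_def by (intro AE_finite_allI finite_J lin_sol_ratio_all_times lin_sol_population yl)
  have A3: "AE \<omega> in M. \<forall>t\<ge>0. (\<forall>u\<in>{0..<t}. y u \<omega> \<noteq> 0) \<longrightarrow>
    (1 - mtrace (\<rho> t \<omega>)) * y 0 \<omega> * e0 t \<omega> = (1 - mtrace (\<rho> 0 \<omega>)) * y t \<omega> * expo 0 0 t \<omega>"
    unfolding e0_def by (intro lin_sol_ratio_all_times lin_sol_trace_defect yl)
  show ?thesis using A1 A2 A3 AE_space
  proof eventually_elim
    case (elim \<omega>)
    have \<omega>: "\<omega> \<in> space M" by fact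
    have r0: "\<rho> 0 \<omega> = \<rho>0" using \<rho>_facts(1)[OF \<omega>] .
    have y0: "y 0 \<omega> \<noteq> 0" using m(2) by (simp add: y_def r0)
    have e0: "e0 t \<omega> \<noteq> 0" for t by (simp add: e0_def expo_def)
    have cy: "continuous_on {0..t} (\<lambda>u. y u \<omega>)" for t
      using yl unfolding lin_sol_def by (intro continuous_paths_on[OF _ \<omega>]) blast
    have tr: "mtrace (\<rho> t \<omega>) = 1" if "0 \<le> t" "\<forall>u\<in>{0..<t}. y u \<omega> \<noteq> 0" for t
    proof -
      have "(1 - mtrace (\<rho> t \<omega>)) * y 0 \<omega> * e0 t \<omega> = (1 - mtrace (\<rho> 0 \<omega>)) * y t \<omega> * expo 0 0 t \<omega>"
        using elim(3) that by blast
      then show ?thesis using y0 e0[of t] by (simp add: r0 mtrace_\<rho>0)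
    qed
    have ynz: "y t \<omega> \<noteq> 0" if t: "0 \<le> t" for t
    proof
      assume yt: "y t \<omega> = 0"
      define Z where "Z = {u \<in> {0..t}. y u \<omega> = 0}"
      have "closed Z" unfolding Z_def
        using continuous_closed_preimage_constant[OF cy closed_atLeastAtMost] .
      moreover have Zne: "Z \<noteq> {}" and Zb: "bdd_below Z" using t yt by (auto simp: Z_def)
      ultimately have "Inf Z \<in> Z" using closed_contains_Inf by blast
      then have \<tau>: "0 \<le> Inf Z" "Inf Z \<le> t" "y (Inf Z) \<omega> = 0" by (auto simp: Z_def)
      have before: "\<forall>u\<in>{0..<Inf Z}. y u \<omega> \<noteq> 0"
      proof (intro ballI notI)
        fix u assume u: "u \<in> {0..<Inf Z}" "y u \<omega> = 0"
        then have "u \<in> Z" using \<tau> by (auto simp: Z_def)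
        then show False using cInf_lower[OF _ Zb, of u] u by auto
      qed
      have "mtrace (E i ** \<rho> (Inf Z) \<omega>) = 0" if "i \<in> J" for i
      proof -
        have "mtrace (E i ** \<rho> (Inf Z) \<omega>) * y 0 \<omega> * e0 (Inf Z) \<omega> = 0"
          using elim(2) that \<tau> before by auto
        then show ?thesis using y0 e0 by simp
      qed
      then have "mtrace (\<rho> (Inf Z) \<omega>) = 0" by (simp add: mtrace_decomposition[of "\<rho> (Inf Z) \<omega>"])
      with tr[OF \<tau>(1) before] show False by simp
    qed
    \<comment> \<open>The factor shared by all blocks; it is not yet known to be real.\<close>
    define \<theta> where "\<theta> = (\<lambda>t. y t \<omega> / (y 0 \<omega> * e0 t \<omega>))"
    have pop: "mtrace (E i ** \<rho> t \<omega>) = mtrace (E i ** \<rho>0) * (\<theta> t * expo 0 (2 * lam i) t \<omega>)" if "i \<in> J" "0 \<le> t" for i t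
    proof -
      have "mtrace (E i ** \<rho> t \<omega>) * y 0 \<omega> * e0 t \<omega> = mtrace (E i ** \<rho>0) * y t \<omega> * expo 0 (2 * lam i) t \<omega>"
        using elim(2) that ynz unfolding r0 by auto
      then show ?thesis using y0 e0[of t] by (simp add: \<theta>_def field_simps)
    qed
    have blk: "(E i ** \<rho> t \<omega> ** E j) $ k $ l = \<theta> t * expo (rate i j) (lam i + lam j) t \<omega> * (E i ** \<rho>0 ** E j) $ k $ l"
      if "i \<in> J" "j \<in> J" "0 \<le> t" for i j t k l
    proof -
      have "(E i ** \<rho> t \<omega> ** E j) $ k $ l * y 0 \<omega> * e0 t \<omega> = (E i ** \<rho>0 ** E j) $ k $ l * y t \<omega> * expo (rate i j) (lam i + lam j) t \<omega>"
        using elim(1) that ynz unfolding r0 by auto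
      then show ?thesis using y0 e0[of t] by (simp add: \<theta>_def field_simps)
    qed
    have tr1: "mtrace (\<rho> t \<omega>) = 1" if "0 \<le> t" for t using tr that ynz by simp
    have ImY: "Im (Y t \<omega>) = 0" if t: "0 \<le> t" for t
    proof -
      define f where "f = (\<lambda>i u. \<theta> u * expo 0 (2 * lam i) u \<omega>)"
      define p where "p = (\<lambda>i. Re (mtrace (E i ** \<rho>0)))"
      have p: "mtrace (E i ** \<rho>0) = of_real (p i)" if "i \<in> J" for i
        using population_real[OF that] unfolding p_def by (metis Reals_cnj_iff of_real_Re)
      have x: "mtrace (E i ** \<rho> u \<omega>) = of_real (p i) * f i u" if "i \<in> J" "0 \<le> u" for i u
        using pop[OF that] p[OF that(1)] by (simp add: f_def)
      have one: "(\<Sum>j\<in>J. of_real (p j) * f j u) = 1" if "0 \<le> u" for u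
        using tr1[OF that] x[OF _ that] unfolding mtrace_decomposition[of "\<rho> u \<omega>"] by simp
      \<comment> \<open>Multiplication by the conjugate of \<open>1 = Tr \<rho>\<close> pairs each
        \<open>f i\<close> with a conjugated \<open>f j\<close>. The unknown phase of
        \<open>\<theta>\<close> cancels in these pairs, apart from \<open>Y\<close> only real
        quantities remain.\<close>
      have mu: "\<mu> u \<omega> = (\<Sum>i\<in>J. \<Sum>j\<in>J. of_real (2 * lam i * p i * p j) * (f i u * cnj (f j u)))" if "0 \<le> u" for u
      proof -
        have "\<mu> u \<omega> = (\<Sum>i\<in>J. of_real (2 * lam i) * (of_real (p i) * f i u))"
          unfolding \<mu>_def meas_populations using x that by simp
        also have "\<dots> = (\<Sum>i\<in>J. of_real (2 * lam i) * (of_real (p i) * f i u)) * cnj (\<Sum>j\<in>J. of_real (p j) * f j u)"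
          unfolding one[OF that] by simp
        also have "\<dots> = (\<Sum>i\<in>J. \<Sum>j\<in>J. of_real (2 * lam i * p i * p j) * (f i u * cnj (f j u)))"
          unfolding cnj_sum sum_product by (intro sum.cong refl) (simp add: mult_ac)
        finally show ?thesis .
      qed
      have cf: "continuous_on {0..t} (f i)" for i
        unfolding f_def \<theta>_def using y0 e0 expo_continuous[OF \<omega>] cy
        by (intro continuous_intros) (auto simp: e0_def)
      have "\<forall>i. \<exists>B. \<forall>u\<in>{0..t}. norm (f i u) \<le> B"
        using continuous_on_bounded[OF cf] by metis
      then obtain B where B: "\<And>i u. u \<in> {0..t} \<Longrightarrow> norm (f i u) \<le> B i" by metis
      have B0: "0 \<le> B i" for i using B[of 0 i] t order_trans[OF norm_ge_zero] by auto
      have Imf: "\<bar>Im (f i u * cnj (f j u))\<bar> \<le> B i * B j * \<bar>2 * c * (lam i - lam j)\<bar> * \<bar>Im (Y u \<omega>)\<bar>" if u: "u \<in> {0..t}" for i j u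
      proof -
        define z where "z = (\<lambda>i. of_real (c * (2 * lam i)) * Y u \<omega> + (0 - of_real ((c * (2 * lam i))\<^sup>2) / 2) * of_real u)"
        have ex: "expo 0 (2 * lam i) u \<omega> = exp (z i)" for i by (simp add: expo_def z_def)
        have eq: "f i u * cnj (f j u) = of_real ((norm (\<theta> u))\<^sup>2) * exp (z i + cnj (z j))"
          unfolding f_def ex complex_norm_square by (simp add: exp_add exp_cnj mult_ac)
        \<comment> \<open>The time-dependent corrections in the exponents are real for populations,
          so only \<open>Im Y\<close> survives.\<close>
        have Imz: "Im (z i + cnj (z j)) = 2 * c * (lam i - lam j) * Im (Y u \<omega>)"
          by (simp add: z_def algebra_simps)
        have "\<bar>Im (f i u * cnj (f j u))\<bar> = (norm (\<theta> u))\<^sup>2 * \<bar>Im (exp (z i + cnj (z j)))\<bar>"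
          unfolding eq by (simp add: abs_mult del: of_real_power)
        also have "\<dots> \<le> (norm (\<theta> u))\<^sup>2 * (norm (exp (z i + cnj (z j))) * \<bar>Im (z i + cnj (z j))\<bar>)"
          by (intro mult_left_mono abs_Im_exp_le) simp
        also have "\<dots> = norm (f i u * cnj (f j u)) * \<bar>2 * c * (lam i - lam j) * Im (Y u \<omega>)\<bar>"
          unfolding eq Imz by (simp add: norm_mult norm_power)
        also have "\<dots> \<le> (B i * B j) * \<bar>2 * c * (lam i - lam j) * Im (Y u \<omega>)\<bar>"
          unfolding norm_mult complex_mod_cnj using B[OF u] B0 by (intro mult_right_mono mult_mono) auto
        finally show ?thesis by (simp add: abs_mult mult_ac)
      qed
      define C where "C = c * (\<Sum>i\<in>J. \<Sum>j\<in>J. \<bar>2 * lam i * p i * p j\<bar> * (B i * B j * \<bar>2 * c * (lam i - lam j)\<bar>))"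
      have c\<mu>: "continuous_on {0..u} (\<lambda>r. \<mu> r \<omega>)" for u using continuous_paths_on[OF \<mu>_continuous \<omega>] .
      have c0: "0 \<le> c" using \<eta> by simp
      show ?thesis
      proof (rule gronwall_zero[where j = "\<lambda>u. c * Im (\<mu> u \<omega>)" and C = C and t = t, OF t])
        show "continuous_on {0..t} (\<lambda>u. c * Im (\<mu> u \<omega>))" using c\<mu> by (intro continuous_intros)
        fix u assume u: "u \<in> {0..t}"
        have "(\<lambda>r. \<mu> r \<omega>) integrable_on {0..u}" by (rule integrable_continuous_real[OF c\<mu>])
        from integral_linear[OF this bounded_linear_Im]
        show "Im (Y u \<omega>) = integral {0..u} (\<lambda>u. c * Im (\<mu> u \<omega>))"
          by (simp add: Y_def comp_def)
        have "\<bar>Im (\<mu> u \<omega>)\<bar> \<le> (\<Sum>i\<in>J. \<Sum>j\<in>J. \<bar>2 * lam i * p i * p j\<bar> * (B i * B j * \<bar>2 * c * (lam i - lam j)\<bar> * \<bar>Im (Y u \<omega>)\<bar>))"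
        proof -
          have Imof: "Im (of_real r * z) = r * Im z" for r z by simp
          have eq: "Im (\<mu> u \<omega>) = (\<Sum>i\<in>J. \<Sum>j\<in>J. 2 * lam i * p i * p j * Im (f i u * cnj (f j u)))"
            using u by (simp only: mu atLeastAtMost_iff Im_sum Imof)
          show ?thesis unfolding eq
            by (rule order_trans[OF sum_abs], rule sum_mono, rule order_trans[OF sum_abs], rule sum_mono, subst abs_mult,
                intro mult_left_mono Imf u abs_ge_zero)
        qed
        then have "c * \<bar>Im (\<mu> u \<omega>)\<bar> \<le> c * (\<Sum>i\<in>J. \<Sum>j\<in>J. \<bar>2 * lam i * p i * p j\<bar> * (B i * B j * \<bar>2 * c * (lam i - lam j)\<bar> * \<bar>Im (Y u \<omega>)\<bar>))"
          by (rule mult_left_mono[OF _ c0])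
        also have "\<dots> = C * \<bar>Im (Y u \<omega>)\<bar>"
          unfolding C_def by (simp only: sum_distrib_right sum_distrib_left mult.assoc)
        finally show "\<bar>c * Im (\<mu> u \<omega>)\<bar> \<le> C * \<bar>Im (Y u \<omega>)\<bar>" using c0 by (simp add: abs_mult)
      qed
    qed
    show ?case
    proof (intro allI impI conjI ImY tr1)
      fix t :: real assume t: "0 \<le> t"
      have "E i ** \<rho> t \<omega> ** E j = csmult (\<theta> t) (csmult (expo (rate i j) (lam i + lam j) t \<omega>) (E i ** \<rho>0 ** E j))" if "i \<in> J" "j \<in> J" for i j
        using blk[OF that t] by (simp add: vec_eq_iff)
      then have "\<rho> t \<omega> = csmult (\<theta> t) (\<Sum>i\<in>J. \<Sum>j\<in>J. csmult (expo (rate i j) (lam i + lam j) t \<omega>) (E i ** \<rho>0 ** E j))"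
        using block_decomposition[of "\<rho> t \<omega>"] by (simp add: csmult_sum)
      then show "\<exists>\<theta>. \<rho> t \<omega> = csmult \<theta> (\<Sum>i\<in>J. \<Sum>j\<in>J. csmult (expo (rate i j) (lam i + lam j) t \<omega>) (E i ** \<rho>0 ** E j))" by blast
    qed
  qed
qed

lemma Re_Y: "\<omega> \<in> space M \<Longrightarrow> Re (Y t \<omega>) = obs_process W \<eta> L \<rho> t \<omega>"
proof -
  assume \<omega>: "\<omega> \<in> space M"
  have "(\<lambda>r. \<mu> r \<omega>) integrable_on {0..t}"
    by (rule integrable_continuous_real[OF continuous_paths_on[OF \<mu>_continuous \<omega>]])
  from integral_linear[OF this bounded_linear_Re] show ?thesis
    by (simp add: Y_def obs_process_def comp_def \<mu>_def meas_def)
qed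

text \<open>The scalar factor in \<open>filter_pathwise\<close> is determined by the trace.\<close>

lemma filter_normalized:
  assumes t: "0 \<le> t"
  shows "AE \<omega> in M. (let R = (\<Sum>i\<in>J. \<Sum>j\<in>J. csmult (exp (of_real (c * (lam i + lam j) * obs_process W \<eta> L \<rho> t \<omega>)
       + (rate i j - of_real ((c * (lam i + lam j))\<^sup>2) / 2) * of_real t)) (E i ** \<rho>0 ** E j))
     in \<rho> t \<omega> = csmult (1 / mtrace R) R)"
  using filter_pathwise AE_space
proof eventually_elim
  case (elim \<omega>)
  define R where "R = (\<Sum>i\<in>J. \<Sum>j\<in>J. csmult (expo (rate i j) (lam i + lam j) t \<omega>) (E i ** \<rho>0 ** E j))"
  obtain \<theta> where \<theta>: "\<rho> t \<omega> = csmult \<theta> R" using elim(1) t unfolding R_def by blast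
  have im: "Im (Y t \<omega>) = 0" and tr: "mtrace (\<rho> t \<omega>) = 1" using elim(1) t by blast+
  \<comment> \<open>The equation also shows that the trace of \<open>R\<close> is nonzero, so
    normalising by it is legitimate.\<close>
  have "\<theta> * mtrace R = 1" using tr unfolding \<theta> mtrace_linear .
  then have inv: "\<theta> = 1 / mtrace R" by (metis eq_divide_imp mult_zero_right zero_neq_one)
  have Y: "Y t \<omega> = of_real (obs_process W \<eta> L \<rho> t \<omega>)"
    using im Re_Y[OF elim(2)] by (simp add: complex_eq_iff)
  have "expo a s t \<omega> = exp (of_real (c * s * obs_process W \<eta> L \<rho> t \<omega>) + (a - of_real ((c * s)\<^sup>2) / 2) * of_real t)" for a s
    unfolding expo_def Y by simp
  then have R: "R = (\<Sum>i\<in>J. \<Sum>j\<in>J. csmult (exp (of_real (c * (lam i + lam j) * obs_process W \<eta> L \<rho> t \<omega>)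
       + (rate i j - of_real ((c * (lam i + lam j))\<^sup>2) / 2) * of_real t)) (E i ** \<rho>0 ** E j))"
    unfolding R_def by (simp only:)
  show ?case unfolding Let_def R[symmetric] using \<theta> inv by simp
qed

end

text \<open>The equation for \<open>\<theta>\<close> has constant coefficients and the observation
  process starts at \<open>0\<close>, so its solution is entered in integrated form. What remains is
  to match its exponents with those of \<open>filter_normalized\<close> block by block.\<close>

theorem theorem1:
  fixes M :: "'a measure" and F :: "real \<Rightarrow> 'a measure" and W :: "real \<Rightarrow> 'a \<Rightarrow> real"
    and H L \<rho>0 :: "'n::finite cmat" and \<rho> :: "real \<Rightarrow> 'a \<Rightarrow> 'n cmat"
    and K D :: nat and lam :: "nat \<Rightarrow> real" and \<beta> :: "nat \<Rightarrow> real"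
    and P Q :: "nat \<Rightarrow> 'n cmat" and \<eta> t :: real
  assumes "hermitian H" and "hermitian L" and "commutator H L = 0"
    and "0 < \<eta>" and "\<eta> \<le> 1"
    and "L = (\<Sum>k<K. lam k *\<^sub>R P k)" and "H = (\<Sum>j<D. \<beta> j *\<^sub>R Q j)"
    and "\<forall>k<K. hermitian (P k)" and "\<forall>j<D. hermitian (Q j)"
    and "\<forall>k<K. \<forall>l<K. P k ** P l = kdelta k l *\<^sub>R P l"
    and "\<forall>j<D. \<forall>l<D. Q j ** Q l = kdelta j l *\<^sub>R Q l"
    and "\<forall>k<K. \<forall>j<D. commutator (P k) (Q j) = 0"
    and "wiener_process M F W"
    and "density_matrix \<rho>0"
    and "solves_quantum_filter M F W \<eta> H L \<rho>0 \<rho>"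
    and "0 \<le> t"
  shows "AE \<omega> in M.
    (let Y = obs_process W \<eta> L \<rho> t \<omega>;
         \<theta> = (\<lambda>k. - (1 + \<eta>) * (lam k)\<^sup>2 * t + 2 * sqrt \<eta> * lam k * Y);
         \<gamma> = (\<lambda>j. - 2 * \<beta> j * t);
         \<alpha> = (\<lambda>k j. (1 - \<eta>) * lam k * lam j * t);
         R = rho_tilde K P D Q \<rho>0 \<theta> \<gamma> \<alpha>
     in \<rho> t \<omega> = csmult (1 / mtrace R) R)"
proof -
  interpret commuting_projections K D P Q
    by unfold_locales (fact assms)+
  define l where "l = (\<lambda>\<mu>::nat \<times> nat. extend_zero K lam (fst \<mu>))"
  define b where "b = (\<lambda>\<mu>::nat \<times> nat. extend_zero D \<beta> (snd \<mu>))"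
  interpret quantum_filter M F W JE EE \<eta> H L \<rho>0 \<rho> l b
  proof unfold_locales
    show "L = (\<Sum>i\<in>JE. csmult (complex_of_real (l i)) (EE i))"
      unfolding l_def P_combination[symmetric] by (rule assms)
    show "H = (\<Sum>i\<in>JE. csmult (complex_of_real (b i)) (EE i))"
      unfolding b_def Q_combination[symmetric] by (rule assms)
    show "cadj L = L" using assms(2) by (simp add: hermitian_def)
    show "hermitian (EE i)" for i by (rule EE_hermitian)
  qed (fact assms)+
  show ?thesis using filter_normalized[OF assms(16)]
  proof eventually_elim
    case (elim \<omega>)
    define y where "y = obs_process W \<eta> L \<rho> t \<omega>"
    define \<theta> where "\<theta> = (\<lambda>k. - (1 + \<eta>) * (lam k)\<^sup>2 * t + 2 * sqrt \<eta> * lam k * y)"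
    define \<gamma> where "\<gamma> = (\<lambda>j. - 2 * \<beta> j * t)"
    define \<alpha> where "\<alpha> = (\<lambda>k j. (1 - \<eta>) * lam k * lam j * t)"
    have \<theta>: "extend_zero K \<theta> (fst \<mu>) = - (1 + \<eta>) * (l \<mu>)\<^sup>2 * t + 2 * sqrt \<eta> * l \<mu> * y" for \<mu>
      by (simp add: extend_zero_def \<theta>_def l_def)
    have \<gamma>: "extend_zero D \<gamma> (snd \<mu>) = - 2 * b \<mu> * t" for \<mu>
      by (simp add: extend_zero_def \<gamma>_def b_def)
    \<comment> \<open>The added index carries the eigenvalue \<open>0\<close>, so the default factor
      \<open>1\<close> is a value of the same exponential.\<close>
    have \<alpha>: "(if fst \<mu> < K \<and> fst \<nu> < K then exp (\<alpha> (fst \<mu>) (fst \<nu>)) else 1) = exp ((1 - \<eta>) * l \<mu> * l \<nu> * t)" for \<mu> \<nu> :: "nat \<times> nat"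
      by (auto simp: extend_zero_def \<alpha>_def l_def)
    have c2: "(c * x)\<^sup>2 = \<eta> * x\<^sup>2" for x using assms(4) by (simp add: power_mult_distrib)
    have coeff: "exp (of_real (extend_zero K \<theta> (fst \<mu>) / 2) + \<i> * of_real (extend_zero D \<gamma> (snd \<mu>) / 2))
      * exp (of_real (extend_zero K \<theta> (fst \<nu>) / 2) - \<i> * of_real (extend_zero D \<gamma> (snd \<nu>) / 2))
      * of_real (if fst \<mu> < K \<and> fst \<nu> < K then exp (\<alpha> (fst \<mu>) (fst \<nu>)) else 1)
      = exp (of_real (c * (l \<mu> + l \<nu>) * y) + (rate \<mu> \<nu> - of_real ((c * (l \<mu> + l \<nu>))\<^sup>2) / 2) * of_real t)" for \<mu> \<nu>
    proof -
      \<comment> \<open>The real parts match after expanding the squares with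
        \<open>c^2 = \<eta>\<close>. The imaginary parts \<open>- b \<mu> * t\<close> from the left
        and \<open>b \<nu> * t\<close> from the right add up to the phase of the commutator.\<close>
      have re: "(- (1 + \<eta>) * (l \<mu>)\<^sup>2 * t + 2 * c * l \<mu> * y) / 2 + (- (1 + \<eta>) * (l \<nu>)\<^sup>2 * t + 2 * c * l \<nu> * y) / 2 + (1 - \<eta>) * l \<mu> * l \<nu> * t
        = c * (l \<mu> + l \<nu>) * y + (- (l \<mu> - l \<nu>)\<^sup>2 / 2 - (c * (l \<mu> + l \<nu>))\<^sup>2 / 2) * t"
        unfolding c2 by (simp add: power2_eq_square field_simps)
      show ?thesis
        unfolding \<theta> \<gamma> \<alpha> exp_of_real[symmetric] exp_add[symmetric]
        by (rule arg_cong[where f = exp], rule complex_eqI) (use re in \<open>simp_all add: algebra_simps\<close>)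
    qed
    have sym: "\<alpha> k j = \<alpha> j k" for k j by (simp add: \<alpha>_def)
    have "rho_tilde K P D Q \<rho>0 \<theta> \<gamma> \<alpha> = (\<Sum>\<mu>\<in>JE. \<Sum>\<nu>\<in>JE. csmult (exp (of_real (c * (l \<mu> + l \<nu>) * y)
       + (rate \<mu> \<nu> - of_real ((c * (l \<mu> + l \<nu>))\<^sup>2) / 2) * of_real t)) (EE \<mu> ** \<rho>0 ** EE \<nu>))"
      unfolding rho_tilde_expansion[OF sym] coeff ..
    then show ?case
      using elim unfolding Let_def y_def[symmetric] \<theta>_def[symmetric] \<gamma>_def[symmetric] \<alpha>_def[symmetric] by simp
  qed
qed

end
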